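(* Let $N\ge 2$, let $\gamma>0$, and let $a,b,c\in\mathbb{R}$ satisfy either (A1) $0<b<\min\{a,c\}$ or (A2) $a,c>0$ and $b>\max\{a,c\}$. Let $\omega>\frac{\gamma^2}{N^2}$ satisfy $N\sqrt{\omega}-\gamma\le\frac{2\gamma}{N}$. Let $\Phi_{\omega,\gamma}=(\phi_{\omega,\gamma},\dots,\phi_{\omega,\gamma})$ ($N$ equal components) with $\phi_{\omega,\gamma}(x)=\sqrt{2\omega}\,\operatorname{sech}\left(\sqrt\omega\,x+\tanh^{-1}\left(\frac{\gamma}{N\sqrt\omega}\right)\right)$. Then the standing wave solution $$\left(e^{i\omega t}\sqrt{\tfrac{b-c}{b^2-ac}}\,\Phi_{\omega,\gamma},\ e^{i\omega t}\sqrt{\tfrac{b-a}{b^2-ac}}\,\Phi_{\omega,\gamma}\right)$$ of the system $$\begin{cases} i\partial_tu+\Delta_\gamma u+(a|u|^2+b|v|^2)u=0\\ i\partial_tv+\Delta_\gamma v+(b|u|^2+c|v|^2)v=0\end{cases}$$ on the star graph $\Gamma$ is orbitally stable in $X$.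
   Context: $\Gamma$ is the star graph made of $N\ge2$ half-lines $I_e=\mathbb{R}^+$, $e=1,\dots,N$, joined at the common vertex $0$. A function $u$ on $\Gamma$ is a vector $u=(u_e)_{e=1}^N$ of functions $u_e:\mathbb{R}^+\to\mathbb{C}$; nonlinear terms are taken componentwise. For $k=1,2$, $H^k(\Gamma)$ is the set of $u$ with $u_e\in H^k(\mathbb{R}^+)$ for all $e$ and $u_1(0)=\dots=u_N(0)$; $\|u\|_{H^1}^2=\sum_e\|u_e\|_{H^1(\mathbb{R}^+)}^2$. $X=H^1(\Gamma)\times H^1(\Gamma)$ with $\|(u,v)\|_X^2=\|u\|_{H^1}^2+\|v\|_{H^1}^2$, and $X^*$ is its dual. $-\Delta_\gamma$ is the self-adjoint operator on $L^2(\Gamma)=\bigoplus_{e=1}^N L^2(\mathbb{R}^+)$ given by $(-\Delta_\gamma v)_e=-v_e''$ on the domain $\{v\in H^2(\Gamma):\sum_{e=1}^Nv_e'(0)=-\gamma v_1(0)\}$ (extended to a bounded operator $H^1(\Gamma)\to (H^1(\Gamma))^*$ through its quadratic form $\|v'\|_2^2-\gamma|v_1(0)|^2$). For every $(u_0,v_0)\in X$ the system has a unique global solution in $C(\mathbb{R},X)\cap C^1(\mathbb{R},X^* )$ with $(u(0),v(0))=(u_0,v_0)$. A standing wave $(e^{i\omega t}\Phi_1,e^{i\omega t}\Phi_2)$ is orbitally stable in $X$ if for every $\epsilon>0$ there is $\eta>0$ such that if $(u_0,v_0)\in X$ satisfies $\|(u_0,v_0)-(\Phi_1,\Phi_2)\|_X<\eta$,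 then the solution with $(u(0),v(0))=(u_0,v_0)$ satisfies $\sup_{t\ge0}\inf_{\theta_1,\theta_2\in\mathbb{R}}\|(u(t),v(t))-(e^{i\theta_1}\Phi_1,e^{i\theta_2}\Phi_2)\|_X<\epsilon$. *)

theory Defs
  imports "HOL-Analysis.Analysis"
begin

text \<open>
  Functions on the half-line are total functions \<open>real \<Rightarrow> complex\<close> of which only the values on
  \<open>[0,\<infinity>)\<close> matter; functions on the star graph with \<open>N\<close> edges are families
  \<open>nat \<Rightarrow> real \<Rightarrow> complex\<close> of which only the components \<open>1, \<dots>, N\<close> matter.
\<close>

type_synonym halfline_fun = "real \<Rightarrow> complex"
type_synonym graph_fun = "nat \<Rightarrow> real \<Rightarrow> complex"


section \<open>Sobolev spaces\<close>

definition L2_halfline :: "halfline_fun set" where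
  "L2_halfline = {f. set_borel_measurable lborel {0..} f \<and>
                     set_integrable lborel {0..} (\<lambda>x. (cmod (f x))\<^sup>2)}"

text \<open>
  The weak derivative on \<open>(0,\<infinity>)\<close>, tested against functions of class \<open>C\<^sup>1\<close> with compact
  support in \<open>(0,\<infinity>)\<close> (as in Brezis' textbook). Real test functions suffice by linearity.
\<close>

definition weak_derivative :: "halfline_fun \<Rightarrow> halfline_fun \<Rightarrow> bool" where
  "weak_derivative f g \<longleftrightarrow>
     (\<forall>(\<phi>::real \<Rightarrow> real) \<phi>' \<alpha> \<beta>.
        (\<forall>x. (\<phi> has_real_derivative \<phi>' x) (at x)) \<and> continuous_on UNIV \<phi>' \<and>
        0 < \<alpha> \<and> (\<forall>x. x \<notin> {\<alpha>..\<beta>} \<longrightarrow> \<phi> x = 0) \<longrightarrow>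
        (LINT x:{0..}|lborel. f x * of_real (\<phi>' x)) = - (LINT x:{0..}|lborel. g x * of_real (\<phi> x)))"

text \<open>
  An element of \<open>H\<^sup>1(\<real>\<^sup>+)\<close> is represented by its continuous representative on \<open>[0,\<infinity>)\<close>, so
  that its trace at the vertex is the value \<open>f 0\<close>.
\<close>

definition H1_halfline :: "halfline_fun set" where
  "H1_halfline = {f. continuous_on {0..} f \<and> f \<in> L2_halfline \<and>
                     (\<exists>g\<in>L2_halfline. weak_derivative f g)}"

text \<open>The weak derivative is unique up to null sets; only its integrals are used below.\<close>

definition wderiv :: "halfline_fun \<Rightarrow> halfline_fun" where
  "wderiv f = (SOME g. g \<in> L2_halfline \<and> weak_derivative f g)"

definition H1_graph :: "nat \<Rightarrow> graph_fun set" where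
  "H1_graph N = {u. (\<forall>e\<in>{1..N}. u e \<in> H1_halfline) \<and> (\<forall>e\<in>{1..N}. u e 0 = u 1 0)}"

definition H1_halfline_norm :: "halfline_fun \<Rightarrow> real" where
  "H1_halfline_norm f = sqrt ((LINT x:{0..}|lborel. (cmod (f x))\<^sup>2) +
                              (LINT x:{0..}|lborel. (cmod (wderiv f x))\<^sup>2))"

definition H1_norm :: "nat \<Rightarrow> graph_fun \<Rightarrow> real" where
  "H1_norm N u = sqrt (\<Sum>e=1..N. (H1_halfline_norm (u e))\<^sup>2)"

definition X_norm :: "nat \<Rightarrow> graph_fun \<Rightarrow> graph_fun \<Rightarrow> real" where
  "X_norm N u v = sqrt ((H1_norm N u)\<^sup>2 + (H1_norm N v)\<^sup>2)"

definition X_dist :: "nat \<Rightarrow> graph_fun \<times> graph_fun \<Rightarrow> graph_fun \<times> graph_fun \<Rightarrow> real" where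
  "X_dist N p q = X_norm N (\<lambda>e x. fst p e x - fst q e x) (\<lambda>e x. snd p e x - snd q e x)"


section \<open>The dual space\<close>

text \<open>
  The dual of \<open>H\<^sup>1(\<Gamma>)\<close> is realised by bounded antilinear functionals, so that the
  embedding \<open>u \<mapsto> (w \<mapsto> L2_inner N u w)\<close> of \<open>H\<^sup>1(\<Gamma>)\<close> into it is linear. The dual of
  \<open>X = H\<^sup>1(\<Gamma>) \<times> H\<^sup>1(\<Gamma>)\<close> is the product of two copies of it.
\<close>

definition L2_inner :: "nat \<Rightarrow> graph_fun \<Rightarrow> graph_fun \<Rightarrow> complex" where
  "L2_inner N u w = (\<Sum>e=1..N. LINT x:{0..}|lborel. u e x * cnj (w e x))"

definition H1_dual :: "nat \<Rightarrow> (graph_fun \<Rightarrow> complex) set" where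
  "H1_dual N = {F.
     (\<forall>w\<in>H1_graph N. \<forall>z\<in>H1_graph N. F (\<lambda>e x. w e x + z e x) = F w + F z) \<and>
     (\<forall>k. \<forall>w\<in>H1_graph N. F (\<lambda>e x. k * w e x) = cnj k * F w) \<and>
     (\<exists>C. \<forall>w\<in>H1_graph N. cmod (F w) \<le> C * H1_norm N w)}"

definition dual_norm :: "nat \<Rightarrow> (graph_fun \<Rightarrow> complex) \<Rightarrow> real" where
  "dual_norm N F = (SUP w\<in>{w\<in>H1_graph N. H1_norm N w \<le> 1}. cmod (F w))"

text \<open>
  \<open>u\<close>, viewed as a curve in the dual of \<open>H\<^sup>1(\<Gamma>)\<close>, is continuously differentiable with
  derivative \<open>du\<close>.
\<close>

definition C1_dual :: "nat \<Rightarrow> (real \<Rightarrow> graph_fun) \<Rightarrow> (real \<Rightarrow> graph_fun \<Rightarrow> complex) \<Rightarrow> bool" where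
  "C1_dual N u du \<longleftrightarrow>
     (\<forall>t. du t \<in> H1_dual N) \<and>
     (\<forall>t. ((\<lambda>s. dual_norm N (\<lambda>w. (L2_inner N (u s) w - L2_inner N (u t) w) / of_real (s - t)
                                  - du t w)) \<longlongrightarrow> 0) (at t)) \<and>
     (\<forall>t. ((\<lambda>s. dual_norm N (\<lambda>w. du s w - du t w)) \<longlongrightarrow> 0) (at t))"


section \<open>The coupled Schroedinger system\<close>

text \<open>
  \<open>- \<Delta>\<^sub>\<gamma>\<close> as an operator from \<open>H\<^sup>1(\<Gamma>)\<close> to its dual: the sesquilinear form whose quadratic
  form is \<open>\<parallel>v'\<parallel>\<^sup>2 - \<gamma> |v\<^sub>1(0)|\<^sup>2\<close>. The condition \<open>\<Sum>\<^sub>e v\<^sub>e'(0) = - \<gamma> v\<^sub>1(0)\<close> of the operator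
  domain is the natural boundary condition of this form.
\<close>

definition minus_Delta :: "nat \<Rightarrow> real \<Rightarrow> graph_fun \<Rightarrow> graph_fun \<Rightarrow> complex" where
  "minus_Delta N \<gamma> u w =
     (\<Sum>e=1..N. LINT x:{0..}|lborel. wderiv (u e) x * cnj (wderiv (w e) x))
       - of_real \<gamma> * u 1 0 * cnj (w 1 0)"

definition cubic :: "real \<Rightarrow> real \<Rightarrow> graph_fun \<Rightarrow> graph_fun \<Rightarrow> graph_fun" where
  "cubic p q u v = (\<lambda>e x. of_real (p * (cmod (u e x))\<^sup>2 + q * (cmod (v e x))\<^sup>2) * u e x)"

text \<open>
  Global solutions in \<open>C(\<real>,X) \<inter> C\<^sup>1(\<real>,X\<^sup>*)\<close>; both equations hold in the dual of \<open>H\<^sup>1(\<Gamma>)\<close> at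
  every time.
\<close>

definition global_solution ::
  "nat \<Rightarrow> real \<Rightarrow> real \<Rightarrow> real \<Rightarrow> real \<Rightarrow> (real \<Rightarrow> graph_fun) \<Rightarrow> (real \<Rightarrow> graph_fun) \<Rightarrow> bool" where
  "global_solution N \<gamma> a b c u v \<longleftrightarrow>
     (\<forall>t. u t \<in> H1_graph N \<and> v t \<in> H1_graph N) \<and>
     (\<forall>t. ((\<lambda>s. X_dist N (u s, v s) (u t, v t)) \<longlongrightarrow> 0) (at t)) \<and>
     (\<exists>du dv. C1_dual N u du \<and> C1_dual N v dv \<and>
        (\<forall>t. \<forall>w\<in>H1_graph N.
           \<i> * du t w - minus_Delta N \<gamma> (u t) w + L2_inner N (cubic a b (u t) (v t)) w = 0 \<and>
           \<i> * dv t w - minus_Delta N \<gamma> (v t) w + L2_inner N (cubic c b (v t) (u t)) w = 0))"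


section \<open>Standing waves and orbital stability\<close>

definition phase_rotate :: "real \<Rightarrow> graph_fun \<Rightarrow> graph_fun" where
  "phase_rotate \<theta> \<Phi> = (\<lambda>e x. cis \<theta> * \<Phi> e x)"

text \<open>
  Supremum and infimum are taken in \<open>ereal\<close>, so that the supremum of an unbounded set is
  \<open>\<infinity>\<close> rather than an unspecified real number. Since the Cauchy problem is well-posed in \<open>X\<close>,
  quantifying over all solutions with initial value \<open>(u\<^sub>0,v\<^sub>0)\<close> means taking the unique one.
\<close>

definition orbitally_stable ::
  "nat \<Rightarrow> real \<Rightarrow> real \<Rightarrow> real \<Rightarrow> real \<Rightarrow> graph_fun \<Rightarrow> graph_fun \<Rightarrow> bool" where
  "orbitally_stable N \<gamma> a b c \<Phi>1 \<Phi>2 \<longleftrightarrow>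
     (\<forall>\<epsilon>>0. \<exists>\<eta>>0. \<forall>u\<^sub>0\<in>H1_graph N. \<forall>v\<^sub>0\<in>H1_graph N.
        X_dist N (u\<^sub>0, v\<^sub>0) (\<Phi>1, \<Phi>2) < \<eta> \<longrightarrow>
        (\<forall>u v. global_solution N \<gamma> a b c u v \<and> u 0 = u\<^sub>0 \<and> v 0 = v\<^sub>0 \<longrightarrow>
           (SUP t\<in>{0..}. INF \<theta>1. INF \<theta>2.
              ereal (X_dist N (u t, v t) (phase_rotate \<theta>1 \<Phi>1, phase_rotate \<theta>2 \<Phi>2))) < ereal \<epsilon>))"

definition soliton :: "nat \<Rightarrow> real \<Rightarrow> real \<Rightarrow> real \<Rightarrow> real" where
  "soliton N \<omega> \<gamma> x =
     sqrt (2 * \<omega>) * (1 / cosh (sqrt \<omega> * x + artanh (\<gamma> / (real N * sqrt \<omega>))))"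

definition soliton_graph :: "nat \<Rightarrow> real \<Rightarrow> real \<Rightarrow> real \<Rightarrow> graph_fun" where
  "soliton_graph N \<omega> \<gamma> k = (\<lambda>e x. of_real (k * soliton N \<omega> \<gamma> x))"

end

theory Submission
  imports Defs
begin

text \<open>
  Write \<open>k1, k2\<close> for the two amplitudes; then \<open>a k1\<^sup>2 + b k2\<^sup>2 = b k1\<^sup>2 + c k2\<^sup>2 = 1\<close>. As \<open>b > 0\<close>, the
  quartic energy density of \<open>(u,v)\<close> is at most the sum of those of two uncoupled cubic equations for
  \<open>u / k1\<close> and \<open>v / k2\<close>, with equality on multiples of a common profile. The energy of the system
  therefore dominates two scalar energies, both masses are conserved, and it suffices to show that
  the scalar soliton \<open>\<phi>\<close> is, modulo phase, a nondegenerate minimum of the scalar energy at fixed mass.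

  If the phase is chosen so that the perturbation \<open>w\<close> of \<open>\<phi>\<close> is real at the vertex, the second
  variation of the action is bounded below by \<open>\<Sum>\<^sub>e \<integral> |w'|\<^sup>2 + (\<omega> - 3 \<phi>\<^sup>2) |w|\<^sup>2 - \<gamma> |w(0)|\<^sup>2\<close>. With
  \<open>Q = - \<phi>' / \<phi>\<close>, which solves \<open>Q' = \<omega> - Q\<^sup>2\<close>, completing the square \<open>|w' - A w - t F|\<^sup>2\<close> edge by edge
  makes this form coercive up to a multiple of the square of \<open>\<Sum>\<^sub>e \<integral> \<phi> Re w\<close>, which conservation of
  mass makes negligible. A continuity argument in time then traps the solution near the orbit.
\<close>

section \<open>Square-integrable functions on the half-line\<close>

text \<open>The form in the overview is indefinite: at \<phi> itself it equals -2 times the integral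
  of \<phi>^4 over the graph, so the mass constraint has to enter the square and not merely follow
  it. With the logarithmic derivative of \<phi>' alone, completing the square leaves on each edge
  the vertex deficit -((\<omega> - q^2)/q) w(0)^2, where q = \<gamma>/N. The extra term t F trades
  this deficit for a pairing of w with \<phi>: for t = \<phi>(0) w(0) the deficit cancels exactly
  and a positive multiple of w(0)^2 survives. Continuity at the vertex gives all edges the same t,
  so the edges decouple.

  The phase is fixed by the value at the vertex and not by an orthogonality condition. The imaginary
  part of w then vanishes there, and on such functions the form with potential \<omega> - 3 \<phi>^2
  is still coercive, so one inequality covers real and imaginary parts together. The price is a
  phase that is discontinuous where the vertex value vanishes.\<close>

abbreviation hl :: "real measure" where
  "hl \<equiv> restrict_space lborel {0..}"

lemma space_hl [simp]: "space hl = {0..}"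
  by (simp add: space_restrict_space)

lemma set_lebesgue_integral_hl:
  fixes f :: "real \<Rightarrow> 'a::{banach, second_countable_topology}"
  shows "(LINT x:{0..}|lborel. f x) = integral\<^sup>L hl f"
  by (simp add: set_lebesgue_integral_def integral_restrict_space)

lemma set_integrable_hl:
  fixes f :: "real \<Rightarrow> 'a::{banach, second_countable_topology}"
  shows "set_integrable lborel {0..} f \<longleftrightarrow> integrable hl f"
  by (simp add: set_integrable_def integrable_restrict_space)

lemma set_borel_measurable_hl:
  fixes f :: "real \<Rightarrow> 'a::real_normed_vector"
  shows "set_borel_measurable lborel {0..} f \<longleftrightarrow> f \<in> borel_measurable hl"
  by (simp add: set_borel_measurable_def borel_measurable_restrict_space_iff)

lemma continuous_measurable_hl:
  fixes f :: "real \<Rightarrow> 'a::topological_space"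
  assumes "continuous_on {0..} f"
  shows "f \<in> borel_measurable hl"
  using borel_measurable_continuous_on_restrict[OF assms]
  by (subst measurable_cong_sets[OF sets_restrict_space_cong[OF sets_lborel] refl]) simp

lemma L2_iff: "f \<in> L2_halfline \<longleftrightarrow> f \<in> borel_measurable hl \<and> integrable hl (\<lambda>x. (cmod (f x))\<^sup>2)"
  by (simp add: L2_halfline_def set_integrable_hl set_borel_measurable_hl)

lemma L2_measurable [measurable_dest]: "f \<in> L2_halfline \<Longrightarrow> f \<in> borel_measurable hl"
  and L2_integrable_sq: "f \<in> L2_halfline \<Longrightarrow> integrable hl (\<lambda>x. (cmod (f x))\<^sup>2)"
  by (simp_all add: L2_iff)

lemma two_mult_le: "2 * (x * y) \<le> x\<^sup>2 + y\<^sup>2" for x y :: real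
  using sum_squares_bound[of x y] by (simp add: mult.assoc)

lemma L2_dominated:
  assumes f: "f \<in> L2_halfline" and g: "g \<in> borel_measurable hl"
    and le: "\<And>x. 0 \<le> x \<Longrightarrow> cmod (g x) \<le> C * cmod (f x)"
  shows "g \<in> L2_halfline"
proof -
  have "integrable hl (\<lambda>x. (cmod (g x))\<^sup>2)"
  proof (rule Bochner_Integration.integrable_bound)
    show "integrable hl (\<lambda>x. C\<^sup>2 * (cmod (f x))\<^sup>2)"
      using L2_integrable_sq[OF f] by simp
    show "(\<lambda>x. (cmod (g x))\<^sup>2) \<in> borel_measurable hl" using g by measurable
    show "AE x in hl. norm ((cmod (g x))\<^sup>2) \<le> norm (C\<^sup>2 * (cmod (f x))\<^sup>2)"
    proof (rule AE_I2)
      fix x assume "x \<in> space hl"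
      then have "(cmod (g x))\<^sup>2 \<le> (C * cmod (f x))\<^sup>2" by (intro power_mono le) auto
      then show "norm ((cmod (g x))\<^sup>2) \<le> norm (C\<^sup>2 * (cmod (f x))\<^sup>2)"
        by (simp add: power_mult_distrib)
    qed
  qed
  then show ?thesis using g by (simp add: L2_iff)
qed

lemma L2_scale: "f \<in> L2_halfline \<Longrightarrow> (\<lambda>x. k * f x) \<in> L2_halfline"
  by (rule L2_dominated[where C="cmod k"]) (auto simp: norm_mult intro!: borel_measurable_times L2_measurable)

lemma L2_cnj: "f \<in> L2_halfline \<Longrightarrow> (\<lambda>x. cnj (f x)) \<in> L2_halfline"
  by (rule L2_dominated[where C=1]) (auto intro!: L2_measurable measurable_compose[OF _ borel_measurable_continuous_onI[OF continuous_on_cnj[OF continuous_on_id]]])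

lemma L2_uminus: "f \<in> L2_halfline \<Longrightarrow> (\<lambda>x. - f x) \<in> L2_halfline"
  by (rule L2_dominated[where C=1]) (auto intro!: L2_measurable)

lemma L2_mult_bounded:
  assumes f: "f \<in> L2_halfline" and g: "g \<in> borel_measurable hl"
    and le: "\<And>x. 0 \<le> x \<Longrightarrow> cmod (g x) \<le> C"
  shows "(\<lambda>x. g x * f x) \<in> L2_halfline"
  using le by (intro L2_dominated[OF f, where C=C])
    (auto simp: norm_mult intro!: mult_right_mono borel_measurable_times g L2_measurable[OF f])

lemma L2_integrable_norm_mult:
  assumes f: "f \<in> L2_halfline" and g: "g \<in> L2_halfline"
  shows "integrable hl (\<lambda>x. cmod (f x) * cmod (g x))"
proof (rule Bochner_Integration.integrable_bound)
  show "integrable hl (\<lambda>x. (cmod (f x))\<^sup>2 + (cmod (g x))\<^sup>2)"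
    using f g by (simp add: L2_integrable_sq)
  show "(\<lambda>x. cmod (f x) * cmod (g x)) \<in> borel_measurable hl"
    using f g by (auto intro!: borel_measurable_times borel_measurable_norm L2_measurable)
  show "AE x in hl. norm (cmod (f x) * cmod (g x)) \<le> norm ((cmod (f x))\<^sup>2 + (cmod (g x))\<^sup>2)"
  proof (rule AE_I2)
    fix x
    have "0 \<le> cmod (f x) * cmod (g x)" by simp
    then have "cmod (f x) * cmod (g x) \<le> (cmod (f x))\<^sup>2 + (cmod (g x))\<^sup>2"
      using two_mult_le[of "cmod (f x)" "cmod (g x)"] by linarith
    then show "norm (cmod (f x) * cmod (g x)) \<le> norm ((cmod (f x))\<^sup>2 + (cmod (g x))\<^sup>2)"
      by (simp add: abs_mult)
  qed
qed

lemma L2_integrable_mult: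
  assumes f: "f \<in> L2_halfline" and g: "g \<in> L2_halfline"
  shows "integrable hl (\<lambda>x. f x * g x)"
  by (rule Bochner_Integration.integrable_bound[OF L2_integrable_norm_mult[OF f g]])
    (auto intro!: borel_measurable_times L2_measurable[OF f] L2_measurable[OF g] simp: norm_mult)

lemma L2_integrable_mult_cnj:
  assumes "f \<in> L2_halfline" "g \<in> L2_halfline"
  shows "integrable hl (\<lambda>x. f x * cnj (g x))"
  using L2_integrable_mult[OF assms(1) L2_cnj[OF assms(2)]] .

lemma cmod_add_sq: "(cmod (x + y))\<^sup>2 = (cmod x)\<^sup>2 + (cmod y)\<^sup>2 + 2 * Re (x * cnj y)"
  unfolding cmod_power2 by (simp add: power2_eq_square algebra_simps)

lemma L2_add:
  assumes f: "f \<in> L2_halfline" and g: "g \<in> L2_halfline"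
  shows "(\<lambda>x. f x + g x) \<in> L2_halfline"
proof -
  have "integrable hl (\<lambda>x. (cmod (f x))\<^sup>2 + (cmod (g x))\<^sup>2 + 2 * Re (f x * cnj (g x)))"
    using f g by (intro Bochner_Integration.integrable_add L2_integrable_sq integrable_mult_right
        integrable_Re L2_integrable_mult_cnj)
  then show ?thesis
    using f g by (auto simp: L2_iff cmod_add_sq)
qed

lemma L2_diff:
  "f \<in> L2_halfline \<Longrightarrow> g \<in> L2_halfline \<Longrightarrow> (\<lambda>x. f x - g x) \<in> L2_halfline"
  using L2_add[OF _ L2_uminus, of f g] by simp

text \<open>Discriminant argument: a quadratic in t that never becomes negative has B^2 \<le> A
  C.\<close>

lemma sqrt_quadratic_triangle:
  fixes A B C :: real
  assumes "\<And>t. 0 \<le> A + 2 * t * B + t\<^sup>2 * C" "0 \<le> A" "0 \<le> C"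
  shows "B \<le> sqrt A * sqrt C"
proof -
  have "B\<^sup>2 \<le> A * C"
  proof (cases "C = 0")
    case True
    have "B = 0"
    proof (rule ccontr)
      assume "B \<noteq> 0"
      \<comment> \<open>For C = 0 the expression is affine in t, and this t gives it the value
        -1.\<close>
      have "0 \<le> A + 2 * (-(A+1)/(2*B)) * B + 0"
        using assms(1)[of "-(A+1)/(2*B)"] True by simp
      also have "\<dots> = -1" using \<open>B \<noteq> 0\<close> by (simp add: field_simps)
      finally show False by simp
    qed
    then show ?thesis using assms by simp
  next
    case False
    then have "C > 0" using assms by simp
    have "0 \<le> A + 2 * (-B/C) * B + (-B/C)\<^sup>2 * C" by (rule assms(1))
    also have "\<dots> = A - B\<^sup>2/C" using \<open>C > 0\<close> by (simp add: field_simps power2_eq_square)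
    finally show ?thesis using \<open>C > 0\<close> by (simp add: field_simps)
  qed
  then have "\<bar>B\<bar> \<le> sqrt (A * C)" by (metis real_sqrt_abs real_sqrt_le_mono)
  then show ?thesis by (simp add: real_sqrt_mult)
qed

section \<open>The L2 norm and the Cauchy-Schwarz inequality\<close>

definition L2norm :: "halfline_fun \<Rightarrow> real" where
  "L2norm f = sqrt (\<integral>x. (cmod (f x))\<^sup>2 \<partial>hl)"

lemma L2norm_nonneg [simp]: "0 \<le> L2norm f"
  by (simp add: L2norm_def)

lemma L2norm_sq: "(L2norm f)\<^sup>2 = (\<integral>x. (cmod (f x))\<^sup>2 \<partial>hl)"
  by (simp add: L2norm_def)

lemma L2norm_scale: "L2norm (\<lambda>x. k * f x) = cmod k * L2norm f"
  by (simp add: L2norm_def norm_mult power_mult_distrib real_sqrt_mult)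

lemma Re_inner_le:
  assumes f: "f \<in> L2_halfline" and g: "g \<in> L2_halfline"
  shows "(\<integral>x. Re (f x * cnj (g x)) \<partial>hl) \<le> L2norm f * L2norm g"
  unfolding L2norm_def
proof (rule sqrt_quadratic_triangle)
  fix t :: real
  have "0 \<le> (\<integral>x. (cmod (f x + of_real t * g x))\<^sup>2 \<partial>hl)" by simp
  also have "\<dots> = (\<integral>x. (cmod (f x))\<^sup>2 + t\<^sup>2 * (cmod (g x))\<^sup>2 + 2 * t * Re (f x * cnj (g x)) \<partial>hl)"
    by (intro Bochner_Integration.integral_cong refl)
       (simp add: cmod_add_sq norm_mult power_mult_distrib algebra_simps)
  also have "\<dots> = (\<integral>x. (cmod (f x))\<^sup>2 \<partial>hl) + 2 * t * (\<integral>x. Re (f x * cnj (g x)) \<partial>hl)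
      + t\<^sup>2 * (\<integral>x. (cmod (g x))\<^sup>2 \<partial>hl)"
    using L2_integrable_sq[OF f] L2_integrable_sq[OF g]
      integrable_Re[OF L2_integrable_mult_cnj[OF f g]]
    by (subst Bochner_Integration.integral_add; (simp del: times_complex.sel)?)+
  finally show "0 \<le> (\<integral>x. (cmod (f x))\<^sup>2 \<partial>hl) + 2 * t * (\<integral>x. Re (f x * cnj (g x)) \<partial>hl)
      + t\<^sup>2 * (\<integral>x. (cmod (g x))\<^sup>2 \<partial>hl)" .
qed auto

text \<open>Multiplying f by the conjugate sign of the integral turns the integral into its modulus,
  which reduces the claim to real parts. The sign of 0 is 0, so this factor has modulus at most
  1.\<close>

lemma inner_le:
  assumes f: "f \<in> L2_halfline" and g: "g \<in> L2_halfline"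
  shows "cmod (\<integral>x. f x * cnj (g x) \<partial>hl) \<le> L2norm f * L2norm g"
proof -
  define I where "I = (\<integral>x. f x * cnj (g x) \<partial>hl)"
  define z where "z = cnj (sgn I)"
  have z: "cmod z \<le> 1" by (simp add: z_def norm_sgn)
  have "cmod I = Re (z * I)"
    by (cases "I = 0") (simp_all add: z_def sgn_eq complex_norm_square[symmetric] power2_eq_square
        complex_eq_iff Re_divide cmod_power2[symmetric, unfolded power2_eq_square] field_simps)
  also have "\<dots> = Re (\<integral>x. z * f x * cnj (g x) \<partial>hl)"
    unfolding I_def by (simp add: mult.assoc)
  also have "\<dots> = (\<integral>x. Re (z * f x * cnj (g x)) \<partial>hl)"
    by (rule integral_Re[symmetric], rule L2_integrable_mult_cnj[OF L2_scale[OF f] g])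
  also have "\<dots> \<le> L2norm (\<lambda>x. z * f x) * L2norm g"
    by (rule Re_inner_le[OF L2_scale[OF f] g])
  also have "\<dots> \<le> L2norm f * L2norm g"
    using z by (simp add: L2norm_scale mult_left_le_one_le mult_right_mono)
  finally show ?thesis unfolding I_def .
qed

lemma L2norm_triangle:
  assumes f: "f \<in> L2_halfline" and g: "g \<in> L2_halfline"
  shows "L2norm (\<lambda>x. f x + g x) \<le> L2norm f + L2norm g"
proof (rule power2_le_imp_le)
  have "(L2norm (\<lambda>x. f x + g x))\<^sup>2
      = (\<integral>x. (cmod (f x))\<^sup>2 + (cmod (g x))\<^sup>2 + 2 * Re (f x * cnj (g x)) \<partial>hl)"
    by (simp add: L2norm_sq cmod_add_sq)
  also have "\<dots> = (L2norm f)\<^sup>2 + (L2norm g)\<^sup>2 + 2 * (\<integral>x. Re (f x * cnj (g x)) \<partial>hl)"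
    using L2_integrable_sq[OF f] L2_integrable_sq[OF g]
      integrable_Re[OF L2_integrable_mult_cnj[OF f g]]
    by (subst Bochner_Integration.integral_add; (simp add: L2norm_sq del: times_complex.sel)?)+
  also have "\<dots> \<le> (L2norm f + L2norm g)\<^sup>2"
    using Re_inner_le[OF f g] by (simp add: power2_sum)
  finally show "(L2norm (\<lambda>x. f x + g x))\<^sup>2 \<le> (L2norm f + L2norm g)\<^sup>2" .
qed simp

lemma L2norm_cong_AE:
  assumes "AE x in hl. f x = g x" "f \<in> L2_halfline" "g \<in> L2_halfline"
  shows "L2norm f = L2norm g"
  unfolding L2norm_def using assms
  by (intro arg_cong[where f=sqrt] integral_cong_AE)
     (auto intro!: borel_measurable_power borel_measurable_norm L2_measurable)

section \<open>Primitives of locally integrable functions\<close>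

text \<open>Local absolute continuity on the closed half-line with derivative g, in the integral
  form of the fundamental theorem. In this form the product rule and the boundary terms come without
  any pointwise differentiability, and g matters only up to null sets.\<close>

definition primitive :: "halfline_fun \<Rightarrow> halfline_fun \<Rightarrow> bool" where
  "primitive f g \<longleftrightarrow>
     (\<forall>x\<ge>0. set_integrable lborel {0..x} g \<and> f x = f 0 + (LINT y:{0..x}|lborel. g y))"

lemma primitive_set_integrable: "primitive f g \<Longrightarrow> set_integrable lborel {0..x} g"
  by (cases "x \<ge> 0") (auto simp: primitive_def)

lemma primitive_eq: "primitive f g \<Longrightarrow> x \<ge> 0 \<Longrightarrow> (LINT y:{0..x}|lborel. g y) = f x - f 0"
  by (metis add_diff_cancel_left' primitive_def)

lemma primitive_add:
  assumes "primitive f g" "primitive f' g'"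
  shows "primitive (\<lambda>x. f x + f' x) (\<lambda>x. g x + g' x)"
  unfolding primitive_def
proof (intro allI impI)
  fix x :: real assume "0 \<le> x"
  have i: "set_integrable lborel {0..x} g" "set_integrable lborel {0..x} g'"
    using assms by (simp_all add: primitive_set_integrable)
  then show "set_integrable lborel {0..x} (\<lambda>x. g x + g' x) \<and>
      f x + f' x = f 0 + f' 0 + (LINT y:{0..x}|lborel. g y + g' y)"
    using primitive_eq[OF assms(1) \<open>0 \<le> x\<close>] primitive_eq[OF assms(2) \<open>0 \<le> x\<close>]
    by (simp add: set_integral_add)
qed

lemma primitive_bounded_linear:
  assumes T: "bounded_linear T" and "primitive f g"
  shows "primitive (\<lambda>x. T (f x)) (\<lambda>x. T (g x))"
  unfolding primitive_def
proof (intro allI impI)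
  interpret T: bounded_linear T by fact
  fix x :: real assume "0 \<le> x"
  have i: "integrable lborel (\<lambda>y. indicator {0..x} y *\<^sub>R g y)"
    using primitive_set_integrable[OF assms(2)] by (simp add: set_integrable_def)
  have "integrable lborel (\<lambda>y. T (indicator {0..x} y *\<^sub>R g y))"
    "(\<integral>y. T (indicator {0..x} y *\<^sub>R g y) \<partial>lborel) = T (\<integral>y. indicator {0..x} y *\<^sub>R g y \<partial>lborel)"
    using integrable_bounded_linear[OF T i] integral_bounded_linear[OF T i] by auto
  then show "set_integrable lborel {0..x} (\<lambda>x. T (g x)) \<and>
      T (f x) = T (f 0) + (LINT y:{0..x}|lborel. T (g y))"
    using primitive_eq[OF assms(2) \<open>0 \<le> x\<close>]
    by (simp add: set_integrable_def set_lebesgue_integral_def T.scaleR T.diff)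
qed

lemma primitive_scale: "primitive f g \<Longrightarrow> primitive (\<lambda>x. k * f x) (\<lambda>x. k * g x)"
  by (rule primitive_bounded_linear[OF bounded_linear_mult_right])

lemma primitive_cnj: "primitive f g \<Longrightarrow> primitive (\<lambda>x. cnj (f x)) (\<lambda>x. cnj (g x))"
  by (rule primitive_bounded_linear[OF bounded_linear_cnj])

lemma primitive_diff:
  assumes "primitive f g" "primitive f' g'"
  shows "primitive (\<lambda>x. f x - f' x) (\<lambda>x. g x - g' x)"
  using primitive_add[OF assms(1) primitive_scale[OF assms(2), of "-1"]] by simp

lemma primitive_C1:
  assumes "\<And>x. 0 \<le> x \<Longrightarrow> (f has_vector_derivative g x) (at x within {0..})"
    and "continuous_on {0..} g"
  shows "primitive f g"
  unfolding primitive_def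
proof (intro allI impI)
  fix x :: real assume "0 \<le> x"
  have c: "continuous_on {0..x} g" using assms(2) by (rule continuous_on_subset) auto
  have "(LINT y:{0..x}|lborel. g y) = f x - f 0"
    unfolding set_lebesgue_integral_def using \<open>0 \<le> x\<close>
    by (intro integral_FTC_atLeastAtMost c)
       (auto intro: has_vector_derivative_within_subset[OF assms(1)])
  then show "set_integrable lborel {0..x} g \<and> f x = f 0 + (LINT y:{0..x}|lborel. g y)"
    using borel_integrable_atLeastAtMost'[OF c] by simp
qed

text \<open>Fubini on the square over [0,X], cut along the diagonal: each triangle gives one of the
  two iterated integrals. This is integration by parts for merely integrable derivatives.\<close>

lemma integral_mult_split:
  fixes g1 g2 :: halfline_fun
  assumes g1: "set_integrable lborel {0..X} g1" and g2: "set_integrable lborel {0..X} g2"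
  shows "set_integrable lborel {0..X} (\<lambda>y. g1 y * (LINT z:{0..y}|lborel. g2 z))" (is ?i1)
    and "set_integrable lborel {0..X} (\<lambda>y. (LINT z:{0..y}|lborel. g1 z) * g2 y)" (is ?i2)
    and "(LINT y:{0..X}|lborel. g1 y * (LINT z:{0..y}|lborel. g2 z)) +
         (LINT y:{0..X}|lborel. (LINT z:{0..y}|lborel. g1 z) * g2 y) =
         (LINT y:{0..X}|lborel. g1 y) * (LINT y:{0..X}|lborel. g2 y)" (is ?eq)
proof -
  define G1 where "G1 = (\<lambda>y. indicator {0..X} y *\<^sub>R g1 y)"
  define G2 where "G2 = (\<lambda>y. indicator {0..X} y *\<^sub>R g2 y)"
  have i1: "integrable lborel G1" and i2: "integrable lborel G2"
    using g1 g2 by (simp_all add: set_integrable_def G1_def G2_def)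
  have [measurable]: "G1 \<in> borel_measurable borel" "G2 \<in> borel_measurable borel"
    using i1 i2 borel_measurable_integrable by fastforce+
  define k where "k = (\<lambda>p. G1 (fst p) * G2 (snd p))"
  have kint: "integrable (lborel \<Otimes>\<^sub>M lborel) k"
  proof (rule lborel_pair.Fubini_integrable)
    show "k \<in> borel_measurable (lborel \<Otimes>\<^sub>M lborel)" unfolding k_def by measurable
    show "integrable lborel (\<lambda>x. \<integral>y. norm (k (x, y)) \<partial>lborel)"
      using i1 i2 by (simp add: k_def norm_mult)
    show "AE x in lborel. integrable lborel (\<lambda>y. k (x, y))" using i2 by (simp add: k_def)
  qed
  define S where "S = {p::real\<times>real. snd p \<le> fst p}"
  have S: "S \<in> sets (lborel \<Otimes>\<^sub>M lborel)"
  proof -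
    have "{p \<in> space (borel \<Otimes>\<^sub>M borel). snd p \<le> (fst p::real)} \<in> sets (borel \<Otimes>\<^sub>M borel)"
      by measurable
    moreover have "sets (lborel \<Otimes>\<^sub>M lborel) = sets (borel \<Otimes>\<^sub>M (borel::real measure))"
      by (intro sets_pair_measure_cong) auto
    ultimately show ?thesis by (simp add: S_def space_pair_measure)
  qed
  have T: "- S \<in> sets (lborel \<Otimes>\<^sub>M lborel)"
    using sets.compl_sets[OF S] by (simp add: Compl_eq_Diff_UNIV space_pair_measure)
  have ks: "integrable (lborel \<Otimes>\<^sub>M lborel) (case_prod (\<lambda>y z. indicator S (y,z) *\<^sub>R k (y,z)))"
    using integrable_mult_indicator[OF S kint] by (simp add: case_prod_unfold)
  have kt: "integrable (lborel \<Otimes>\<^sub>M lborel) (case_prod (\<lambda>y z. indicator (-S) (y,z) *\<^sub>R k (y,z)))"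
    using integrable_mult_indicator[OF T kint] by (simp add: case_prod_unfold)
  have inS: "(\<integral>z. indicator S (y,z) *\<^sub>R k (y,z) \<partial>lborel)
      = indicator {0..X} y *\<^sub>R (g1 y * (LINT z:{0..y}|lborel. g2 z))" for y
  proof -
    have "(\<integral>z. indicator S (y,z) *\<^sub>R k (y,z) \<partial>lborel) =
       (\<integral>z. (indicator {0..X} y *\<^sub>R g1 y) * (indicator {0..y} z *\<^sub>R g2 z) \<partial>lborel)"
      by (intro Bochner_Integration.integral_cong) (auto simp: S_def k_def G1_def G2_def split: split_indicator)
    also have "\<dots> = (indicator {0..X} y *\<^sub>R g1 y) * (LINT z:{0..y}|lborel. g2 z)"
      unfolding set_lebesgue_integral_def by (rule integral_mult_right_zero)
    finally show ?thesis by simp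
  qed
  \<comment> \<open>The diagonal belongs to \<open>S\<close>, so the inner interval is half-open
    here; the missing endpoint is a null set.\<close>
  have inT: "(\<integral>y. indicator (-S) (y,z) *\<^sub>R k (y,z) \<partial>lborel)
      = indicator {0..X} z *\<^sub>R ((LINT y:{0..z}|lborel. g1 y) * g2 z)" for z
  proof -
    have "(\<integral>y. indicator (-S) (y,z) *\<^sub>R k (y,z) \<partial>lborel) =
       (\<integral>y. (indicator {0..<z} y *\<^sub>R g1 y) * (indicator {0..X} z *\<^sub>R g2 z) \<partial>lborel)"
      by (intro Bochner_Integration.integral_cong) (auto simp: S_def k_def G1_def G2_def split: split_indicator)
    also have "\<dots> = (LINT y:{0..<z}|lborel. g1 y) * (indicator {0..X} z *\<^sub>R g2 z)"
      unfolding set_lebesgue_integral_def by (rule integral_mult_left_zero)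
    also have "(LINT y:{0..<z}|lborel. g1 y) = (LINT y:{0..z}|lborel. g1 y)"
      by (rule set_integral_discrete_difference[where X="{z}"]) auto
    finally show ?thesis by simp
  qed
  show ?i1 using lborel_pair.integrable_fst[OF ks] by (simp add: inS set_integrable_def)
  show ?i2 using lborel_pair.integrable_snd[OF kt] by (simp add: inT set_integrable_def)
  have "(\<integral>y. (\<integral>z. indicator S (y,z) *\<^sub>R k (y,z) \<partial>lborel) \<partial>lborel)
      + (\<integral>z. (\<integral>y. indicator (-S) (y,z) *\<^sub>R k (y,z) \<partial>lborel) \<partial>lborel)
      = (\<integral>p. indicator S p *\<^sub>R k p \<partial>(lborel \<Otimes>\<^sub>M lborel)) + (\<integral>p. indicator (-S) p *\<^sub>R k p \<partial>(lborel \<Otimes>\<^sub>M lborel))"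
    using lborel_pair.integral_fst[OF ks] lborel_pair.integral_snd[OF kt]
    by (simp add: case_prod_unfold)
  also have "\<dots> = (\<integral>p. indicator S p *\<^sub>R k p + indicator (-S) p *\<^sub>R k p \<partial>(lborel \<Otimes>\<^sub>M lborel))"
    by (intro Bochner_Integration.integral_add[symmetric] integrable_mult_indicator S T kint)
  also have "\<dots> = (\<integral>p. k p \<partial>(lborel \<Otimes>\<^sub>M lborel))"
    by (intro Bochner_Integration.integral_cong refl) (auto split: split_indicator)
  also have "\<dots> = (\<integral>y. (\<integral>z. k (y,z) \<partial>lborel) \<partial>lborel)"
    using lborel_pair.integral_fst[of "\<lambda>y z. k (y,z)"] kint by simp
  also have "\<dots> = (LINT y:{0..X}|lborel. g1 y) * (LINT y:{0..X}|lborel. g2 y)"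
    unfolding k_def fst_conv snd_conv integral_mult_right_zero integral_mult_left_zero
    by (simp add: G1_def G2_def set_lebesgue_integral_def)
  finally show ?eq by (simp add: inS inT set_lebesgue_integral_def)
qed

text \<open>Writing both factors as initial value plus integral leaves one genuine product of
  integrals, which \<open>integral_mult_split\<close> handles.\<close>

lemma primitive_mult:
  assumes p: "primitive f1 g1" and q: "primitive f2 g2"
  shows "primitive (\<lambda>x. f1 x * f2 x) (\<lambda>x. f1 x * g2 x + g1 x * f2 x)"
  unfolding primitive_def
proof (intro allI impI)
  fix X :: real assume "0 \<le> X"
  define F1 where "F1 x = (LINT y:{0..x}|lborel. g1 y)" for x
  define F2 where "F2 x = (LINT y:{0..x}|lborel. g2 y)" for x
  have f1: "f1 x = f1 0 + F1 x" and f2: "f2 x = f2 0 + F2 x" if "x \<ge> 0" for x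
    using primitive_eq[OF p that] primitive_eq[OF q that] by (simp_all add: F1_def F2_def)
  have g: "set_integrable lborel {0..X} g1" "set_integrable lborel {0..X} g2"
    using p q by (simp_all add: primitive_set_integrable)
  note I = integral_mult_split[OF g, folded F1_def F2_def]
  have e: "indicator {0..X} x *\<^sub>R (f1 x * g2 x + g1 x * f2 x)
     = indicator {0..X} x *\<^sub>R ((f1 0 * g2 x + f2 0 * g1 x) + (g1 x * F2 x + F1 x * g2 x))" for x
    using f1[of x] f2[of x] by (auto simp: algebra_simps split: split_indicator)
  have i: "set_integrable lborel {0..X} (\<lambda>x. (f1 0 * g2 x + f2 0 * g1 x) + (g1 x * F2 x + F1 x * g2 x))"
    using g I by (intro set_integral_add(1) set_integrable_mult_right) auto
  have "(LINT x:{0..X}|lborel. (f1 0 * g2 x + f2 0 * g1 x) + (g1 x * F2 x + F1 x * g2 x))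
     = (f1 0 * F2 X + f2 0 * F1 X) + F1 X * F2 X"
    using g I by (simp add: set_integral_add set_integrable_mult_right F1_def F2_def)
  then have j: "(LINT x:{0..X}|lborel. f1 x * g2 x + g1 x * f2 x)
     = (f1 0 * F2 X + f2 0 * F1 X) + F1 X * F2 X"
    by (simp add: set_lebesgue_integral_def e)
  show "set_integrable lborel {0..X} (\<lambda>x. f1 x * g2 x + g1 x * f2 x) \<and>
     f1 X * f2 X = f1 0 * f2 0 + (LINT y:{0..X}|lborel. f1 y * g2 y + g1 y * f2 y)"
    using i unfolding j set_integrable_def e using f1[OF \<open>0 \<le> X\<close>] f2[OF \<open>0 \<le> X\<close>]
    by (simp add: algebra_simps)
qed

lemma primitive_tendsto:
  assumes p: "primitive f g" and g: "integrable hl g"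
  shows "(f \<longlongrightarrow> f 0 + integral\<^sup>L hl g) at_top"
proof -
  have "((\<lambda>y. \<integral>x. indicator {..y} x *\<^sub>R (indicator {0..} x *\<^sub>R g x) \<partial>lborel) \<longlongrightarrow>
     (\<integral>x. indicator {0..} x *\<^sub>R g x \<partial>lborel)) at_top"
    by (rule tendsto_integral_at_top) (use g in \<open>auto simp: integrable_restrict_space\<close>)
  then have "((\<lambda>y. f 0 + (\<integral>x. indicator {..y} x *\<^sub>R (indicator {0..} x *\<^sub>R g x) \<partial>lborel)) \<longlongrightarrow>
     f 0 + integral\<^sup>L hl g) at_top"
    by (intro tendsto_intros) (simp add: integral_restrict_space)
  moreover have "\<forall>\<^sub>F y in at_top. f 0 + (\<integral>x. indicator {..y} x *\<^sub>R (indicator {0..} x *\<^sub>R g x) \<partial>lborel) = f y"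
    using eventually_ge_at_top[of "0::real"]
  proof eventually_elim
    case (elim y)
    have "(\<integral>x. indicator {..y} x *\<^sub>R (indicator {0..} x *\<^sub>R g x) \<partial>lborel) = (LINT x:{0..y}|lborel. g x)"
      unfolding set_lebesgue_integral_def
      by (intro Bochner_Integration.integral_cong) (auto split: split_indicator)
    then show ?case using primitive_eq[OF p elim] by simp
  qed
  ultimately show ?thesis using Lim_transform_eventually by blast
qed

text \<open>A nonzero limit would keep the modulus above a positive constant on a tail of infinite
  measure.\<close>

lemma integrable_tendsto_zero:
  fixes f :: halfline_fun
  assumes i: "integrable hl f" and t: "(f \<longlongrightarrow> L) at_top"
  shows "L = 0"
proof (rule ccontr)
  assume "L \<noteq> 0"
  have "((\<lambda>x. cmod (f x)) \<longlongrightarrow> cmod L) at_top" by (intro tendsto_intros t)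
  then have "\<forall>\<^sub>F x in at_top. cmod L / 2 < cmod (f x)"
    using \<open>L \<noteq> 0\<close> by (intro order_tendstoD(1)[where y="cmod L"]) auto
  then obtain Y where Y: "\<And>x. x \<ge> Y \<Longrightarrow> cmod L / 2 < cmod (f x)"
    by (auto simp: eventually_at_top_linorder)
  define X where "X = max Y 0"
  have "integrable lborel (\<lambda>x. (cmod L / 2) * indicat_real {X..} x)"
  proof (rule Bochner_Integration.integrable_bound)
    show "integrable lborel (\<lambda>x. indicator {0..} x *\<^sub>R f x)"
      using i by (simp add: integrable_restrict_space)
    show "AE x in lborel. norm (cmod L / 2 * indicat_real {X..} x) \<le> norm (indicat_real {0..} x *\<^sub>R f x)"
      using Y by (intro AE_I2) (auto simp: X_def split: split_indicator intro: less_imp_le)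
  qed auto
  from integrable_mult_right[OF this, of "2 / cmod L"]
  have "integrable lborel (indicat_real {X..})" using \<open>L \<noteq> 0\<close> by simp
  then have "emeasure lborel {X..} < \<infinity>" by (simp add: integrable_indicator_iff)
  moreover have "emeasure lborel {X..} \<ge> ennreal (real n)" for n
  proof -
    have "emeasure lborel {X..X + real n} \<le> emeasure lborel {X..}" by (intro emeasure_mono) auto
    then show ?thesis by simp
  qed
  moreover obtain n where "emeasure lborel {X..} < of_nat n"
    using \<open>emeasure lborel {X..} < \<infinity>\<close> by (auto dest: ennreal_Ex_less_of_nat)
  ultimately show False by (metis ennreal_of_nat_eq_real_of_nat not_less)
qed

text \<open>Integrability of f forces its limit at infinity, f(0) plus the integral of g, to be 0.
  Integration by parts on the half-line is this statement applied to a product; the only boundary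
  term sits at the vertex.\<close>

lemma primitive_integral:
  assumes p: "primitive f g" and "integrable hl f" and "integrable hl g"
  shows "integral\<^sup>L hl g = - f 0"
  using integrable_tendsto_zero[OF assms(2) primitive_tendsto[OF p assms(3)]]
  by (simp add: add_eq_0_iff2)

text \<open>The half-lines are an intersection-stable generator of the Borel sets, and the sets over
  which g integrates to 0 are closed under complements and countable disjoint unions.\<close>

lemma set_integral_zero_imp_AE:
  fixes g :: "real \<Rightarrow> complex"
  assumes i: "integrable lborel g" and z: "\<And>x. (LINT y:{..x}|lborel. g y) = 0"
  shows "AE x in lborel. g x = 0"
proof (rule sigma_finite_measure.density_zero[OF lborel.sigma_finite_measure_axioms i])
  have si: "set_integrable lborel A g" if "A \<in> sets borel" for A
    using i that unfolding set_integrable_def by (intro integrable_mult_indicator) auto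
  have sA: "sets (borel::real measure) = sigma_sets UNIV (range atMost)"
    by (subst borel_eq_atMost) (simp add: atMost_def[abs_def])
  \<comment> \<open>The complement case below needs the integral over the whole line, reached as a
    limit of half-lines.\<close>
  have int0: "integral\<^sup>L lborel g = 0"
  proof -
    have "((\<lambda>y. \<integral>x. indicator {..y} x *\<^sub>R g x \<partial>lborel) \<longlongrightarrow> integral\<^sup>L lborel g) at_top"
      by (rule tendsto_integral_at_top) (use i in auto)
    then show ?thesis using z by (simp add: set_lebesgue_integral_def tendsto_const_iff)
  qed
  fix A :: "real set" assume "A \<in> sets lborel"
  then have A: "A \<in> sigma_sets UNIV (range atMost)" using sA by simp
  have "Int_stable (range (atMost :: real \<Rightarrow> _))" "range (atMost :: real \<Rightarrow> _) \<subseteq> Pow UNIV"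
    by (auto simp: Int_stable_def)
  from this A show "(LINT y:A|lborel. g y) = 0"
  proof (induction rule: sigma_sets_induct_disjoint)
    case (basic A) then show ?case using z by auto
  next
    case empty then show ?case by (simp add: set_lebesgue_integral_def)
  next
    case (compl A)
    then have "A \<in> sets borel" unfolding sA by simp
    then have "(LINT y:A|lborel. g y) + (LINT y:UNIV - A|lborel. g y) = (LINT y:A \<union> (UNIV - A)|lborel. g y)"
      by (intro set_integral_Un[symmetric] si) auto
    also have "\<dots> = 0" using int0 by (simp add: set_lebesgue_integral_def)
    finally show ?case using compl by simp
  next
    case (union A)
    have m: "A i \<in> sets borel" for i using union(2) unfolding sA by auto
    then have "(\<Union>i. A i) \<in> sets borel" by auto
    then have "(LINT y:(\<Union>i. A i)|lborel. g y) = (\<Sum>i. (LINT y:A i|lborel. g y))"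
      using union(1) m by (intro lebesgue_integral_countable_add si)
        (auto simp: disjoint_family_on_def)
    then show ?case using union(3) by simp
  qed
qed

text \<open>Cutting off at n makes the difference of the two derivatives integrable with vanishing
  integrals over half-lines; countably many null sets are then united.\<close>

lemma primitive_unique:
  assumes p: "primitive f g" and q: "primitive f g'"
  shows "AE x in hl. g x = g' x"
proof -
  have d: "primitive (\<lambda>x. 0) (\<lambda>x. g x - g' x)" using primitive_diff[OF p q] by simp
  have "AE x in lborel. indicator {0..real n} x *\<^sub>R (g x - g' x) = 0" for n :: nat
  proof (rule set_integral_zero_imp_AE)
    show "integrable lborel (\<lambda>x. indicat_real {0..real n} x *\<^sub>R (g x - g' x))"
      using primitive_set_integrable[OF d] by (simp add: set_integrable_def)
    fix x :: real
    have "(LINT y:{..x}|lborel. indicat_real {0..real n} y *\<^sub>R (g y - g' y))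
       = (LINT y:{0..min x (real n)}|lborel. g y - g' y)"
      unfolding set_lebesgue_integral_def
      by (intro Bochner_Integration.integral_cong) (auto split: split_indicator)
    also have "\<dots> = 0"
    proof (cases "min x (real n) \<ge> 0")
      case True then show ?thesis using primitive_eq[OF d] by simp
    next
      case False
      then have "{0..min x (real n)} = {}" by simp
      then show ?thesis by (simp only: set_lebesgue_integral_def) simp
    qed
    finally show "(LINT y:{..x}|lborel. indicat_real {0..real n} y *\<^sub>R (g y - g' y)) = 0" .
  qed
  then have "AE x in lborel. \<forall>n. indicator {0..real n} x *\<^sub>R (g x - g' x) = 0"
    unfolding AE_all_countable by blast
  then have "AE x in lborel. x \<in> {0..} \<longrightarrow> g x = g' x"
  proof eventually_elim
    case (elim x)
    obtain n :: nat where "x \<le> real n" using real_arch_simple by blast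
    then show ?case using elim[rule_format, of n] by (auto split: split_indicator_asm)
  qed
  then show ?thesis by (simp add: AE_restrict_space_iff)
qed

section \<open>Weak derivatives\<close>

text \<open>The test functions are supported away from 0. Hence k is first shown to be constant on
  the open half-line, and the endpoint is added by continuity.\<close>

lemma du_Bois_Reymond:
  fixes k :: "real \<Rightarrow> real"
  assumes k: "continuous_on {0..} k"
    and test: "\<And>\<phi> \<phi>' \<alpha> \<beta>. (\<And>x. (\<phi> has_real_derivative \<phi>' x) (at x)) \<Longrightarrow> continuous_on UNIV \<phi>' \<Longrightarrow>
       0 < \<alpha> \<Longrightarrow> \<alpha> < \<beta> \<Longrightarrow> (\<And>x. x \<notin> {\<alpha>..\<beta>} \<Longrightarrow> \<phi> x = 0) \<Longrightarrow> (\<And>x. x \<notin> {\<alpha>..\<beta>} \<Longrightarrow> \<phi>' x = 0) \<Longrightarrow>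
       integral {\<alpha>..\<beta>} (\<lambda>x. k x * \<phi>' x) = 0"
    and "0 \<le> x"
  shows "k x = k 0"
proof -
  have const: "k s = k t" if st: "0 < s" "s < t" for s t :: real
  proof -
    define \<alpha> where "\<alpha> = s / 2"
    define \<beta> where "\<beta> = t + 1"
    have ab: "0 < \<alpha>" "\<alpha> < s" "t < \<beta>" "\<alpha> < \<beta>" using st by (auto simp: \<alpha>_def \<beta>_def)
    \<comment> \<open>A continuous weight, positive exactly between \<alpha> and \<beta>. Continuity
      is enough because the weight enters the derivative of the test function and not the test
      function itself.\<close>
    define \<eta> where "\<eta> = (\<lambda>x. max 0 ((x - \<alpha>) * (\<beta> - x)))"
    \<comment> \<open>A continuous extension of k to the whole line, since test functions are
      defined there.\<close>
    define kk where "kk = (\<lambda>x. k (max 0 x))"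
    have c\<eta>: "continuous_on A \<eta>" for A unfolding \<eta>_def by (intro continuous_intros)
    have ckk: "continuous_on A kk" for A unfolding kk_def
      by (rule continuous_on_compose2[OF k]) (auto intro!: continuous_intros)
    have \<eta>0: "\<eta> x = 0" if "x \<notin> {\<alpha>..\<beta>}" for x
      using that ab unfolding \<eta>_def
      by (auto simp: max_def zero_le_mult_iff)
    have \<eta>pos: "\<eta> x > 0" if "x \<in> {\<alpha><..<\<beta>}" for x using that by (simp add: \<eta>_def)
    have I\<eta>: "integral {\<alpha>..\<beta>} \<eta> > 0"
    proof -
      have "integral {\<alpha>..\<beta>} \<eta> \<ge> 0" by (intro integral_nonneg integrable_continuous_real c\<eta>) (auto simp: \<eta>_def)
      moreover have "integral {\<alpha>..\<beta>} \<eta> \<noteq> 0"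
        using integral_eq_0_iff[OF c\<eta>, of \<alpha> \<beta>] ab \<eta>pos[of s] st by (force simp: \<eta>_def)
      ultimately show ?thesis by simp
    qed
    define c where "c = integral {\<alpha>..\<beta>} (\<lambda>x. kk x * \<eta> x) / integral {\<alpha>..\<beta>} \<eta>"
    \<comment> \<open>\<open>c\<close> is the \<open>\<eta>\<close>-mean of \<open>k\<close>, so \<open>\<psi>\<close> is the derivative of a test function and
      testing with it gives \<open>\<integral> (k - c)\<^sup>2 \<eta> = 0\<close>.\<close>
    define \<psi> where "\<psi> = (\<lambda>x. (kk x - c) * \<eta> x)"
    have c\<psi>: "continuous_on A \<psi>" for A unfolding \<psi>_def by (intro continuous_intros ckk c\<eta>)
    have int\<psi>: "integral {\<alpha>..\<beta>} \<psi> = 0"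
    proof -
      have "integral {\<alpha>..\<beta>} \<psi> = integral {\<alpha>..\<beta>} (\<lambda>x. kk x * \<eta> x - c * \<eta> x)"
        by (simp add: \<psi>_def left_diff_distrib)
      also have "\<dots> = integral {\<alpha>..\<beta>} (\<lambda>x. kk x * \<eta> x) - integral {\<alpha>..\<beta>} (\<lambda>x. c * \<eta> x)"
        by (intro Henstock_Kurzweil_Integration.integral_diff integrable_continuous_real continuous_intros ckk c\<eta>)
      finally show ?thesis using I\<eta> by (simp add: c_def)
    qed
    have "\<exists>F. \<forall>x::real. - \<infinity> < ereal x \<longrightarrow> ereal x < \<infinity> \<longrightarrow> (F has_vector_derivative \<psi> x) (at x)"
      by (rule einterval_antiderivative) (use c\<psi>[of UNIV] in \<open>auto simp: continuous_on_eq_continuous_at\<close>)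
    then obtain F where F: "\<And>x. (F has_real_derivative \<psi> x) (at x)"
      by (auto simp: has_real_derivative_iff_has_vector_derivative)
    define \<phi> where "\<phi> = (\<lambda>x. F x - F \<alpha>)"
    have d\<phi>: "(\<phi> has_real_derivative \<psi> x) (at x)" for x
      unfolding \<phi>_def using F[of x] by (auto intro!: derivative_eq_intros)
    have \<psi>0: "\<psi> x = 0" if "x \<notin> {\<alpha>..\<beta>}" for x using \<eta>0[OF that] by (simp add: \<psi>_def)
    have \<psi>b: "\<psi> \<alpha> = 0" "\<psi> \<beta> = 0" by (simp_all add: \<psi>_def \<eta>_def)
    have \<phi>\<beta>: "\<phi> \<beta> = 0"
    proof -
      have "(\<psi> has_integral (\<phi> \<beta> - \<phi> \<alpha>)) {\<alpha>..\<beta>}"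
        using ab d\<phi> by (intro fundamental_theorem_of_calculus)
          (auto simp: has_real_derivative_iff_has_vector_derivative intro: has_vector_derivative_at_within)
      then show ?thesis using int\<psi> by (auto simp: integral_unique \<phi>_def)
    qed
    have const: "\<phi> v = \<phi> u" if "u < v" "\<And>x. u < x \<Longrightarrow> x < v \<Longrightarrow> x \<notin> {\<alpha>..\<beta>}" for u v
      using that(1)
    proof (rule DERIV_isconst_end)
      show "continuous_on {u..v} \<phi>" using d\<phi> DERIV_continuous_on has_field_derivative_at_within by blast
      show "DERIV \<phi> x :> 0" if "u < x" "x < v" for x
        using d\<phi>[of x] \<psi>0[of x] \<open>\<And>x. u < x \<Longrightarrow> x < v \<Longrightarrow> x \<notin> {\<alpha>..\<beta>}\<close>[OF that] by simp
    qed
    have \<phi>0: "\<phi> x = 0" if "x \<notin> {\<alpha>..\<beta>}" for x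
      using const[of x \<alpha>] const[of \<beta> x] \<phi>\<beta> that by (cases "x < \<alpha>") (auto simp: \<phi>_def)
    have "integral {\<alpha>..\<beta>} (\<lambda>x. k x * \<psi> x) = 0"
      by (rule test[OF d\<phi> c\<psi> ab(1,4) \<phi>0 \<psi>0])
    moreover have "integral {\<alpha>..\<beta>} (\<lambda>x. k x * \<psi> x) = integral {\<alpha>..\<beta>} (\<lambda>x. kk x * \<psi> x)"
      using ab by (intro Henstock_Kurzweil_Integration.integral_cong) (auto simp: kk_def)
    moreover have "integral {\<alpha>..\<beta>} (\<lambda>x. c * \<psi> x) = 0" unfolding integral_mult_right int\<psi> by simp
    moreover have "integral {\<alpha>..\<beta>} (\<lambda>x. kk x * \<psi> x - c * \<psi> x)
        = integral {\<alpha>..\<beta>} (\<lambda>x. kk x * \<psi> x) - integral {\<alpha>..\<beta>} (\<lambda>x. c * \<psi> x)"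
      by (intro Henstock_Kurzweil_Integration.integral_diff integrable_continuous_real continuous_intros ckk c\<psi>)
    ultimately have "integral {\<alpha>..\<beta>} (\<lambda>x. kk x * \<psi> x - c * \<psi> x) = 0" by linarith
    moreover have "(\<lambda>x. kk x * \<psi> x - c * \<psi> x) = (\<lambda>x. (kk x - c)\<^sup>2 * \<eta> x)"
      by (simp add: fun_eq_iff \<psi>_def power2_eq_square algebra_simps)
    ultimately have "integral {\<alpha>..\<beta>} (\<lambda>x. (kk x - c)\<^sup>2 * \<eta> x) = 0" by simp
    moreover have "continuous_on {\<alpha>..\<beta>} (\<lambda>x. (kk x - c)\<^sup>2 * \<eta> x)"
      by (intro continuous_intros ckk c\<eta>)
    ultimately have z: "(kk x - c)\<^sup>2 * \<eta> x = 0" if "x \<in> {\<alpha>..\<beta>}" for x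
      using that ab by (subst (asm) integral_eq_0_iff) (auto simp: \<eta>_def)
    have "kk s = c" "kk t = c" using z[of s] z[of t] \<eta>pos[of s] \<eta>pos[of t] ab st by auto
    then show ?thesis using st by (simp add: kk_def)
  qed
  have pos: "k y = k 1" if "0 < y" for y
    using const that by (metis linorder_less_linear zero_less_one)
  have "((\<lambda>y. k y) \<longlongrightarrow> k 0) (at 0 within {0..})" using k by (auto simp: continuous_on_def)
  then have "((\<lambda>y. k y) \<longlongrightarrow> k 0) (at 0 within {0<..})" by (rule tendsto_within_subset) auto
  then have "((\<lambda>y::real. k 1) \<longlongrightarrow> k 0) (at 0 within {0<..})"
    by (rule Lim_transform_eventually, unfold eventually_at_filter)
      (intro always_eventually allI impI pos, simp)
  then have "k 0 = k 1" by (simp add: tendsto_const_iff)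
  then show ?thesis using pos[of x] \<open>0 \<le> x\<close> by (cases "x = 0") auto
qed

lemma primitive_continuous:
  assumes p: "primitive f g"
  shows "continuous_on {0..} f"
proof -
  have "continuous_on {0..b} f" for b
  proof (cases "b \<ge> 0")
    case True
    have si: "set_integrable lborel {0..b} g" by (rule primitive_set_integrable[OF p])
    have "continuous_on {0..b} (\<lambda>x. f 0 + integral {0..x} g)"
      by (intro continuous_intros indefinite_integral_continuous_1 set_borel_integral_eq_integral(1)[OF si])
    moreover have "f x = f 0 + integral {0..x} g" if "x \<in> {0..b}" for x
      using set_borel_integral_eq_integral(2)[OF primitive_set_integrable[OF p], of x] primitive_eq[OF p, of x] that
      by simp
    ultimately show ?thesis using continuous_on_cong[OF refl, of "{0..b}" f "\<lambda>x. f 0 + integral {0..x} g"] by blast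
  qed auto
  then have "continuous (at x within {0..}) f" if "x \<ge> 0" for x
  proof -
    have "continuous (at x within {0..x+1}) f"
      using \<open>\<And>b. continuous_on {0..b} f\<close>[of "x+1"] that by (auto simp: continuous_on_eq_continuous_within)
    moreover have "at x within {0..x+1} = at x within {0..}"
      by (rule at_within_nhd[of _ "{..<x+1}"]) auto
    ultimately show ?thesis by simp
  qed
  then show ?thesis by (simp add: continuous_on_eq_continuous_within)
qed

lemma integrable_hl_compact_support:
  fixes h :: "real \<Rightarrow> 'a::{banach, second_countable_topology}"
  assumes "continuous_on {0..} h" and "\<And>x. x > \<beta> \<Longrightarrow> h x = 0"
  shows "integrable hl h"
proof -
  have c: "continuous_on {0..\<beta>} h" using assms(1) by (rule continuous_on_subset) auto
  have "integrable lborel (\<lambda>x. indicator {0..\<beta>} x *\<^sub>R h x)"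
    using borel_integrable_atLeastAtMost'[OF c] by (simp add: set_integrable_def)
  moreover have "(\<lambda>x. indicator {0..\<beta>} x *\<^sub>R h x) = (\<lambda>x. indicator {0..} x *\<^sub>R h x)"
    using assms(2) by (auto split: split_indicator simp: fun_eq_iff not_le)
  ultimately show ?thesis by (simp add: integrable_restrict_space)
qed

lemma L2_compact_support:
  assumes "continuous_on {0..} h" and "\<And>x. x > \<beta> \<Longrightarrow> h x = 0"
  shows "h \<in> L2_halfline"
proof -
  have "continuous_on {0..} (\<lambda>x. (cmod (h x))\<^sup>2)"
    by (intro continuous_on_power continuous_on_norm assms(1))
  then have "integrable hl (\<lambda>x. (cmod (h x))\<^sup>2)"
    by (rule integrable_hl_compact_support[where \<beta>=\<beta>]) (use assms(2) in auto)
  then show ?thesis using continuous_measurable_hl[OF assms(1)] by (simp add: L2_iff)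
qed

lemma L2_set_integrable:
  assumes g: "g \<in> L2_halfline"
  shows "set_integrable lborel {0..x} g"
proof -
  have "(\<lambda>y. of_real (indicat_real {0..x} y)) \<in> L2_halfline"
    unfolding L2_iff
  proof
    show "(\<lambda>y. complex_of_real (indicat_real {0..x} y)) \<in> borel_measurable hl"
      by (intro measurable_restrict_space1) auto
    have "integrable lborel (indicat_real {0..x})" 
      by (intro integrable_real_indicator) (auto simp: emeasure_lborel_Icc_eq)
    moreover have "(\<lambda>y. indicat_real {0..} y *\<^sub>R (cmod (complex_of_real (indicat_real {0..x} y)))\<^sup>2) = indicat_real {0..x}"
      by (auto simp: fun_eq_iff split: split_indicator)
    ultimately show "integrable hl (\<lambda>y. (cmod (complex_of_real (indicat_real {0..x} y)))\<^sup>2)"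
      by (subst integrable_restrict_space) auto
  qed
  from L2_integrable_mult[OF this g]
  have "integrable lborel (\<lambda>y. indicat_real {0..} y *\<^sub>R (complex_of_real (indicat_real {0..x} y) * g y))"
    by (simp add: integrable_restrict_space)
  moreover have "(\<lambda>y. indicat_real {0..} y *\<^sub>R (complex_of_real (indicat_real {0..x} y) * g y))
      = (\<lambda>y. indicat_real {0..x} y *\<^sub>R g y)"
    by (auto simp: fun_eq_iff split: split_indicator)
  ultimately show ?thesis by (simp add: set_integrable_def)
qed

lemma indefinite_integral_primitive:
  assumes "\<And>x. set_integrable lborel {0..x} g"
  shows "primitive (\<lambda>x. LINT y:{0..x}|lborel. g y) g"
proof -
  have "(LINT y:{0..0::real}|lborel. g y) = (LINT y:{}|lborel. g y)"
    by (rule set_integral_discrete_difference[where X="{0}"]) auto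
  then have "(LINT y:{0..0::real}|lborel. g y) = 0" by (simp only: set_lebesgue_integral_def) simp
  then show ?thesis using assms by (simp add: primitive_def)
qed

lemma primitive_real:
  assumes d: "\<And>x. 0 \<le> x \<Longrightarrow> (\<phi> has_real_derivative \<phi>' x) (at x)" and c: "continuous_on {0..} \<phi>'"
  shows "primitive (\<lambda>x. of_real (\<phi> x)) (\<lambda>x. of_real (\<phi>' x))"
proof (rule primitive_C1)
  fix x :: real assume "0 \<le> x"
  then have "(\<phi> has_vector_derivative \<phi>' x) (at x within {0..})"
    using d by (auto simp: has_real_derivative_iff_has_vector_derivative intro: has_vector_derivative_at_within)
  from bounded_linear.has_vector_derivative[OF bounded_linear_of_real this]
  show "((\<lambda>x. complex_of_real (\<phi> x)) has_vector_derivative complex_of_real (\<phi>' x)) (at x within {0..})" .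
next
  show "continuous_on {0..} (\<lambda>x. complex_of_real (\<phi>' x))" by (rule continuous_on_of_real[OF c])
qed

lemma deriv_zero_off_support:
  assumes d: "\<And>x. (\<phi> has_real_derivative \<phi>' x) (at x)"
    and z: "\<And>x. x \<notin> {\<alpha>..\<beta>} \<Longrightarrow> \<phi> x = 0" and x: "x \<notin> {\<alpha>..\<beta>}"
  shows "\<phi>' x = 0"
proof -
  have "open (- {\<alpha>..\<beta>})" by (intro open_Compl) auto
  have "((\<lambda>_. 0) has_real_derivative \<phi>' x) (at x)"
    by (rule has_field_derivative_transform_within_open[OF d \<open>open (- {\<alpha>..\<beta>})\<close>]) (use x z in auto)
  then show ?thesis using DERIV_const DERIV_unique by blast
qed

text \<open>Integration by parts against a test function, which vanishes at 0 and so removes the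
  vertex term.\<close>

lemma primitive_imp_weak_derivative:
  assumes p: "primitive f g" and f: "f \<in> L2_halfline" and g: "g \<in> L2_halfline"
  shows "weak_derivative f g"
  unfolding weak_derivative_def set_lebesgue_integral_hl
proof (intro allI impI, elim conjE)
  fix \<phi> \<phi>' :: "real \<Rightarrow> real" and \<alpha> \<beta> :: real
  assume d: "\<forall>x. (\<phi> has_real_derivative \<phi>' x) (at x)" and c: "continuous_on UNIV \<phi>'"
    and \<alpha>: "0 < \<alpha>" and z: "\<forall>x. x \<notin> {\<alpha>..\<beta>} \<longrightarrow> \<phi> x = 0"
  have z': "\<phi>' x = 0" if "x \<notin> {\<alpha>..\<beta>}" for x
    by (rule deriv_zero_off_support[OF _ _ that, of \<phi>]) (use d z in auto)
  have c\<phi>: "continuous_on UNIV \<phi>" using d DERIV_continuous_on by blast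
  have L: "(\<lambda>x. complex_of_real (\<phi> x)) \<in> L2_halfline" "(\<lambda>x. complex_of_real (\<phi>' x)) \<in> L2_halfline"
    by (intro L2_compact_support[where \<beta>=\<beta>] continuous_intros continuous_on_subset[OF c\<phi>]
        continuous_on_subset[OF c]; use z z' in simp)+
  note P = primitive_mult[OF p primitive_real[OF d[rule_format] continuous_on_subset[OF c subset_UNIV]]]
  have I: "integrable hl (\<lambda>x. f x * of_real (\<phi> x))" "integrable hl (\<lambda>x. f x * of_real (\<phi>' x))"
    "integrable hl (\<lambda>x. g x * of_real (\<phi> x))"
    using L f g by (auto intro: L2_integrable_mult)
  have "(\<integral>x. f x * of_real (\<phi>' x) + g x * of_real (\<phi> x) \<partial>hl) = - (f 0 * of_real (\<phi> 0))"
    by (rule primitive_integral[OF P I(1)]) (use I in simp)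
  moreover have "\<phi> 0 = 0" using z \<alpha> by auto
  ultimately show "(\<integral>x. f x * of_real (\<phi>' x) \<partial>hl) = - (\<integral>x. g x * of_real (\<phi> x) \<partial>hl)"
    using I by (simp add: add_eq_0_iff2)
qed

text \<open>Subtracting the indefinite integral of g leaves a continuous function with weak
  derivative 0; \<open>du_Bois_Reymond\<close>, applied to real and imaginary part, makes it
  constant.\<close>

lemma weak_derivative_imp_primitive:
  assumes w: "weak_derivative f g" and f: "f \<in> L2_halfline" and g: "g \<in> L2_halfline"
    and cf: "continuous_on {0..} f"
  shows "primitive f g"
proof -
  define G where "G x = (LINT y:{0..x}|lborel. g y)" for x
  have pG: "primitive G g"
    unfolding G_def by (rule indefinite_integral_primitive[OF L2_set_integrable[OF g]])
  have cG: "continuous_on {0..} G" by (rule primitive_continuous[OF pG])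
  have G0: "G 0 = 0" using primitive_eq[OF pG, of 0] by (simp add: G_def)
  define k where "k x = f x - G x" for x
  have ck: "continuous_on {0..} k" unfolding k_def by (intro continuous_intros cf cG)
  have test: "integral {\<alpha>..\<beta>} (\<lambda>x. T (k x) * \<phi>' x) = 0"
    if d: "\<And>x. (\<phi> has_real_derivative \<phi>' x) (at x)" and c: "continuous_on UNIV \<phi>'"
    and ab: "0 < \<alpha>" "\<alpha> < \<beta>" and z: "\<And>x. x \<notin> {\<alpha>..\<beta>} \<Longrightarrow> \<phi> x = 0" and z': "\<And>x. x \<notin> {\<alpha>..\<beta>} \<Longrightarrow> \<phi>' x = 0"
    and T: "bounded_linear T" for T :: "complex \<Rightarrow> real" and \<phi> \<phi>' \<alpha> \<beta>
  proof -
    interpret T: bounded_linear T by fact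
    have c\<phi>: "continuous_on UNIV \<phi>" using d DERIV_continuous_on by blast
    have ir: "integrable hl (\<lambda>x. h x * of_real (q x))"
      if "continuous_on {0..} h" "continuous_on UNIV q" "\<And>x. x \<notin> {\<alpha>..\<beta>} \<Longrightarrow> q x = 0"
      for h :: halfline_fun and q
      using that by (intro integrable_hl_compact_support[where \<beta>=\<beta>])
        (auto intro!: continuous_intros intro: continuous_on_subset)
    have L: "(\<lambda>x. complex_of_real (\<phi> x)) \<in> L2_halfline"
      by (intro L2_compact_support[where \<beta>=\<beta>] continuous_intros continuous_on_subset[OF c\<phi>])
        (use z in auto)
    have I: "integrable hl (\<lambda>x. G x * of_real (\<phi> x))" "integrable hl (\<lambda>x. G x * of_real (\<phi>' x))"
      "integrable hl (\<lambda>x. f x * of_real (\<phi>' x))"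
      using ir cG cf c c\<phi> z z' by auto
    have Ig: "integrable hl (\<lambda>x. g x * of_real (\<phi> x))" by (rule L2_integrable_mult[OF g L])
    have "(\<integral>x. G x * of_real (\<phi>' x) + g x * of_real (\<phi> x) \<partial>hl) = - (G 0 * of_real (\<phi> 0))"
      by (rule primitive_integral[OF primitive_mult[OF pG primitive_real[OF d continuous_on_subset[OF c subset_UNIV]]] I(1)]) (use I Ig in simp)
    then have "(\<integral>x. G x * of_real (\<phi>' x) \<partial>hl) = - (\<integral>x. g x * of_real (\<phi> x) \<partial>hl)"
      using I Ig G0 by (simp add: add_eq_0_iff2)
    moreover have "(\<integral>x. f x * of_real (\<phi>' x) \<partial>hl) = - (\<integral>x. g x * of_real (\<phi> x) \<partial>hl)"
      using w d c ab z unfolding weak_derivative_def set_lebesgue_integral_hl by blast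
    ultimately have "(\<integral>x. k x * of_real (\<phi>' x) \<partial>hl) = 0"
      using I by (simp add: k_def left_diff_distrib)
    moreover have "(\<integral>x. T (k x * of_real (\<phi>' x)) \<partial>hl) = T (\<integral>x. k x * of_real (\<phi>' x) \<partial>hl)"
      by (rule integral_bounded_linear[OF T ir[OF ck c z']])
    ultimately have "(\<integral>x. T (k x) * \<phi>' x \<partial>hl) = 0"
      by (simp add: T.zero mult.commute[of "k _"] scaleR_conv_of_real[symmetric] T.scaleR) (simp add: mult.commute)
    then have "(LINT x:{0..}|lborel. T (k x) * \<phi>' x) = 0" by (simp add: set_lebesgue_integral_hl)
    moreover have "(LINT x:{0..}|lborel. T (k x) * \<phi>' x) = (LINT x:{\<alpha>..\<beta>}|lborel. T (k x) * \<phi>' x)"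
      unfolding set_lebesgue_integral_def
      by (intro Bochner_Integration.integral_cong) (use ab z' in \<open>auto split: split_indicator\<close>)
    moreover have "continuous_on {\<alpha>..\<beta>} (\<lambda>x. T (k x) * \<phi>' x)"
      using ab by (intro continuous_intros T.continuous_on continuous_on_subset[OF ck] continuous_on_subset[OF c]) auto
    ultimately show ?thesis
      using set_borel_integral_eq_integral(2)[OF borel_integrable_atLeastAtMost', of \<alpha> \<beta> "\<lambda>x. T (k x) * \<phi>' x"]
      by simp
  qed
  have "Re (k x) = Re (k 0)" "Im (k x) = Im (k 0)" if "0 \<le> x" for x
    by (rule du_Bois_Reymond[OF continuous_on_Re[OF ck] test[OF _ _ _ _ _ _ bounded_linear_Re] that]; assumption)
       (rule du_Bois_Reymond[OF continuous_on_Im[OF ck] test[OF _ _ _ _ _ _ bounded_linear_Im] that]; assumption)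
  then have kc: "k x = k 0" if "0 \<le> x" for x using that by (intro complex_eqI)
  have "f x = f 0 + G x" if "0 \<le> x" for x
    using kc[OF that] G0 by (simp add: k_def algebra_simps)
  then show ?thesis unfolding primitive_def G_def using L2_set_integrable[OF g] by blast
qed

text \<open>Test functions are traded for \<open>primitive\<close> in the description of the Sobolev
  space. Continuity need not be listed on the right, as every primitive is continuous.\<close>

lemma H1_iff: "f \<in> H1_halfline \<longleftrightarrow> f \<in> L2_halfline \<and> (\<exists>g\<in>L2_halfline. primitive f g)"
  unfolding H1_halfline_def
  using primitive_continuous weak_derivative_imp_primitive primitive_imp_weak_derivative by blast

lemma H1_wderiv:
  assumes "f \<in> H1_halfline"
  shows H1_L2: "f \<in> L2_halfline" and wderiv_L2: "wderiv f \<in> L2_halfline"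
    and wderiv_primitive: "primitive f (wderiv f)" and H1_continuous: "continuous_on {0..} f"
proof -
  show f: "f \<in> L2_halfline" "continuous_on {0..} f" using assms by (auto simp: H1_halfline_def)
  have "\<exists>g. g \<in> L2_halfline \<and> weak_derivative f g" using assms by (auto simp: H1_halfline_def)
  then have "wderiv f \<in> L2_halfline \<and> weak_derivative f (wderiv f)"
    unfolding wderiv_def by (rule someI_ex)
  then show "wderiv f \<in> L2_halfline" "primitive f (wderiv f)"
    using weak_derivative_imp_primitive f by auto
qed

section \<open>Sobolev norms and forms on the star graph\<close>

text \<open>\<open>wderiv\<close> is a choice among functions that agree almost everywhere, so its
  rules of calculation hold almost everywhere and reach norms and forms through integrals.\<close>

lemma wderiv_AE:
  assumes "f \<in> H1_halfline" "primitive f g"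
  shows "AE x in hl. wderiv f x = g x"
  using primitive_unique[OF wderiv_primitive] assms by blast

lemma H1I: "f \<in> L2_halfline \<Longrightarrow> g \<in> L2_halfline \<Longrightarrow> primitive f g \<Longrightarrow> f \<in> H1_halfline"
  by (auto simp: H1_iff)

lemma H1_add: "f \<in> H1_halfline \<Longrightarrow> g \<in> H1_halfline \<Longrightarrow> (\<lambda>x. f x + g x) \<in> H1_halfline"
  by (rule H1I[OF L2_add[OF H1_L2 H1_L2] L2_add[OF wderiv_L2 wderiv_L2]
        primitive_add[OF wderiv_primitive wderiv_primitive]])

lemma H1_scale: "f \<in> H1_halfline \<Longrightarrow> (\<lambda>x. k * f x) \<in> H1_halfline"
  by (rule H1I[OF L2_scale[OF H1_L2] L2_scale[OF wderiv_L2] primitive_scale[OF wderiv_primitive]])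

lemma H1_diff: "f \<in> H1_halfline \<Longrightarrow> g \<in> H1_halfline \<Longrightarrow> (\<lambda>x. f x - g x) \<in> H1_halfline"
  by (rule H1I[OF L2_diff[OF H1_L2 H1_L2] L2_diff[OF wderiv_L2 wderiv_L2]
        primitive_diff[OF wderiv_primitive wderiv_primitive]])

lemma wderiv_add:
  "f \<in> H1_halfline \<Longrightarrow> g \<in> H1_halfline \<Longrightarrow> AE x in hl. wderiv (\<lambda>x. f x + g x) x = wderiv f x + wderiv g x"
  by (rule wderiv_AE[OF H1_add
        primitive_add[OF wderiv_primitive wderiv_primitive]])

lemma wderiv_scale:
  "f \<in> H1_halfline \<Longrightarrow> AE x in hl. wderiv (\<lambda>x. k * f x) x = k * wderiv f x"
  by (rule wderiv_AE[OF H1_scale primitive_scale[OF wderiv_primitive]])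

lemma H1_halfline_norm_eq: "H1_halfline_norm f = sqrt ((L2norm f)\<^sup>2 + (L2norm (wderiv f))\<^sup>2)"
  by (simp add: H1_halfline_norm_def L2norm_sq set_lebesgue_integral_hl)

lemma H1_halfline_norm_nonneg [simp]: "0 \<le> H1_halfline_norm f"
  by (simp add: H1_halfline_norm_eq)

lemma H1_halfline_norm_sq: "(H1_halfline_norm f)\<^sup>2 = (L2norm f)\<^sup>2 + (L2norm (wderiv f))\<^sup>2"
  by (simp add: H1_halfline_norm_eq)

lemma L2norm_le_H1: "L2norm f \<le> H1_halfline_norm f" "L2norm (wderiv f) \<le> H1_halfline_norm f"
  by (simp_all add: H1_halfline_norm_eq real_le_rsqrt)

lemma H1_halfline_norm_scale:
  assumes f: "f \<in> H1_halfline"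
  shows "H1_halfline_norm (\<lambda>x. k * f x) = cmod k * H1_halfline_norm f"
proof -
  have "L2norm (wderiv (\<lambda>x. k * f x)) = L2norm (\<lambda>x. k * wderiv f x)"
    by (rule L2norm_cong_AE[OF wderiv_scale[OF f]]) (auto intro: H1_wderiv H1_scale L2_scale f)
  then show ?thesis
    by (simp add: H1_halfline_norm_eq L2norm_scale power_mult_distrib real_sqrt_mult flip: distrib_left)
qed

lemma H1_halfline_norm_triangle:
  assumes f: "f \<in> H1_halfline" and g: "g \<in> H1_halfline"
  shows "H1_halfline_norm (\<lambda>x. f x + g x) \<le> H1_halfline_norm f + H1_halfline_norm g"
proof -
  have "L2norm (wderiv (\<lambda>x. f x + g x)) = L2norm (\<lambda>x. wderiv f x + wderiv g x)"
    by (rule L2norm_cong_AE[OF wderiv_add[OF f g]]) (auto intro: H1_wderiv H1_add L2_add f g)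
  also have "\<dots> \<le> L2norm (wderiv f) + L2norm (wderiv g)"
    by (intro L2norm_triangle H1_wderiv f g)
  finally have "H1_halfline_norm (\<lambda>x. f x + g x)
      \<le> sqrt ((L2norm f + L2norm g)\<^sup>2 + (L2norm (wderiv f) + L2norm (wderiv g))\<^sup>2)"
    unfolding H1_halfline_norm_eq
    by (intro real_sqrt_le_mono add_mono power_mono L2norm_triangle H1_wderiv f g) auto
  also have "\<dots> \<le> H1_halfline_norm f + H1_halfline_norm g"
    unfolding H1_halfline_norm_eq by (rule real_sqrt_sum_squares_triangle_ineq)
  finally show ?thesis .
qed

text \<open>|f(x)|^2 is minus the integral over [x,\<infinity>) of its derivative, and that
  derivative is at most |f|^2 + |f'|^2 in modulus. The embedding constant is therefore 1.\<close>

lemma H1_sup_bound: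
  assumes f: "f \<in> H1_halfline" and x: "0 \<le> x"
  shows "cmod (f x) \<le> H1_halfline_norm f"
proof -
  define g where "g = wderiv f"
  define h where "h y = f y * cnj (g y) + g y * cnj (f y)" for y
  have L: "f \<in> L2_halfline" "g \<in> L2_halfline" using H1_wderiv[OF f] by (simp_all add: g_def)
  have p: "primitive (\<lambda>x. f x * cnj (f x)) h"
    unfolding h_def using primitive_mult[OF wderiv_primitive[OF f] primitive_cnj[OF wderiv_primitive[OF f]]]
    by (simp add: g_def)
  have ih: "integrable hl h" unfolding h_def
    using L by (intro Bochner_Integration.integrable_add L2_integrable_mult_cnj)
  have "integral\<^sup>L hl h = - (f 0 * cnj (f 0))"
    by (rule primitive_integral[OF p L2_integrable_mult_cnj[OF L(1,1)] ih])
  moreover have "(LINT y:{0..x}|lborel. h y) = f x * cnj (f x) - f 0 * cnj (f 0)"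
    by (rule primitive_eq[OF p x])
  moreover have "(LINT y:{0..x}|lborel. h y) = (\<integral>y. indicator {0..x} y *\<^sub>R h y \<partial>hl)"
    by (simp add: integral_restrict_space set_lebesgue_integral_def)
      (intro Bochner_Integration.integral_cong, auto split: split_indicator)
  moreover have i2: "integrable hl (\<lambda>y. indicator {0..x} y *\<^sub>R h y)"
    by (rule integrable_mult_indicator[OF _ ih]) (auto simp: sets_restrict_space_iff)
  ultimately have "f x * cnj (f x) = - (\<integral>y. h y - indicator {0..x} y *\<^sub>R h y \<partial>hl)"
    using ih by (simp add: algebra_simps)
  then have "(cmod (f x))\<^sup>2 = cmod (\<integral>y. h y - indicator {0..x} y *\<^sub>R h y \<partial>hl)"
    by (metis complex_norm_square norm_minus_cancel norm_of_real abs_of_nonneg zero_le_power2)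
  also have "\<dots> \<le> (\<integral>y. cmod (h y - indicator {0..x} y *\<^sub>R h y) \<partial>hl)"
    by (rule integral_norm_bound)
  also have "\<dots> \<le> (\<integral>y. (cmod (f y))\<^sup>2 + (cmod (g y))\<^sup>2 \<partial>hl)"
  proof (rule integral_mono)
    show "integrable hl (\<lambda>y. cmod (h y - indicator {0..x} y *\<^sub>R h y))"
      using ih i2 by (intro integrable_norm Bochner_Integration.integrable_diff)
    show "integrable hl (\<lambda>y. (cmod (f y))\<^sup>2 + (cmod (g y))\<^sup>2)" using L by (simp add: L2_integrable_sq)
    fix y
    have "cmod (h y - indicator {0..x} y *\<^sub>R h y) \<le> cmod (h y)" by (auto split: split_indicator)
    also have "\<dots> \<le> 2 * (cmod (f y) * cmod (g y))"
      unfolding h_def by (rule order_trans[OF norm_triangle_ineq]) (simp add: norm_mult)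
    also have "\<dots> \<le> (cmod (f y))\<^sup>2 + (cmod (g y))\<^sup>2" by (rule two_mult_le)
    finally show "cmod (h y - indicator {0..x} y *\<^sub>R h y) \<le> (cmod (f y))\<^sup>2 + (cmod (g y))\<^sup>2" .
  qed
  also have "\<dots> = (H1_halfline_norm f)\<^sup>2"
    using L by (simp add: L2_integrable_sq H1_halfline_norm_sq L2norm_sq g_def)
  finally show ?thesis by (rule power2_le_imp_le) simp
qed

section \<open>The Sobolev norm on the star graph\<close>

lemma H1_norm_eq: "H1_norm N u = L2_set (\<lambda>e. H1_halfline_norm (u e)) {1..N}"
  by (simp add: H1_norm_def L2_set_def)

lemma H1_norm_nonneg [simp]: "0 \<le> H1_norm N u"
  by (simp add: H1_norm_eq)

lemma H1_norm_sq: "(H1_norm N u)\<^sup>2 = (\<Sum>e=1..N. (H1_halfline_norm (u e))\<^sup>2)"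
  by (simp add: H1_norm_def sum_nonneg)

lemma H1_graphD: "u \<in> H1_graph N \<Longrightarrow> e \<in> {1..N} \<Longrightarrow> u e \<in> H1_halfline"
  "u \<in> H1_graph N \<Longrightarrow> e \<in> {1..N} \<Longrightarrow> u e 0 = u 1 0"
  unfolding H1_graph_def by blast+

lemma H1_graphI:
  assumes "\<And>e. e \<in> {1..N} \<Longrightarrow> u e \<in> H1_halfline" "\<And>e. e \<in> {1..N} \<Longrightarrow> u e 0 = u 1 0"
  shows "u \<in> H1_graph N"
  using assms unfolding H1_graph_def by blast

lemma H1_graph_add: "u \<in> H1_graph N \<Longrightarrow> w \<in> H1_graph N \<Longrightarrow> (\<lambda>e x. u e x + w e x) \<in> H1_graph N"
  by (rule H1_graphI, rule H1_add[OF H1_graphD(1) H1_graphD(1)]; assumption?) (metis H1_graphD(2))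

lemma H1_graph_scale: "u \<in> H1_graph N \<Longrightarrow> (\<lambda>e x. k * u e x) \<in> H1_graph N"
  by (rule H1_graphI, rule H1_scale[OF H1_graphD(1)]; assumption?) (metis H1_graphD(2))

lemma H1_graph_diff: "u \<in> H1_graph N \<Longrightarrow> w \<in> H1_graph N \<Longrightarrow> (\<lambda>e x. u e x - w e x) \<in> H1_graph N"
  by (rule H1_graphI, rule H1_diff[OF H1_graphD(1) H1_graphD(1)]; assumption?) (metis H1_graphD(2))

lemma H1_norm_scale: "u \<in> H1_graph N \<Longrightarrow> H1_norm N (\<lambda>e x. k * u e x) = cmod k * H1_norm N u"
  by (simp add: H1_norm_def H1_halfline_norm_scale H1_graphD power_mult_distrib real_sqrt_mult
      flip: sum_distrib_left)

lemma H1_norm_triangle: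
  assumes "u \<in> H1_graph N" "w \<in> H1_graph N"
  shows "H1_norm N (\<lambda>e x. u e x + w e x) \<le> H1_norm N u + H1_norm N w"
proof -
  have "H1_norm N (\<lambda>e x. u e x + w e x) \<le> L2_set (\<lambda>e. H1_halfline_norm (u e) + H1_halfline_norm (w e)) {1..N}"
    unfolding H1_norm_eq using assms
    by (intro L2_set_mono H1_halfline_norm_triangle) (auto dest: H1_graphD)
  also have "\<dots> \<le> H1_norm N u + H1_norm N w"
    unfolding H1_norm_eq by (rule L2_set_triangle_ineq)
  finally show ?thesis .
qed

lemma H1_norm_minus: "u \<in> H1_graph N \<Longrightarrow> H1_norm N (\<lambda>e x. - u e x) = H1_norm N u"
  using H1_norm_scale[of u N "-1"] by simp

lemma H1_norm_diff_commute:
  assumes "u \<in> H1_graph N" "w \<in> H1_graph N"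
  shows "H1_norm N (\<lambda>e x. u e x - w e x) = H1_norm N (\<lambda>e x. w e x - u e x)"
  using H1_norm_minus[OF H1_graph_diff[OF assms]] by simp

lemma H1_norm_le_add_diff:
  assumes "u \<in> H1_graph N" "w \<in> H1_graph N"
  shows "H1_norm N u \<le> H1_norm N w + H1_norm N (\<lambda>e x. u e x - w e x)"
  using H1_norm_triangle[OF assms(2) H1_graph_diff[OF assms]] by simp

lemma H1_norm_diff_triangle:
  assumes "u \<in> H1_graph N" "v \<in> H1_graph N" "w \<in> H1_graph N"
  shows "H1_norm N (\<lambda>e x. u e x - w e x)
      \<le> H1_norm N (\<lambda>e x. u e x - v e x) + H1_norm N (\<lambda>e x. v e x - w e x)"
  using H1_norm_triangle[OF H1_graph_diff[OF assms(1,2)] H1_graph_diff[OF assms(2,3)]] by simp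

lemma edge_norm_le: "e \<in> {1..N} \<Longrightarrow> H1_halfline_norm (u e) \<le> H1_norm N u"
  unfolding H1_norm_eq by (rule member_le_L2_set) auto

lemma graph_sup_bound: "u \<in> H1_graph N \<Longrightarrow> e \<in> {1..N} \<Longrightarrow> 0 \<le> x \<Longrightarrow> cmod (u e x) \<le> H1_norm N u"
  using H1_sup_bound[OF H1_graphD(1)] edge_norm_le order_trans by blast

text \<open>Cauchy-Schwarz over the edges. The families f and g stand for L2 norms of the edge
  functions or of their derivatives.\<close>

lemma sum_mult_le_H1_norm:
  assumes "\<And>e. e \<in> {1..N} \<Longrightarrow> 0 \<le> f e \<and> f e \<le> H1_halfline_norm (u e)"
    and "\<And>e. e \<in> {1..N} \<Longrightarrow> 0 \<le> g e \<and> g e \<le> H1_halfline_norm (w e)"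
  shows "(\<Sum>e=1..N. f e * g e) \<le> H1_norm N u * H1_norm N w"
proof -
  have "(\<Sum>e=1..N. f e * g e) \<le> (\<Sum>e=1..N. \<bar>H1_halfline_norm (u e)\<bar> * \<bar>H1_halfline_norm (w e)\<bar>)"
  proof (rule sum_mono)
    fix e assume "e \<in> {1..N}"
    from assms[OF this] show "f e * g e \<le> \<bar>H1_halfline_norm (u e)\<bar> * \<bar>H1_halfline_norm (w e)\<bar>"
      by (intro mult_mono) auto
  qed
  also have "\<dots> \<le> H1_norm N u * H1_norm N w"
    unfolding H1_norm_eq by (rule L2_set_mult_ineq)
  finally show ?thesis .
qed

section \<open>The L2 pairing and the form of the Laplacian\<close>

lemma L2_inner_hl: "L2_inner N u w = (\<Sum>e=1..N. \<integral>x. u e x * cnj (w e x) \<partial>hl)"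
  by (simp add: L2_inner_def set_lebesgue_integral_hl)

lemma minus_Delta_hl: "minus_Delta N \<gamma> u w =
   (\<Sum>e=1..N. \<integral>x. wderiv (u e) x * cnj (wderiv (w e) x) \<partial>hl) - of_real \<gamma> * u 1 0 * cnj (w 1 0)"
  by (simp add: minus_Delta_def set_lebesgue_integral_hl)

lemma cnj_inner_hl: "cnj (\<integral>x. f x * cnj (g x) \<partial>hl) = (\<integral>x. g x * cnj (f x) \<partial>hl)"
proof -
  have "cnj (\<integral>x. f x * cnj (g x) \<partial>hl) = (\<integral>x. cnj (f x * cnj (g x)) \<partial>hl)"
    by (rule Bochner_Integration.integral_cnj[symmetric])
  then show ?thesis by (simp add: mult.commute)
qed

definition L2_graph :: "nat \<Rightarrow> graph_fun set" where
  "L2_graph N = {u. \<forall>e\<in>{1..N}. u e \<in> L2_halfline}"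

lemma H1_graph_L2: "u \<in> H1_graph N \<Longrightarrow> u \<in> L2_graph N"
  by (auto simp: L2_graph_def dest: H1_graphD intro: H1_L2)

lemma L2_inner_cnj: "cnj (L2_inner N u w) = L2_inner N w u"
  by (simp add: L2_inner_hl cnj_inner_hl)

lemma L2_inner_add_left:
  assumes "u \<in> L2_graph N" "v \<in> L2_graph N" "w \<in> L2_graph N"
  shows "L2_inner N (\<lambda>e x. u e x + v e x) w = L2_inner N u w + L2_inner N v w"
  using assms unfolding L2_inner_hl L2_graph_def
  by (simp add: distrib_right L2_integrable_mult_cnj sum.distrib)

lemma L2_inner_diff_left:
  assumes "u \<in> L2_graph N" "v \<in> L2_graph N" "w \<in> L2_graph N"
  shows "L2_inner N (\<lambda>e x. u e x - v e x) w = L2_inner N u w - L2_inner N v w"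
  using assms unfolding L2_inner_hl L2_graph_def
  by (simp add: left_diff_distrib L2_integrable_mult_cnj sum_subtractf)

lemma L2_inner_scale_left: "L2_inner N (\<lambda>e x. k * u e x) w = k * L2_inner N u w"
  by (simp add: L2_inner_hl mult.assoc sum_distrib_left)

lemma L2_inner_add_right:
  assumes "u \<in> L2_graph N" "v \<in> L2_graph N" "w \<in> L2_graph N"
  shows "L2_inner N w (\<lambda>e x. u e x + v e x) = L2_inner N w u + L2_inner N w v"
  using L2_inner_add_left[OF assms] by (metis L2_inner_cnj complex_cnj_add)

lemma L2_inner_diff_right:
  assumes "u \<in> L2_graph N" "v \<in> L2_graph N" "w \<in> L2_graph N"
  shows "L2_inner N w (\<lambda>e x. u e x - v e x) = L2_inner N w u - L2_inner N w v"
  using L2_inner_diff_left[OF assms] by (metis L2_inner_cnj complex_cnj_diff)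

lemma L2_inner_scale_right: "L2_inner N w (\<lambda>e x. k * u e x) = cnj k * L2_inner N w u"
  using L2_inner_scale_left[of N k u w] by (metis L2_inner_cnj complex_cnj_mult)

lemma L2_inner_le:
  assumes "u \<in> H1_graph N" "w \<in> H1_graph N"
  shows "cmod (L2_inner N u w) \<le> H1_norm N u * H1_norm N w"
proof -
  have "cmod (L2_inner N u w) \<le> (\<Sum>e=1..N. L2norm (u e) * L2norm (w e))"
    unfolding L2_inner_hl using assms
    by (intro order_trans[OF norm_sum] sum_mono inner_le) (auto dest: H1_graphD intro: H1_L2)
  also have "\<dots> \<le> H1_norm N u * H1_norm N w"
    by (rule sum_mult_le_H1_norm) (auto intro: L2norm_le_H1)
  finally show ?thesis .
qed

lemma inner_cong_AE:
  assumes "AE x in hl. f x = f' x" "AE x in hl. g x = g' x"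
    "f \<in> L2_halfline" "f' \<in> L2_halfline" "g \<in> L2_halfline" "g' \<in> L2_halfline"
  shows "(\<integral>x. f x * cnj (g x) \<partial>hl) = (\<integral>x. f' x * cnj (g' x) \<partial>hl)"
proof (rule integral_cong_AE)
  show "(\<lambda>x. f x * cnj (g x)) \<in> borel_measurable hl" "(\<lambda>x. f' x * cnj (g' x)) \<in> borel_measurable hl"
    by (rule borel_measurable_integrable[OF L2_integrable_mult_cnj[OF assms(3,5)]])
       (rule borel_measurable_integrable[OF L2_integrable_mult_cnj[OF assms(4,6)]])
  show "AE x in hl. f x * cnj (g x) = f' x * cnj (g' x)" using assms(1,2) by eventually_elim simp
qed

lemma minus_Delta_cnj: "cnj (minus_Delta N \<gamma> u w) = minus_Delta N \<gamma> w u"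
  by (simp add: minus_Delta_hl cnj_inner_hl mult.commute mult.left_commute)

lemma minus_Delta_add_left:
  assumes "u \<in> H1_graph N" "v \<in> H1_graph N" "w \<in> H1_graph N"
  shows "minus_Delta N \<gamma> (\<lambda>e x. u e x + v e x) w = minus_Delta N \<gamma> u w + minus_Delta N \<gamma> v w"
proof -
  have "(\<integral>x. wderiv (\<lambda>x. u e x + v e x) x * cnj (wderiv (w e) x) \<partial>hl)
     = (\<integral>x. wderiv (u e) x * cnj (wderiv (w e) x) \<partial>hl) + (\<integral>x. wderiv (v e) x * cnj (wderiv (w e) x) \<partial>hl)"
    if "e \<in> {1..N}" for e
  proof -
    note H = H1_graphD(1)[OF assms(1) that] H1_graphD(1)[OF assms(2) that] H1_graphD(1)[OF assms(3) that]
    have "(\<integral>x. wderiv (\<lambda>x. u e x + v e x) x * cnj (wderiv (w e) x) \<partial>hl)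
       = (\<integral>x. (wderiv (u e) x + wderiv (v e) x) * cnj (wderiv (w e) x) \<partial>hl)"
      by (rule inner_cong_AE[OF wderiv_add[OF H(1,2)] AE_I2[OF refl]])
        (intro wderiv_L2 H1_add L2_add H)+
    then show ?thesis using H by (simp add: distrib_right L2_integrable_mult_cnj wderiv_L2)
  qed
  then show ?thesis by (simp add: minus_Delta_hl sum.distrib algebra_simps)
qed

lemma minus_Delta_scale_left:
  assumes "u \<in> H1_graph N" "w \<in> H1_graph N"
  shows "minus_Delta N \<gamma> (\<lambda>e x. k * u e x) w = k * minus_Delta N \<gamma> u w"
proof -
  have "(\<integral>x. wderiv (\<lambda>x. k * u e x) x * cnj (wderiv (w e) x) \<partial>hl)
     = k * (\<integral>x. wderiv (u e) x * cnj (wderiv (w e) x) \<partial>hl)"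
    if "e \<in> {1..N}" for e
  proof -
    note H = H1_graphD(1)[OF assms(1) that] H1_graphD(1)[OF assms(2) that]
    have "(\<integral>x. wderiv (\<lambda>x. k * u e x) x * cnj (wderiv (w e) x) \<partial>hl)
       = (\<integral>x. (k * wderiv (u e) x) * cnj (wderiv (w e) x) \<partial>hl)"
      by (rule inner_cong_AE[OF wderiv_scale[OF H(1)] AE_I2[OF refl]])
        (intro wderiv_L2 H1_scale L2_scale H)+
    then show ?thesis by (simp add: mult.assoc)
  qed
  then show ?thesis by (simp add: minus_Delta_hl sum_distrib_left algebra_simps)
qed

lemma minus_Delta_le:
  assumes "u \<in> H1_graph N" "w \<in> H1_graph N" "N \<ge> 1"
  shows "cmod (minus_Delta N \<gamma> u w) \<le> (1 + \<bar>\<gamma>\<bar>) * (H1_norm N u * H1_norm N w)"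
proof -
  have "cmod (\<Sum>e=1..N. \<integral>x. wderiv (u e) x * cnj (wderiv (w e) x) \<partial>hl)
      \<le> (\<Sum>e=1..N. L2norm (wderiv (u e)) * L2norm (wderiv (w e)))"
    using assms by (intro order_trans[OF norm_sum] sum_mono inner_le) (auto dest: H1_graphD intro: wderiv_L2)
  also have "\<dots> \<le> H1_norm N u * H1_norm N w"
    by (rule sum_mult_le_H1_norm) (auto intro: L2norm_le_H1)
  finally have 1: "cmod (\<Sum>e=1..N. \<integral>x. wderiv (u e) x * cnj (wderiv (w e) x) \<partial>hl) \<le> H1_norm N u * H1_norm N w" .
  have "cmod (u 1 0) * cmod (w 1 0) \<le> H1_norm N u * H1_norm N w"
    using assms by (intro mult_mono graph_sup_bound) auto
  then have "cmod (of_real \<gamma> * u 1 0 * cnj (w 1 0)) \<le> \<bar>\<gamma>\<bar> * (H1_norm N u * H1_norm N w)"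
    by (simp add: norm_mult mult_left_mono mult.assoc)
  with 1 show ?thesis
    unfolding minus_Delta_hl by (intro order_trans[OF norm_triangle_ineq4]) (simp add: algebra_simps)
qed

section \<open>The nonlinearity\<close>

lemma integrable_bounded_mult:
  fixes m h :: "real \<Rightarrow> real"
  assumes "m \<in> borel_measurable hl" "\<And>x. 0 \<le> x \<Longrightarrow> \<bar>m x\<bar> \<le> C" "integrable hl h"
  shows "integrable hl (\<lambda>x. m x * h x)"
proof (rule Bochner_Integration.integrable_bound)
  show "integrable hl (\<lambda>x. C * h x)" using assms(3) by simp
  show "(\<lambda>x. m x * h x) \<in> borel_measurable hl" using assms by (intro borel_measurable_times) auto
  show "AE x in hl. norm (m x * h x) \<le> norm (C * h x)"
  proof (rule AE_I2)
    fix x assume "x \<in> space hl"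
    then have "\<bar>m x\<bar> \<le> \<bar>C\<bar>" using assms(2)[of x] by auto
    then show "norm (m x * h x) \<le> norm (C * h x)" by (simp add: abs_mult mult_right_mono)
  qed
qed

text \<open>This is a |z|^4 + 2 b |z|^2 |w|^2 + c |w|^4, grouped as the two cubic nonlinearities
  paired with z and w.\<close>

definition quartic_density :: "real \<Rightarrow> real \<Rightarrow> real \<Rightarrow> complex \<Rightarrow> complex \<Rightarrow> real" where
  "quartic_density a b c z w =
     (a * (cmod z)\<^sup>2 + b * (cmod w)\<^sup>2) * (cmod z)\<^sup>2 + (b * (cmod z)\<^sup>2 + c * (cmod w)\<^sup>2) * (cmod w)\<^sup>2"

definition quartic :: "nat \<Rightarrow> real \<Rightarrow> real \<Rightarrow> real \<Rightarrow> graph_fun \<Rightarrow> graph_fun \<Rightarrow> real" where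
  "quartic N a b c u v = (\<Sum>e=1..N. \<integral>x. quartic_density a b c (u e x) (v e x) \<partial>hl)"

definition mass :: "nat \<Rightarrow> graph_fun \<Rightarrow> real" where
  "mass N u = (\<Sum>e=1..N. \<integral>x. (cmod (u e x))\<^sup>2 \<partial>hl)"

text \<open>Twice the usual Hamiltonian, so that the quadratic forms carry no factor 1/2.\<close>

definition energy :: "nat \<Rightarrow> real \<Rightarrow> real \<Rightarrow> real \<Rightarrow> real \<Rightarrow> graph_fun \<Rightarrow> graph_fun \<Rightarrow> real" where
  "energy N \<gamma> a b c u v =
     Re (minus_Delta N \<gamma> u u) + Re (minus_Delta N \<gamma> v v) - quartic N a b c u v / 2"

lemma H1_integrable_sq: "f \<in> H1_halfline \<Longrightarrow> integrable hl (\<lambda>x. (cmod (f x))\<^sup>2)"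
  by (rule L2_integrable_sq[OF H1_L2])

lemma H1_cmod_sq_measurable: "f \<in> H1_halfline \<Longrightarrow> (\<lambda>x. (cmod (f x))\<^sup>2) \<in> borel_measurable hl"
  by (intro borel_measurable_power borel_measurable_norm[THEN measurable_compose[rotated]] L2_measurable H1_L2)

lemma weight_bound:
  assumes "f \<in> H1_halfline" "g \<in> H1_halfline" "0 \<le> x" "H1_halfline_norm f \<le> R" "H1_halfline_norm g \<le> R"
  shows "\<bar>p * (cmod (f x))\<^sup>2 + q * (cmod (g x))\<^sup>2\<bar> \<le> (\<bar>p\<bar> + \<bar>q\<bar>) * R\<^sup>2"
proof -
  have "(cmod (f x))\<^sup>2 \<le> R\<^sup>2" "(cmod (g x))\<^sup>2 \<le> R\<^sup>2"
    using H1_sup_bound[of f x] H1_sup_bound[of g x] assms by (auto intro!: power_mono)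
  then have "\<bar>p\<bar> * (cmod (f x))\<^sup>2 + \<bar>q\<bar> * (cmod (g x))\<^sup>2 \<le> \<bar>p\<bar> * R\<^sup>2 + \<bar>q\<bar> * R\<^sup>2"
    by (intro add_mono mult_left_mono) auto
  then show ?thesis by (intro order_trans[OF abs_triangle_ineq]) (simp add: abs_mult algebra_simps)
qed

lemma cubic_edge_L2:
  assumes f: "f \<in> H1_halfline" and g: "g \<in> H1_halfline"
  shows "(\<lambda>x. of_real (p * (cmod (f x))\<^sup>2 + q * (cmod (g x))\<^sup>2) * f x) \<in> L2_halfline"
proof (rule L2_mult_bounded[OF H1_L2[OF f]])
  define R where "R = max (H1_halfline_norm f) (H1_halfline_norm g)"
  show "(\<lambda>x. complex_of_real (p * (cmod (f x))\<^sup>2 + q * (cmod (g x))\<^sup>2)) \<in> borel_measurable hl"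
    by (intro borel_measurable_of_real[THEN measurable_compose[rotated]] borel_measurable_add
        borel_measurable_times borel_measurable_const H1_cmod_sq_measurable f g)
  show "cmod (complex_of_real (p * (cmod (f x))\<^sup>2 + q * (cmod (g x))\<^sup>2)) \<le> (\<bar>p\<bar> + \<bar>q\<bar>) * R\<^sup>2"
    if "0 \<le> x" for x
    unfolding norm_of_real using that by (intro weight_bound f g) (auto simp: R_def)
qed

lemma cubic_L2: "u \<in> H1_graph N \<Longrightarrow> v \<in> H1_graph N \<Longrightarrow> cubic p q u v \<in> L2_graph N"
  unfolding L2_graph_def cubic_def mem_Collect_eq by (intro ballI cubic_edge_L2) (auto dest: H1_graphD(1))

lemma cubic_L2norm_le:
  assumes f: "f \<in> H1_halfline" and g: "g \<in> H1_halfline" "H1_halfline_norm f \<le> R" "H1_halfline_norm g \<le> R"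
  shows "L2norm (\<lambda>x. of_real (p * (cmod (f x))\<^sup>2 + q * (cmod (g x))\<^sup>2) * f x) \<le> (\<bar>p\<bar> + \<bar>q\<bar>) * R\<^sup>2 * L2norm f"
proof -
  define C where "C = (\<bar>p\<bar> + \<bar>q\<bar>) * R\<^sup>2"
  have "C \<ge> 0" by (simp add: C_def)
  have "(L2norm (\<lambda>x. of_real (p * (cmod (f x))\<^sup>2 + q * (cmod (g x))\<^sup>2) * f x))\<^sup>2 \<le> (C * L2norm f)\<^sup>2"
    unfolding L2norm_sq power_mult_distrib
    unfolding integral_mult_right_zero[symmetric]
  proof (rule integral_mono)
    show "integrable hl (\<lambda>x. (cmod (complex_of_real (p * (cmod (f x))\<^sup>2 + q * (cmod (g x))\<^sup>2) * f x))\<^sup>2)"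
      by (rule L2_integrable_sq[OF cubic_edge_L2[OF assms(1,2)]])
    show "integrable hl (\<lambda>x. C\<^sup>2 * (cmod (f x))\<^sup>2)" using H1_integrable_sq[OF f] by simp
    fix x assume "x \<in> space hl"
    then have "\<bar>p * (cmod (f x))\<^sup>2 + q * (cmod (g x))\<^sup>2\<bar> \<le> C"
      unfolding C_def using assms by (intro weight_bound) auto
    then have "(p * (cmod (f x))\<^sup>2 + q * (cmod (g x))\<^sup>2)\<^sup>2 \<le> C\<^sup>2"
      by (metis abs_ge_zero power2_abs power_mono)
    then show "(cmod (complex_of_real (p * (cmod (f x))\<^sup>2 + q * (cmod (g x))\<^sup>2) * f x))\<^sup>2 \<le> C\<^sup>2 * (cmod (f x))\<^sup>2"
      by (simp add: norm_mult power_mult_distrib mult_right_mono del: of_real_add of_real_mult)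
  qed
  then show ?thesis unfolding C_def[symmetric]
    by (rule power2_le_imp_le) (use \<open>C \<ge> 0\<close> in simp)
qed

lemma L2_inner_cubic_le:
  assumes u: "u \<in> H1_graph N" and v: "v \<in> H1_graph N" and w: "w \<in> H1_graph N"
    and R: "H1_norm N u \<le> R" "H1_norm N v \<le> R"
  shows "cmod (L2_inner N (cubic p q u v) w) \<le> (\<bar>p\<bar> + \<bar>q\<bar>) * R\<^sup>2 * (H1_norm N u * H1_norm N w)"
proof -
  have "cmod (L2_inner N (cubic p q u v) w) \<le> (\<Sum>e=1..N. L2norm (cubic p q u v e) * L2norm (w e))"
    unfolding L2_inner_hl using assms cubic_L2[OF u v, of p q, unfolded L2_graph_def]
    by (intro order_trans[OF norm_sum] sum_mono inner_le) (auto dest: H1_graphD(1) intro: H1_L2)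
  also have "\<dots> \<le> (\<Sum>e=1..N. ((\<bar>p\<bar> + \<bar>q\<bar>) * R\<^sup>2) * (L2norm (u e) * L2norm (w e)))"
  proof (rule sum_mono)
    fix e assume e: "e \<in> {1..N}"
    have "L2norm (cubic p q u v e) \<le> (\<bar>p\<bar> + \<bar>q\<bar>) * R\<^sup>2 * L2norm (u e)"
      unfolding cubic_def using e R edge_norm_le[OF e, of u] edge_norm_le[OF e, of v]
      by (intro cubic_L2norm_le H1_graphD(1)[OF u] H1_graphD(1)[OF v]) auto
    then show "L2norm (cubic p q u v e) * L2norm (w e) \<le> ((\<bar>p\<bar> + \<bar>q\<bar>) * R\<^sup>2) * (L2norm (u e) * L2norm (w e))"
      using mult_right_mono[of _ _ "L2norm (w e)", OF _ L2norm_nonneg] by (fastforce simp: mult.assoc)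
  qed
  also have "\<dots> = (\<bar>p\<bar> + \<bar>q\<bar>) * R\<^sup>2 * (\<Sum>e=1..N. L2norm (u e) * L2norm (w e))"
    by (simp add: sum_distrib_left)
  also have "\<dots> \<le> (\<bar>p\<bar> + \<bar>q\<bar>) * R\<^sup>2 * (H1_norm N u * H1_norm N w)"
    by (intro mult_left_mono sum_mult_le_H1_norm) (auto intro: L2norm_le_H1)
  finally show ?thesis .
qed

lemma mass_eq: "mass N u = Re (L2_inner N u u)" "L2_inner N u u = of_real (mass N u)"
proof -
  have "(\<integral>x. u e x * cnj (u e x) \<partial>hl) = of_real (\<integral>x. (cmod (u e x))\<^sup>2 \<partial>hl)" for e
    unfolding complex_norm_square[symmetric] by (rule integral_complex_of_real)
  then show "L2_inner N u u = of_real (mass N u)" by (simp add: L2_inner_hl mass_def)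
  then show "mass N u = Re (L2_inner N u u)" by simp
qed

lemma mass_nonneg: "0 \<le> mass N u"
  by (simp add: mass_def sum_nonneg)

lemma mass_le: "mass N u \<le> (H1_norm N u)\<^sup>2"
  unfolding mass_def H1_norm_sq by (intro sum_mono) (simp add: H1_halfline_norm_sq L2norm_sq[symmetric])

lemma integrable_quartic_density:
  assumes f: "f \<in> H1_halfline" and g: "g \<in> H1_halfline"
  shows "integrable hl (\<lambda>x. quartic_density a b c (f x) (g x))"
  unfolding quartic_density_def
proof (intro Bochner_Integration.integrable_add integrable_bounded_mult)
  define R where "R = max (H1_halfline_norm f) (H1_halfline_norm g)"
  show "\<bar>a * (cmod (f x))\<^sup>2 + b * (cmod (g x))\<^sup>2\<bar> \<le> (\<bar>a\<bar> + \<bar>b\<bar>) * R\<^sup>2"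
    "\<bar>b * (cmod (f x))\<^sup>2 + c * (cmod (g x))\<^sup>2\<bar> \<le> (\<bar>b\<bar> + \<bar>c\<bar>) * R\<^sup>2" if "0 \<le> x" for x
    using that by (auto intro!: weight_bound f g simp: R_def)
qed (auto intro!: H1_integrable_sq borel_measurable_add borel_measurable_times H1_cmod_sq_measurable f g)

lemma quartic_eq_inner:
  assumes u: "u \<in> H1_graph N" and v: "v \<in> H1_graph N"
  shows "L2_inner N (cubic a b u v) u + L2_inner N (cubic c b v u) v = of_real (quartic N a b c u v)"
proof -
  have "(\<integral>x. cubic a b u v e x * cnj (u e x) \<partial>hl) + (\<integral>x. cubic c b v u e x * cnj (v e x) \<partial>hl)
     = of_real (\<integral>x. quartic_density a b c (u e x) (v e x) \<partial>hl)" if "e \<in> {1..N}" for e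
  proof -
    note H = H1_graphD(1)[OF u that] H1_graphD(1)[OF v that]
    have "(\<integral>x. cubic a b u v e x * cnj (u e x) \<partial>hl) + (\<integral>x. cubic c b v u e x * cnj (v e x) \<partial>hl)
      = (\<integral>x. cubic a b u v e x * cnj (u e x) + cubic c b v u e x * cnj (v e x) \<partial>hl)"
      unfolding cubic_def using H
      by (intro Bochner_Integration.integral_add[symmetric] L2_integrable_mult_cnj cubic_edge_L2 H1_L2)
    also have "\<dots> = (\<integral>x. complex_of_real (quartic_density a b c (u e x) (v e x)) \<partial>hl)"
      unfolding cubic_def quartic_density_def mult.assoc complex_norm_square[symmetric]
      by (intro Bochner_Integration.integral_cong) (auto simp: algebra_simps)
    finally show ?thesis by simp
  qed
  then show ?thesis unfolding L2_inner_hl quartic_def of_real_sum sum.distrib[symmetric]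
    by (intro sum.cong) auto
qed

text \<open>Each line on the left is (F' - F) Re(z cnj z'), or the same with G and w, and 2 Re(z cnj
  z') = |z|^2 + |z'|^2 - |z - z'|^2. Because the coupling matrix is symmetric, the square terms add
  up to an exact difference of quartic densities; what is left is quadratic in the
  increments.\<close>

lemma cross_identity:
  fixes z z' w w' :: complex and a b c :: real
  defines "F \<equiv> a * (cmod z)\<^sup>2 + b * (cmod w)\<^sup>2" and "F' \<equiv> a * (cmod z')\<^sup>2 + b * (cmod w')\<^sup>2"
    and "G \<equiv> c * (cmod w)\<^sup>2 + b * (cmod z)\<^sup>2" and "G' \<equiv> c * (cmod w')\<^sup>2 + b * (cmod z')\<^sup>2"
  shows "Re (z * cnj (of_real F' * z') - of_real F * z * cnj z')
       + Re (w * cnj (of_real G' * w') - of_real G * w * cnj w')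
     = (quartic_density a b c z' w' - quartic_density a b c z w) / 2
       - ((F' - F) * (cmod (z - z'))\<^sup>2 + (G' - G) * (cmod (w - w'))\<^sup>2) / 2"
proof -
  have *: "Re (z * cnj (of_real A' * z') - of_real A * z * cnj z')
     = (A' - A) * ((cmod z)\<^sup>2 + (cmod z')\<^sup>2 - (cmod (z - z'))\<^sup>2) / 2" for A A' :: real and z z'
    unfolding cmod_power2 by (simp add: power2_eq_square algebra_simps)
  show ?thesis
    unfolding * F_def F'_def G_def G'_def quartic_density_def by (simp add: algebra_simps add_divide_distrib diff_divide_distrib)
qed

text \<open>The error is measured by the squared L2 norm of the increments. For increments over a
  time r this quantity is o(r) by \<open>mass_increment\<close>, which is what the energy argument
  needs.\<close>

lemma cubic_cross:
  assumes u: "u \<in> H1_graph N" and v: "v \<in> H1_graph N" and u': "u' \<in> H1_graph N" and v': "v' \<in> H1_graph N"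
    and R: "H1_norm N u \<le> R" "H1_norm N v \<le> R" "H1_norm N u' \<le> R" "H1_norm N v' \<le> R"
  shows "\<bar>Re (L2_inner N u (cubic a b u' v') - L2_inner N (cubic a b u v) u')
      + Re (L2_inner N v (cubic c b v' u') - L2_inner N (cubic c b v u) v')
      - (quartic N a b c u' v' - quartic N a b c u v) / 2\<bar>
    \<le> (\<bar>a\<bar> + \<bar>b\<bar> + \<bar>c\<bar>) * R\<^sup>2 * (mass N (\<lambda>e x. u e x - u' e x) + mass N (\<lambda>e x. v e x - v' e x))"
proof -
  define C where "C = (\<bar>a\<bar> + \<bar>b\<bar> + \<bar>c\<bar>) * R\<^sup>2"
  define F where "F e x = a * (cmod (u e x))\<^sup>2 + b * (cmod (v e x))\<^sup>2" for e x
  define F' where "F' e x = a * (cmod (u' e x))\<^sup>2 + b * (cmod (v' e x))\<^sup>2" for e x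
  define G where "G e x = c * (cmod (v e x))\<^sup>2 + b * (cmod (u e x))\<^sup>2" for e x
  define G' where "G' e x = c * (cmod (v' e x))\<^sup>2 + b * (cmod (u' e x))\<^sup>2" for e x
  define Q where "Q e x = quartic_density a b c (u e x) (v e x)" for e x
  define Q' where "Q' e x = quartic_density a b c (u' e x) (v' e x)" for e x
  define r where "r e x = ((F' e x - F e x) * (cmod (u e x - u' e x))\<^sup>2
      + (G' e x - G e x) * (cmod (v e x - v' e x))\<^sup>2) / 2" for e x
  have edge: "\<bar>Re ((\<integral>x. u e x * cnj (cubic a b u' v' e x) \<partial>hl) - (\<integral>x. cubic a b u v e x * cnj (u' e x) \<partial>hl))
      + Re ((\<integral>x. v e x * cnj (cubic c b v' u' e x) \<partial>hl) - (\<integral>x. cubic c b v u e x * cnj (v' e x) \<partial>hl))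
      - ((\<integral>x. Q' e x \<partial>hl) - (\<integral>x. Q e x \<partial>hl)) / 2\<bar>
     \<le> C * ((\<integral>x. (cmod (u e x - u' e x))\<^sup>2 \<partial>hl) + (\<integral>x. (cmod (v e x - v' e x))\<^sup>2 \<partial>hl))" (is "?L \<le> ?M")
    if e: "e \<in> {1..N}" for e
  proof -
    note H = H1_graphD(1)[OF u e] H1_graphD(1)[OF v e] H1_graphD(1)[OF u' e] H1_graphD(1)[OF v' e]
    have B: "H1_halfline_norm (u e) \<le> R" "H1_halfline_norm (v e) \<le> R"
       "H1_halfline_norm (u' e) \<le> R" "H1_halfline_norm (v' e) \<le> R"
      using R edge_norm_le[OF e] order_trans by blast+
    note L = cubic_edge_L2[OF H(1,2), of a b] cubic_edge_L2[OF H(3,4), of a b]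
      cubic_edge_L2[OF H(2,1), of c b] cubic_edge_L2[OF H(4,3), of c b]
    have I1: "integrable hl (\<lambda>x. u e x * cnj (cubic a b u' v' e x))"
      "integrable hl (\<lambda>x. cubic a b u v e x * cnj (u' e x))"
      "integrable hl (\<lambda>x. v e x * cnj (cubic c b v' u' e x))"
      "integrable hl (\<lambda>x. cubic c b v u e x * cnj (v' e x))"
      unfolding cubic_def by (intro L2_integrable_mult_cnj L H1_L2 H)+
    have I2: "integrable hl (Q e)" "integrable hl (Q' e)"
      unfolding Q_def[abs_def] Q'_def[abs_def] by (intro integrable_quartic_density H)+
    have eq: "Re (u e x * cnj (cubic a b u' v' e x) - cubic a b u v e x * cnj (u' e x))
       + Re (v e x * cnj (cubic c b v' u' e x) - cubic c b v u e x * cnj (v' e x))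
       - (Q' e x - Q e x) / 2 = - r e x" for x
      unfolding cubic_def Q_def Q'_def r_def F_def G_def F'_def G'_def
      using cross_identity[where a=a and b=b and c=c and z="u e x" and w="v e x" and z'="u' e x" and w'="v' e x"]
      by linarith
    have "Re ((\<integral>x. u e x * cnj (cubic a b u' v' e x) \<partial>hl) - (\<integral>x. cubic a b u v e x * cnj (u' e x) \<partial>hl))
      + Re ((\<integral>x. v e x * cnj (cubic c b v' u' e x) \<partial>hl) - (\<integral>x. cubic c b v u e x * cnj (v' e x) \<partial>hl))
      - ((\<integral>x. Q' e x \<partial>hl) - (\<integral>x. Q e x \<partial>hl)) / 2
      = (\<integral>x. Re (u e x * cnj (cubic a b u' v' e x) - cubic a b u v e x * cnj (u' e x))
       + Re (v e x * cnj (cubic c b v' u' e x) - cubic c b v u e x * cnj (v' e x))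
       - (Q' e x - Q e x) / 2 \<partial>hl)"
      using I1 I2
      by (simp add: Bochner_Integration.integral_add Bochner_Integration.integral_diff integral_Re
          del: times_complex.sel minus_complex.sel)
    also have "\<dots> = (\<integral>x. - r e x \<partial>hl)" unfolding eq ..
    finally have "?L = \<bar>\<integral>x. - r e x \<partial>hl\<bar>" by simp
    also have "\<dots> \<le> (\<integral>x. C * ((cmod (u e x - u' e x))\<^sup>2 + (cmod (v e x - v' e x))\<^sup>2) \<partial>hl)"
    proof (rule order_trans[OF integral_abs_bound integral_mono])
      show "integrable hl (\<lambda>x. C * ((cmod (u e x - u' e x))\<^sup>2 + (cmod (v e x - v' e x))\<^sup>2))"
        by (intro integrable_mult_right Bochner_Integration.integrable_add H1_integrable_sq H1_diff H)
      have "integrable hl (\<lambda>x. - r e x)"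
        unfolding eq[symmetric] using I1 I2
        by (intro Bochner_Integration.integrable_add Bochner_Integration.integrable_diff integrable_Re integrable_divide)
      then show "integrable hl (\<lambda>x. \<bar>- r e x\<bar>)" by (rule integrable_abs)
      fix x assume "x \<in> space hl"
      then have x: "0 \<le> x" by simp
      have w: "\<bar>F e x\<bar> \<le> (\<bar>a\<bar> + \<bar>b\<bar>) * R\<^sup>2" "\<bar>F' e x\<bar> \<le> (\<bar>a\<bar> + \<bar>b\<bar>) * R\<^sup>2"
        "\<bar>G e x\<bar> \<le> (\<bar>c\<bar> + \<bar>b\<bar>) * R\<^sup>2" "\<bar>G' e x\<bar> \<le> (\<bar>c\<bar> + \<bar>b\<bar>) * R\<^sup>2"
        unfolding F_def G_def F'_def G'_def by (intro weight_bound H B x)+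
      have le: "(\<bar>a\<bar> + \<bar>b\<bar>) * R\<^sup>2 \<le> C" "(\<bar>c\<bar> + \<bar>b\<bar>) * R\<^sup>2 \<le> C"
        unfolding C_def by (intro mult_right_mono; simp)+
      have half: "\<bar>(s - t) / 2\<bar> \<le> C" if "\<bar>s\<bar> \<le> K" "\<bar>t\<bar> \<le> K" "K \<le> C" for s t K :: real
        using that unfolding abs_le_iff by (simp add: field_simps)
      have "\<bar>(F' e x - F e x) / 2\<bar> \<le> C" "\<bar>(G' e x - G e x) / 2\<bar> \<le> C"
        by (rule half[OF w(2,1) le(1)], rule half[OF w(4,3) le(2)])
      then have "\<bar>(F' e x - F e x) / 2 * (cmod (u e x - u' e x))\<^sup>2\<bar> \<le> C * (cmod (u e x - u' e x))\<^sup>2"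
        "\<bar>(G' e x - G e x) / 2 * (cmod (v e x - v' e x))\<^sup>2\<bar> \<le> C * (cmod (v e x - v' e x))\<^sup>2"
        unfolding abs_mult abs_power2 abs_norm_cancel by (intro mult_right_mono; simp)+
      moreover have "r e x = (F' e x - F e x) / 2 * (cmod (u e x - u' e x))\<^sup>2
         + (G' e x - G e x) / 2 * (cmod (v e x - v' e x))\<^sup>2" by (simp add: r_def add_divide_distrib)
      ultimately show "\<bar>- r e x\<bar> \<le> C * ((cmod (u e x - u' e x))\<^sup>2 + (cmod (v e x - v' e x))\<^sup>2)"
        unfolding distrib_left by linarith
    qed
    also have "\<dots> = ?M"
      using H1_integrable_sq[OF H1_diff[OF H(1,3)]] H1_integrable_sq[OF H1_diff[OF H(2,4)]] by simp
    finally show ?thesis .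
  qed
  have total: "Re (L2_inner N u (cubic a b u' v') - L2_inner N (cubic a b u v) u')
      + Re (L2_inner N v (cubic c b v' u') - L2_inner N (cubic c b v u) v')
      - (quartic N a b c u' v' - quartic N a b c u v) / 2
     = (\<Sum>e=1..N. Re ((\<integral>x. u e x * cnj (cubic a b u' v' e x) \<partial>hl) - (\<integral>x. cubic a b u v e x * cnj (u' e x) \<partial>hl))
      + Re ((\<integral>x. v e x * cnj (cubic c b v' u' e x) \<partial>hl) - (\<integral>x. cubic c b v u e x * cnj (v' e x) \<partial>hl))
      - ((\<integral>x. Q' e x \<partial>hl) - (\<integral>x. Q e x \<partial>hl)) / 2)"
    by (simp add: L2_inner_hl quartic_def Q_def Q'_def sum.distrib sum_subtractf sum_divide_distrib diff_divide_distrib)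
  have "\<bar>\<Sum>e=1..N. Re ((\<integral>x. u e x * cnj (cubic a b u' v' e x) \<partial>hl) - (\<integral>x. cubic a b u v e x * cnj (u' e x) \<partial>hl))
      + Re ((\<integral>x. v e x * cnj (cubic c b v' u' e x) \<partial>hl) - (\<integral>x. cubic c b v u e x * cnj (v' e x) \<partial>hl))
      - ((\<integral>x. Q' e x \<partial>hl) - (\<integral>x. Q e x \<partial>hl)) / 2\<bar> \<le> (\<Sum>e=1..N. C * ((\<integral>x. (cmod (u e x - u' e x))\<^sup>2 \<partial>hl) + (\<integral>x. (cmod (v e x - v' e x))\<^sup>2 \<partial>hl)))"
    by (rule order_trans[OF sum_abs sum_mono[OF edge]])
  also have "\<dots> = C * (mass N (\<lambda>e x. u e x - u' e x) + mass N (\<lambda>e x. v e x - v' e x))"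
    unfolding mass_def sum.distrib[symmetric] sum_distrib_left ..
  finally show ?thesis unfolding total C_def .
qed

section \<open>Conservation laws\<close>

lemma H1_dual_add:
  "F \<in> H1_dual N \<Longrightarrow> u \<in> H1_graph N \<Longrightarrow> w \<in> H1_graph N \<Longrightarrow> F (\<lambda>e x. u e x + w e x) = F u + F w"
  by (simp add: H1_dual_def)

lemma H1_dual_scale: "F \<in> H1_dual N \<Longrightarrow> w \<in> H1_graph N \<Longrightarrow> F (\<lambda>e x. k * w e x) = cnj k * F w"
  by (simp add: H1_dual_def)

lemma H1_dual_bounded:
  assumes "F \<in> H1_dual N"
  obtains C where "\<And>w. w \<in> H1_graph N \<Longrightarrow> cmod (F w) \<le> C * H1_norm N w"
proof -
  have "\<exists>C. \<forall>w\<in>H1_graph N. cmod (F w) \<le> C * H1_norm N w" using assms by (simp add: H1_dual_def)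
  then show ?thesis using that by blast
qed

text \<open>A real supremum is informative only over a set that is bounded above. Hence some bound C
  must be known beforehand; the conclusion replaces it by the dual norm.\<close>

lemma dual_norm_bound:
  assumes hom: "\<And>k w. w \<in> H1_graph N \<Longrightarrow> F (\<lambda>e x. k * w e x) = cnj k * F w"
    and bd: "\<And>w. w \<in> H1_graph N \<Longrightarrow> cmod (F w) \<le> C * H1_norm N w"
    and w: "w \<in> H1_graph N"
  shows "cmod (F w) \<le> dual_norm N F * H1_norm N w"
proof (cases "H1_norm N w = 0")
  case True
  then show ?thesis using bd[OF w] by simp
next
  case False
  define n where "n = H1_norm N w"
  have n: "n > 0" using False by (simp add: n_def order_le_neq_trans)
  define z where "z = (\<lambda>e x. complex_of_real (1/n) * w e x)"
  have zH: "z \<in> H1_graph N" unfolding z_def by (rule H1_graph_scale[OF w])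
  have "H1_norm N z = cmod (complex_of_real (1/n)) * n"
    unfolding z_def H1_norm_scale[OF w] n_def ..
  then have z1: "H1_norm N z = 1" using n by (simp add: norm_divide)
  have "cmod (F z) \<le> dual_norm N F"
    unfolding dual_norm_def
  proof (rule cSUP_upper)
    show "z \<in> {w \<in> H1_graph N. H1_norm N w \<le> 1}" using zH z1 by simp
    show "bdd_above ((\<lambda>w. cmod (F w)) ` {w \<in> H1_graph N. H1_norm N w \<le> 1})"
    proof (rule bdd_aboveI2)
      fix w assume "w \<in> {w \<in> H1_graph N. H1_norm N w \<le> 1}"
      then have "cmod (F w) \<le> C * H1_norm N w" and w: "H1_norm N w \<le> 1" using bd by auto
      note this(1)
      also have "C * H1_norm N w \<le> \<bar>C\<bar> * 1" using w by (intro mult_mono) auto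
      finally show "cmod (F w) \<le> \<bar>C\<bar>" by simp
    qed
  qed
  moreover have "F z = cnj (complex_of_real (1/n)) * F w" unfolding z_def by (rule hom[OF w])
  then have "cmod (F z) = cmod (F w) / n" using n by (simp add: norm_mult norm_divide)
  ultimately show ?thesis using n by (simp add: field_simps n_def)
qed

section \<open>Continuous curves in the energy space, differentiable in the dual\<close>

definition H1_curve :: "nat \<Rightarrow> (real \<Rightarrow> graph_fun) \<Rightarrow> bool" where
  "H1_curve N u \<longleftrightarrow> (\<forall>t. u t \<in> H1_graph N) \<and>
     (\<forall>t. ((\<lambda>s. H1_norm N (\<lambda>e x. u s e x - u t e x)) \<longlongrightarrow> 0) (at t))"

lemma H1_curve_shift:
  assumes "H1_curve N u" shows "H1_curve N (\<lambda>t. u (t + r))"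
  unfolding H1_curve_def
proof (intro conjI allI)
  show "u (t + r) \<in> H1_graph N" for t using assms by (simp add: H1_curve_def)
  show "((\<lambda>s. H1_norm N (\<lambda>e x. u (s + r) e x - u (t + r) e x)) \<longlongrightarrow> 0) (at t)" for t
    using LIM_offset[where f="\<lambda>s. H1_norm N (\<lambda>e x. u s e x - u (t + r) e x)" and a="t + r" and L=0 and k=r] assms
    by (simp add: H1_curve_def)
qed

lemma C1_dual_shift:
  assumes "C1_dual N u du" shows "C1_dual N (\<lambda>t. u (t + r)) (\<lambda>t. du (t + r))"
  unfolding C1_dual_def
proof (intro conjI allI)
  fix t
  show "du (t + r) \<in> H1_dual N" using assms by (simp add: C1_dual_def)
  define h where "h s = dual_norm N (\<lambda>w. (L2_inner N (u s) w - L2_inner N (u (t + r)) w) / of_real (s - (t + r))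
       - du (t + r) w)" for s
  have "(h \<longlongrightarrow> 0) (at (t + r))" unfolding h_def[abs_def] using assms by (simp add: C1_dual_def del: of_real_diff)
  from LIM_offset[OF this, of r]
  have "((\<lambda>s. h (s + r)) \<longlongrightarrow> 0) (at t)" by simp
  moreover have "s + r - (t + r) = s - t" for s by simp
  ultimately show "((\<lambda>s. dual_norm N (\<lambda>w. (L2_inner N (u (s + r)) w - L2_inner N (u (t + r)) w) / of_real (s - t)
       - du (t + r) w)) \<longlongrightarrow> 0) (at t)"
    unfolding h_def by (simp only:)
  show "((\<lambda>s. dual_norm N (\<lambda>w. du (s + r) w - du (t + r) w)) \<longlongrightarrow> 0) (at t)"
    using LIM_offset[where f="\<lambda>s. dual_norm N (\<lambda>w. du s w - du (t + r) w)" and a="t + r" and L=0 and k=r] assms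
    by (simp add: C1_dual_def)
qed

lemma H1_dual_diff:
  assumes "F \<in> H1_dual N" "u \<in> H1_graph N" "w \<in> H1_graph N"
  shows "F (\<lambda>e x. u e x - w e x) = F u - F w"
proof -
  have "F (\<lambda>e x. u e x + (-1) * w e x) = F u + F (\<lambda>e x. (-1) * w e x)"
    by (rule H1_dual_add[OF assms(1,2) H1_graph_scale[OF assms(3)]])
  moreover have "F (\<lambda>e x. (-1) * w e x) = cnj (-1) * F w" by (rule H1_dual_scale[OF assms(1,3)])
  ultimately show ?thesis by simp
qed

text \<open>The test function moves with s. The quotient converges in dual norm and w(s) stays
  bounded near t, so the error at w(s) vanishes; the limit functional is bounded and hence
  continuous along w.\<close>

lemma inner_difference_quotient:
  assumes u: "H1_curve N u" and w: "H1_curve N w" and du: "C1_dual N u du"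
  shows "((\<lambda>s. (L2_inner N (u s) (w s) - L2_inner N (u t) (w s)) / of_real (s - t)) \<longlongrightarrow> du t (w t)) (at t)"
proof -
  have uH: "u s \<in> H1_graph N" and wH: "w s \<in> H1_graph N" for s using u w by (auto simp: H1_curve_def)
  have wt: "((\<lambda>s. H1_norm N (\<lambda>e x. w s e x - w t e x)) \<longlongrightarrow> 0) (at t)" using w by (simp add: H1_curve_def)
  have D: "du t \<in> H1_dual N" using du by (simp add: C1_dual_def)
  then obtain C where C: "\<And>w. w \<in> H1_graph N \<Longrightarrow> cmod (du t w) \<le> C * H1_norm N w"
    by (rule H1_dual_bounded) blast
  have hom: "\<And>k w. w \<in> H1_graph N \<Longrightarrow> du t (\<lambda>e x. k * w e x) = cnj k * du t w"
    by (rule H1_dual_scale[OF D])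
  define G where "G s = (\<lambda>w. (L2_inner N (u s) w - L2_inner N (u t) w) / of_real (s - t) - du t w)" for s
  have G0: "((\<lambda>s. dual_norm N (G s)) \<longlongrightarrow> 0) (at t)" using du by (simp add: C1_dual_def G_def)
  have Gle: "cmod (G s z) \<le> dual_norm N (G s) * H1_norm N z" if z: "z \<in> H1_graph N" for s z
  proof (rule dual_norm_bound[OF _ _ z])
    show "G s (\<lambda>e x. k * w e x) = cnj k * G s w" if "w \<in> H1_graph N" for k w
      by (simp add: G_def L2_inner_scale_right hom[OF that] diff_divide_distrib algebra_simps)
    \<comment> \<open>The constant may blow up as s tends to t. It certifies, for each single s,
      that the supremum in the dual norm is over a bounded set.\<close>
    show "cmod (G s z) \<le> ((H1_norm N (u s) + H1_norm N (u t)) / \<bar>s - t\<bar> + C) * H1_norm N z"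
      if z: "z \<in> H1_graph N" for z
    proof -
      have "cmod (G s z) \<le> cmod ((L2_inner N (u s) z - L2_inner N (u t) z) / of_real (s - t)) + cmod (du t z)"
        unfolding G_def by (rule norm_triangle_ineq4)
      also have "cmod ((L2_inner N (u s) z - L2_inner N (u t) z) / of_real (s - t))
          = cmod (L2_inner N (u s) z - L2_inner N (u t) z) / \<bar>s - t\<bar>"
        unfolding norm_divide norm_of_real ..
      also have "\<dots> \<le> (H1_norm N (u s) * H1_norm N z + H1_norm N (u t) * H1_norm N z) / \<bar>s - t\<bar>"
        using L2_inner_le[OF uH z, of s] L2_inner_le[OF uH z, of t]
        by (intro divide_right_mono order_trans[OF norm_triangle_ineq4] add_mono) auto
      finally show ?thesis using C[OF z] by (simp add: field_simps add_divide_distrib)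
    qed
  qed
  have wb: "((\<lambda>s. H1_norm N (w t) + H1_norm N (\<lambda>e x. w s e x - w t e x)) \<longlongrightarrow> H1_norm N (w t) + 0) (at t)"
    by (intro tendsto_intros wt)
  have "((\<lambda>s. G s (w s)) \<longlongrightarrow> 0) (at t)"
  proof (rule Lim_null_comparison)
    show "((\<lambda>s. \<bar>dual_norm N (G s)\<bar> * (H1_norm N (w t) + H1_norm N (\<lambda>e x. w s e x - w t e x))) \<longlongrightarrow> 0) (at t)"
      using tendsto_mult[OF tendsto_rabs_zero[OF G0] wb] by simp
    show "\<forall>\<^sub>F s in at t. norm (G s (w s)) \<le> \<bar>dual_norm N (G s)\<bar> * (H1_norm N (w t) + H1_norm N (\<lambda>e x. w s e x - w t e x))"
      by (intro always_eventually allI order_trans[OF Gle[OF wH]] mult_mono H1_norm_le_add_diff wH) auto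
  qed
  moreover have "((\<lambda>s. du t (w s)) \<longlongrightarrow> du t (w t)) (at t)"
  proof (rule LIM_zero_cancel, rule Lim_null_comparison)
    show "((\<lambda>s. C * H1_norm N (\<lambda>e x. w s e x - w t e x)) \<longlongrightarrow> 0) (at t)"
      using tendsto_mult_left[OF wt, of C] by simp
    show "\<forall>\<^sub>F s in at t. norm (du t (w s) - du t (w t)) \<le> C * H1_norm N (\<lambda>e x. w s e x - w t e x)"
      unfolding H1_dual_diff[OF D wH wH, symmetric] by (intro always_eventually allI C H1_graph_diff wH)
  qed
  ultimately have "((\<lambda>s. G s (w s) + du t (w s)) \<longlongrightarrow> 0 + du t (w t)) (at t)" by (rule tendsto_add)
  then show ?thesis by (simp add: G_def)
qed

lemma has_vector_derivative_iff_quotient: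
  fixes f :: "real \<Rightarrow> complex"
  shows "(f has_vector_derivative D) (at t) \<longleftrightarrow> ((\<lambda>s. (f s - f t) / of_real (s - t)) \<longlongrightarrow> D) (at t)"
proof -
  have "\<forall>\<^sub>F s in at t. cmod ((f s - f t) / of_real (s - t) - D) = cmod (f s - f t - (s - t) *\<^sub>R D) / norm (s - t)"
    unfolding eventually_at_filter
  proof (intro always_eventually allI impI)
    fix s assume "s \<noteq> t"
    then have "(f s - f t) / of_real (s - t) - D = (f s - f t - (s - t) *\<^sub>R D) / of_real (s - t)"
      by (simp add: diff_divide_distrib scaleR_conv_of_real)
    then show "cmod ((f s - f t) / of_real (s - t) - D) = cmod (f s - f t - (s - t) *\<^sub>R D) / norm (s - t)"
      by (simp only: norm_divide norm_of_real real_norm_def)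
  qed
  from tendsto_cong[OF this, of 0]
  have "((\<lambda>s. cmod ((f s - f t) / of_real (s - t) - D)) \<longlongrightarrow> 0) (at t)
    \<longleftrightarrow> ((\<lambda>s. cmod (f s - f t - (s - t) *\<^sub>R D) / norm (s - t)) \<longlongrightarrow> 0) (at t)" .
  then show ?thesis
    unfolding has_vector_derivative_def has_derivative_iff_norm
    by (simp add: bounded_linear_scaleR_left tendsto_norm_zero_iff flip: LIM_zero_iff[of _ D])
qed

lemmas has_vector_derivative_quotient = has_vector_derivative_iff_quotient[THEN iffD2]

lemma H1_norm_zero: "H1_norm N (\<lambda>e x. 0) = 0"
proof -
  have "(\<lambda>e x. 0) \<in> H1_graph N"
    by (intro H1_graphI H1I[of _ "\<lambda>x. 0"]) (simp_all add: L2_iff primitive_def set_integrable_def)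
  from H1_norm_scale[OF this, of 0] show ?thesis by simp
qed

lemma inner_has_derivative:
  assumes u: "H1_curve N u" and w: "H1_curve N w" and du: "C1_dual N u du" and dw: "C1_dual N w dw"
  shows "((\<lambda>s. L2_inner N (u s) (w s)) has_vector_derivative (du t (w t) + cnj (dw t (u t)))) (at t)"
proof -
  have const: "H1_curve N (\<lambda>s. u t)" 
    using u by (simp add: H1_curve_def H1_norm_zero)
  have 1: "((\<lambda>s. (L2_inner N (u s) (w s) - L2_inner N (u t) (w s)) / of_real (s - t)) \<longlongrightarrow> du t (w t)) (at t)"
    by (rule inner_difference_quotient[OF u w du])
  have "((\<lambda>s. cnj ((L2_inner N (w s) (u t) - L2_inner N (w t) (u t)) / of_real (s - t))) \<longlongrightarrow> cnj (dw t (u t))) (at t)"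
    by (rule tendsto_cnj[OF inner_difference_quotient[OF w const dw]])
  then have 2: "((\<lambda>s. (L2_inner N (u t) (w s) - L2_inner N (u t) (w t)) / of_real (s - t)) \<longlongrightarrow> cnj (dw t (u t))) (at t)"
    by (simp add: L2_inner_cnj)
  have "((\<lambda>s. (L2_inner N (u s) (w s) - L2_inner N (u t) (w t)) / of_real (s - t))
     \<longlongrightarrow> du t (w t) + cnj (dw t (u t))) (at t)"
    using tendsto_add[OF 1 2] by (simp add: add_divide_distrib[symmetric])
  then show ?thesis
    by (rule has_vector_derivative_quotient)
qed

text \<open>Continuity at each time and the triangle inequality give joint continuity in both times,
  the form needed for compactness arguments.\<close>

lemma H1_curve_dist_continuous:
  assumes u: "H1_curve N u"
  shows "continuous_on UNIV (\<lambda>p. H1_norm N (\<lambda>e x. u (fst p) e x - u (snd p) e x))"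
proof -
  have uH: "u s \<in> H1_graph N" for s using u by (simp add: H1_curve_def)
  define D where "D s t = H1_norm N (\<lambda>e x. u s e x - u t e x)" for s t
  have D0: "D s s = 0" for s by (simp add: D_def H1_norm_zero)
  have c: "isCont (\<lambda>s. D s t) t" for t
    using u by (simp add: isCont_def D0) (simp add: D_def H1_curve_def)
  have sym: "D s t = D t s" for s t unfolding D_def by (rule H1_norm_diff_commute[OF uH uH])
  have tri: "D s t \<le> D s r + D r t" for s t r unfolding D_def by (rule H1_norm_diff_triangle[OF uH uH uH])
  have dist: "\<bar>D s t - D s' t'\<bar> \<le> D s s' + D t t'" for s t s' t'
    using tri[of s t s'] tri[of s' t t'] tri[of s' t' s] tri[of s t' t] sym[of s s'] sym[of t t'] by linarith
  have "isCont (\<lambda>p. D (fst p) (snd p)) (s, t)" for s t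
    unfolding isCont_def
  proof (rule LIM_zero_cancel, rule Lim_null_comparison)
    have "isCont (\<lambda>p::real\<times>real. D (fst p) s + D (snd p) t) (s, t)"
      using isCont_o2[OF isCont_fst[OF continuous_ident], of "(s,t)" "\<lambda>x. D x s"]
        isCont_o2[OF isCont_snd[OF continuous_ident], of "(s,t)" "\<lambda>x. D x t"] c by (intro isCont_add) auto
    then show "((\<lambda>p. D (fst p) s + D (snd p) t) \<longlongrightarrow> 0) (at (s, t))" by (simp add: isCont_def D0)
    show "\<forall>\<^sub>F p in at (s, t). norm (D (fst p) (snd p) - D (fst (s, t)) (snd (s, t))) \<le> D (fst p) s + D (snd p) t"
      using dist by (intro always_eventually) simp
  qed
  then show ?thesis unfolding D_def by (auto simp: continuous_on_eq_continuous_at)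
qed

text \<open>Heine-Cantor for the real function of two times on a compact square: it vanishes on the
  diagonal and is therefore uniformly small near it.\<close>

lemma H1_curve_uniform:
  assumes u: "H1_curve N u" and \<epsilon>: "\<epsilon> > 0"
  obtains \<delta> where "\<delta> > 0" "\<And>t r. \<bar>t\<bar> \<le> T \<Longrightarrow> \<bar>r\<bar> < \<delta> \<Longrightarrow> H1_norm N (\<lambda>e x. u (t + r) e x - u t e x) < \<epsilon>"
proof -
  define D where "D p = H1_norm N (\<lambda>e x. u (fst p) e x - u (snd p) e x)" for p
  \<comment> \<open>The margin 1 keeps t + r inside the square for |r| < 1.\<close>
  define K where "K = {-\<bar>T\<bar>-1..\<bar>T\<bar>+1} \<times> {-\<bar>T\<bar>-1..\<bar>T\<bar>+1}"
  have "compact K" unfolding K_def by (intro compact_Times compact_Icc)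
  then have "uniformly_continuous_on K D"
    using continuous_on_subset[OF H1_curve_dist_continuous[OF u], of K]
    unfolding D_def by (intro compact_uniformly_continuous) auto
  then obtain d where d: "d > 0" "\<And>p q. p \<in> K \<Longrightarrow> q \<in> K \<Longrightarrow> dist q p < d \<Longrightarrow> dist (D q) (D p) < \<epsilon>"
    using \<epsilon> unfolding uniformly_continuous_on_def by metis
  show thesis
  proof (rule that[of "min d 1"])
    show "0 < min d 1" using d by simp
    fix t r :: real assume t: "\<bar>t\<bar> \<le> T" and r: "\<bar>r\<bar> < min d 1"
    have "dist (t + r, t) (t, t) < d" using r by (simp add: dist_Pair_Pair dist_real_def)
    moreover have "(t, t) \<in> K" "(t + r, t) \<in> K" using t r by (auto simp: K_def)
    ultimately have "dist (D (t + r, t)) (D (t, t)) < \<epsilon>" by (rule d(2)[rotated 2])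
    then show "H1_norm N (\<lambda>e x. u (t + r) e x - u t e x) < \<epsilon>"
      by (simp add: D_def H1_norm_zero dist_real_def)
  qed
qed

lemma H1_curve_bounded:
  assumes u: "H1_curve N u"
  obtains R where "0 \<le> R" "\<And>t. \<bar>t\<bar> \<le> T \<Longrightarrow> H1_norm N (u t) \<le> R"
proof -
  have uH: "u s \<in> H1_graph N" for s using u by (simp add: H1_curve_def)
  define D where "D t = H1_norm N (\<lambda>e x. u t e x - u 0 e x)" for t
  have "continuous_on UNIV D" unfolding D_def
    using continuous_on_compose2[OF H1_curve_dist_continuous[OF u], of UNIV "\<lambda>t. (t, 0)"]
    by (simp add: continuous_on_Pair)
  then have "bounded (D ` {-\<bar>T\<bar>..\<bar>T\<bar>})"
    by (intro compact_imp_bounded compact_continuous_image compact_Icc) (auto intro: continuous_on_subset)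
  then obtain B where B: "\<And>t. t \<in> {-\<bar>T\<bar>..\<bar>T\<bar>} \<Longrightarrow> norm (D t) \<le> B"
    unfolding bounded_iff by blast
  show thesis
  proof (rule that[of "H1_norm N (u 0) + \<bar>B\<bar>"])
    fix t assume "\<bar>t\<bar> \<le> T"
    then have "D t \<le> \<bar>B\<bar>" using B[of t] by (auto simp: abs_le_iff)
    then show "H1_norm N (u t) \<le> H1_norm N (u 0) + \<bar>B\<bar>"
      using H1_norm_le_add_diff[OF uH uH, of t 0] by (simp add: D_def)
  qed simp
qed

section \<open>Conservation of mass\<close>

lemma cubic_inner_real:
  shows "Im (L2_inner N (cubic p q u v) u) = 0"
proof -
  have "Im (\<integral>x. cubic p q u v e x * cnj (u e x) \<partial>hl) = 0" for e
  proof -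
    have "(\<integral>x. cubic p q u v e x * cnj (u e x) \<partial>hl)
      = (\<integral>x. complex_of_real ((p * (cmod (u e x))\<^sup>2 + q * (cmod (v e x))\<^sup>2) * (cmod (u e x))\<^sup>2) \<partial>hl)"
      unfolding cubic_def mult.assoc complex_norm_square[symmetric]
      by (intro Bochner_Integration.integral_cong) auto
    then show ?thesis by (simp only: integral_complex_of_real Im_complex_of_real)
  qed
  then show ?thesis by (simp add: L2_inner_hl)
qed

lemma minus_Delta_real: "Im (minus_Delta N \<gamma> u u) = 0"
  using minus_Delta_cnj[of N \<gamma> u u] by (metis Reals_cnj_iff complex_is_Real_iff)

text \<open>The system is invariant under exchanging u with v and a with c. Statements are proved
  for u, and \<open>swap\<close> transfers them to v.\<close>

locale nls_flow =
  fixes N :: nat and \<gamma> a b c :: real and u v :: "real \<Rightarrow> graph_fun" and du dv :: "real \<Rightarrow> graph_fun \<Rightarrow> complex"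
  assumes N: "N \<ge> 1"
    and u: "H1_curve N u" and v: "H1_curve N v"
    and du: "C1_dual N u du" and dv: "C1_dual N v dv"
    and eq_u: "w \<in> H1_graph N \<Longrightarrow> \<i> * du t w - minus_Delta N \<gamma> (u t) w + L2_inner N (cubic a b (u t) (v t)) w = 0"
    and eq_v: "w \<in> H1_graph N \<Longrightarrow> \<i> * dv t w - minus_Delta N \<gamma> (v t) w + L2_inner N (cubic c b (v t) (u t)) w = 0"
begin

lemma uH: "u t \<in> H1_graph N" and vH: "v t \<in> H1_graph N"
  using u v by (simp_all add: H1_curve_def)

lemma swap: "nls_flow N \<gamma> c b a v u dv du"
  using N u v du dv eq_u eq_v by unfold_locales auto

lemma du_eq: "w \<in> H1_graph N \<Longrightarrow> du t w = - \<i> * (minus_Delta N \<gamma> (u t) w - L2_inner N (cubic a b (u t) (v t)) w)"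
  using eq_u[of w t] by (simp add: complex_eq_iff algebra_simps)

text \<open>At the test function u(t) both the form and the cubic pairing are real, so the factor
  -\<i> makes the derivative of u paired with u purely imaginary.\<close>

lemma mass_u_conserved: "mass N (u t) = mass N (u s)"
proof -
  have "((\<lambda>t. mass N (u t)) has_real_derivative 0) (at t)" for t
  proof -
    have "((\<lambda>s. L2_inner N (u s) (u s)) has_vector_derivative (du t (u t) + cnj (du t (u t)))) (at t)"
      by (rule inner_has_derivative[OF u u du du])
    moreover have "Re (du t (u t)) = 0"
      unfolding du_eq[OF uH] by (simp add: cubic_inner_real minus_Delta_real)
    then have "du t (u t) + cnj (du t (u t)) = 0" by (simp add: complex_eq_iff)
    ultimately have "((\<lambda>s. L2_inner N (u s) (u s)) has_vector_derivative 0) (at t)" by simp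
    from bounded_linear.has_vector_derivative[OF bounded_linear_Re this]
    show ?thesis by (simp add: mass_eq(1) has_real_derivative_iff_has_vector_derivative)
  qed
  then show ?thesis using DERIV_isconst_all[of "\<lambda>t. mass N (u t)"] by blast
qed

lemma mass_increment:
  assumes R: "\<And>t. \<bar>t\<bar> \<le> T \<Longrightarrow> H1_norm N (u t) \<le> R" "\<And>t. \<bar>t\<bar> \<le> T \<Longrightarrow> H1_norm N (v t) \<le> R" "0 \<le> R"
    and st: "\<bar>s\<bar> \<le> T" "\<bar>t\<bar> \<le> T"
  shows "mass N (\<lambda>e x. u s e x - u t e x)
     \<le> ((1 + \<bar>\<gamma>\<bar>) * R + (\<bar>a\<bar> + \<bar>b\<bar>) * R\<^sup>2 * R) * \<bar>s - t\<bar> * H1_norm N (\<lambda>e x. u s e x - u t e x)"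
proof -
  define w where "w = (\<lambda>e x. u s e x - u t e x)"
  have w: "w \<in> H1_graph N" unfolding w_def by (rule H1_graph_diff[OF uH uH])
  have wc: "H1_curve N (\<lambda>t. w)" using w by (simp add: H1_curve_def H1_norm_zero)
  define C where "C = (1 + \<bar>\<gamma>\<bar>) * R + (\<bar>a\<bar> + \<bar>b\<bar>) * R\<^sup>2 * R"
  have d: "((\<lambda>s. Re (L2_inner N (u s) w)) has_real_derivative Re (du \<tau> w)) (at \<tau>)" for \<tau>
    using bounded_linear.has_vector_derivative[OF bounded_linear_Re
        has_vector_derivative_quotient[OF inner_difference_quotient[OF u wc du]]]
    by (simp add: has_real_derivative_iff_has_vector_derivative)
  have le: "\<bar>Re (du \<tau> w)\<bar> \<le> C * H1_norm N w" if \<tau>: "\<bar>\<tau>\<bar> \<le> T" for \<tau>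
  proof -
    have "\<bar>Re (du \<tau> w)\<bar> \<le> cmod (du \<tau> w)" by (rule abs_Re_le_cmod)
    also have "\<dots> \<le> cmod (minus_Delta N \<gamma> (u \<tau>) w) + cmod (L2_inner N (cubic a b (u \<tau>) (v \<tau>)) w)"
      unfolding du_eq[OF w] by (simp add: norm_mult norm_triangle_ineq4)
    also have "cmod (minus_Delta N \<gamma> (u \<tau>) w) \<le> (1 + \<bar>\<gamma>\<bar>) * (H1_norm N (u \<tau>) * H1_norm N w)"
      by (rule minus_Delta_le[OF uH w N])
    also have "\<dots> \<le> (1 + \<bar>\<gamma>\<bar>) * (R * H1_norm N w)"
      using R(1)[OF \<tau>] by (intro mult_left_mono mult_right_mono) auto
    also have "cmod (L2_inner N (cubic a b (u \<tau>) (v \<tau>)) w) \<le> (\<bar>a\<bar> + \<bar>b\<bar>) * R\<^sup>2 * (H1_norm N (u \<tau>) * H1_norm N w)"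
      by (rule L2_inner_cubic_le[OF uH vH w R(1)[OF \<tau>] R(2)[OF \<tau>]])
    also have "\<dots> \<le> (\<bar>a\<bar> + \<bar>b\<bar>) * R\<^sup>2 * (R * H1_norm N w)"
      using R(1)[OF \<tau>] by (intro mult_left_mono mult_right_mono) auto
    finally show ?thesis by (simp add: C_def algebra_simps)
  qed
  have "norm (Re (L2_inner N (u s) w) - Re (L2_inner N (u t) w)) \<le> C * H1_norm N w * norm (s - t)"
  proof (rule field_differentiable_bound[where S="{-T..T}"])
    show "((\<lambda>s. Re (L2_inner N (u s) w)) has_field_derivative Re (du z w)) (at z within {-T..T})" for z
      by (rule has_field_derivative_at_within[OF d])
    show "norm (Re (du z w)) \<le> C * H1_norm N w" if "z \<in> {-T..T}" for z
      using le[of z] that by auto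
  qed (use st in auto)
  moreover have "mass N w = Re (L2_inner N (u s) w) - Re (L2_inner N (u t) w)"
    unfolding mass_eq(1) using L2_inner_diff_left[OF H1_graph_L2[OF uH] H1_graph_L2[OF uH] H1_graph_L2[OF w], of s t]
    by (simp add: w_def)
  ultimately show ?thesis unfolding C_def w_def[symmetric]
    by (simp add: mult.commute mult.left_commute)
qed

end

section \<open>Lipschitz continuity of the quartic energy\<close>

lemma integral_norm_mult_le:
  assumes f: "f \<in> L2_halfline" and g: "g \<in> L2_halfline"
  shows "(\<integral>x. cmod (f x) * cmod (g x) \<partial>hl) \<le> L2norm f * L2norm g"
proof -
  have L: "(\<lambda>x. complex_of_real (cmod (h x))) \<in> L2_halfline" if "h \<in> L2_halfline" for h
    using that L2_measurable[OF that]
    by (intro L2_dominated[OF that, where C=1] borel_measurable_of_real[THEN measurable_compose[rotated]]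
        borel_measurable_norm[THEN measurable_compose[rotated]]) auto
  have "(\<integral>x. complex_of_real (cmod (f x)) * cnj (complex_of_real (cmod (g x))) \<partial>hl)
     = complex_of_real (\<integral>x. cmod (f x) * cmod (g x) \<partial>hl)"
    by (simp flip: integral_complex_of_real)
  moreover have "0 \<le> (\<integral>x. cmod (f x) * cmod (g x) \<partial>hl)" by simp
  ultimately show ?thesis using inner_le[OF L[OF f] L[OF g]] by (simp add: L2norm_def)
qed

text \<open>The bound keeps products of an increment with a modulus, because these are integrable on
  the half-line by Cauchy-Schwarz; a bound by constants would not be.\<close>

lemma quartic_density_diff:
  assumes "cmod z \<le> R" "cmod w \<le> R" "cmod z' \<le> R" "cmod w' \<le> R"
  shows "\<bar>quartic_density a b c z w - quartic_density a b c z' w'\<bar>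
     \<le> 2 * (\<bar>a\<bar> + 2 * \<bar>b\<bar> + \<bar>c\<bar>) * R\<^sup>2 * (cmod (z - z') * (cmod z + cmod z') + cmod (w - w') * (cmod w + cmod w'))"
proof -
  define X where "X = (cmod z)\<^sup>2" define Y where "Y = (cmod w)\<^sup>2"
  define X' where "X' = (cmod z')\<^sup>2" define Y' where "Y' = (cmod w')\<^sup>2"
  define dx where "dx = cmod (z - z') * (cmod z + cmod z')"
  define dy where "dy = cmod (w - w') * (cmod w + cmod w')"
  have b: "0 \<le> X" "X \<le> R\<^sup>2" "0 \<le> X'" "X' \<le> R\<^sup>2" "0 \<le> Y" "Y \<le> R\<^sup>2" "0 \<le> Y'" "Y' \<le> R\<^sup>2"
    unfolding X_def Y_def X'_def Y'_def using assms by (auto intro!: power_mono)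
  have sq: "\<bar>(cmod p)\<^sup>2 - (cmod q)\<^sup>2\<bar> \<le> cmod (p - q) * (cmod p + cmod q)" for p q
  proof -
    have "\<bar>(cmod p)\<^sup>2 - (cmod q)\<^sup>2\<bar> = \<bar>cmod p - cmod q\<bar> * (cmod p + cmod q)"
      by (simp add: power2_eq_square square_diff_square_factored abs_mult mult.commute)
    also have "\<dots> \<le> cmod (p - q) * (cmod p + cmod q)"
      by (intro mult_right_mono norm_triangle_ineq3) auto
    finally show ?thesis .
  qed
  have d: "\<bar>X - X'\<bar> \<le> dx" "\<bar>Y - Y'\<bar> \<le> dy"
    unfolding X_def Y_def X'_def Y'_def dx_def dy_def by (rule sq)+
  have "quartic_density a b c z w - quartic_density a b c z' w'
     = (a * (X - X')) * (X + X') + (b * (Y - Y')) * (X + X') + ((b * (X - X')) * (Y + Y') + (c * (Y - Y')) * (Y + Y'))"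
    unfolding quartic_density_def X_def[symmetric] Y_def[symmetric] X'_def[symmetric] Y'_def[symmetric]
    by (simp add: algebra_simps)
  also have "\<bar>\<dots>\<bar> \<le> (\<bar>a\<bar> * dx) * (2 * R\<^sup>2) + (\<bar>b\<bar> * dy) * (2 * R\<^sup>2) + ((\<bar>b\<bar> * dx) * (2 * R\<^sup>2) + (\<bar>c\<bar> * dy) * (2 * R\<^sup>2))"
    using b d
    by (intro order_trans[OF abs_triangle_ineq] add_mono; simp only: abs_mult; intro mult_mono mult_nonneg_nonneg; simp)
  also have "\<dots> \<le> 2 * (\<bar>a\<bar> + 2 * \<bar>b\<bar> + \<bar>c\<bar>) * R\<^sup>2 * (dx + dy)"
  proof -
    have "0 \<le> R\<^sup>2 * dx * \<bar>b\<bar>" "0 \<le> R\<^sup>2 * dx * \<bar>c\<bar>" "0 \<le> R\<^sup>2 * dy * \<bar>b\<bar>" "0 \<le> R\<^sup>2 * dy * \<bar>a\<bar>"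
      by (simp_all add: dx_def dy_def)
    then show ?thesis by (simp add: algebra_simps)
  qed
  finally show ?thesis unfolding dx_def dy_def .
qed

lemma quartic_lipschitz:
  assumes u: "u \<in> H1_graph N" and v: "v \<in> H1_graph N" and u': "u' \<in> H1_graph N" and v': "v' \<in> H1_graph N"
    and R: "H1_norm N u \<le> R" "H1_norm N v \<le> R" "H1_norm N u' \<le> R" "H1_norm N v' \<le> R"
  shows "\<bar>quartic N a b c u v - quartic N a b c u' v'\<bar> \<le> 4 * (\<bar>a\<bar> + 2 * \<bar>b\<bar> + \<bar>c\<bar>) * R ^ 3 *
     (H1_norm N (\<lambda>e x. u e x - u' e x) + H1_norm N (\<lambda>e x. v e x - v' e x))"
proof -
  define K where "K = 2 * (\<bar>a\<bar> + 2 * \<bar>b\<bar> + \<bar>c\<bar>) * R\<^sup>2"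
  have R0: "R \<ge> 0" using R(1) H1_norm_nonneg[of N u] by linarith
  have K0: "K \<ge> 0" by (simp add: K_def)
  define d where "d e = L2norm (\<lambda>x. u e x - u' e x) * L2norm (u e) + L2norm (\<lambda>x. u e x - u' e x) * L2norm (u' e)
     + (L2norm (\<lambda>x. v e x - v' e x) * L2norm (v e) + L2norm (\<lambda>x. v e x - v' e x) * L2norm (v' e))" for e
  have edge: "\<bar>(\<integral>x. quartic_density a b c (u e x) (v e x) \<partial>hl) - (\<integral>x. quartic_density a b c (u' e x) (v' e x) \<partial>hl)\<bar>
      \<le> K * d e" if e: "e \<in> {1..N}" for e
  proof -
    note H = H1_graphD(1)[OF u e] H1_graphD(1)[OF v e] H1_graphD(1)[OF u' e] H1_graphD(1)[OF v' e]
    define h where "h x = cmod (u e x - u' e x) * cmod (u e x) + cmod (u e x - u' e x) * cmod (u' e x)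
       + (cmod (v e x - v' e x) * cmod (v e x) + cmod (v e x - v' e x) * cmod (v' e x))" for x
    have Q: "integrable hl (\<lambda>x. quartic_density a b c (u e x) (v e x))"
      "integrable hl (\<lambda>x. quartic_density a b c (u' e x) (v' e x))"
      by (intro integrable_quartic_density H)+
    have L: "u e \<in> L2_halfline" "v e \<in> L2_halfline" "u' e \<in> L2_halfline" "v' e \<in> L2_halfline"
      "(\<lambda>x. u e x - u' e x) \<in> L2_halfline" "(\<lambda>x. v e x - v' e x) \<in> L2_halfline"
      by (intro H1_L2 L2_diff H)+
    note I = L2_integrable_norm_mult[OF L(5,1)] L2_integrable_norm_mult[OF L(5,3)]
      L2_integrable_norm_mult[OF L(6,2)] L2_integrable_norm_mult[OF L(6,4)]
    have "\<bar>(\<integral>x. quartic_density a b c (u e x) (v e x) \<partial>hl) - (\<integral>x. quartic_density a b c (u' e x) (v' e x) \<partial>hl)\<bar>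
      = \<bar>\<integral>x. quartic_density a b c (u e x) (v e x) - quartic_density a b c (u' e x) (v' e x) \<partial>hl\<bar>"
      using Q by simp
    also have "\<dots> \<le> (\<integral>x. K * h x \<partial>hl)"
    proof (rule order_trans[OF integral_abs_bound integral_mono])
      show "integrable hl (\<lambda>x. \<bar>quartic_density a b c (u e x) (v e x) - quartic_density a b c (u' e x) (v' e x)\<bar>)"
        by (intro integrable_abs Bochner_Integration.integrable_diff Q)
      show "integrable hl (\<lambda>x. K * h x)" unfolding h_def
        by (intro integrable_mult_right Bochner_Integration.integrable_add I)
      fix x assume "x \<in> space hl"
      then have "cmod (u e x) \<le> R" "cmod (v e x) \<le> R" "cmod (u' e x) \<le> R" "cmod (v' e x) \<le> R"
        using graph_sup_bound[OF u e, of x] graph_sup_bound[OF v e, of x]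
          graph_sup_bound[OF u' e, of x] graph_sup_bound[OF v' e, of x] R by auto
      from quartic_density_diff[OF this, of a b c]
      show "\<bar>quartic_density a b c (u e x) (v e x) - quartic_density a b c (u' e x) (v' e x)\<bar> \<le> K * h x"
        by (simp add: K_def h_def distrib_left)
    qed
    also have "(\<integral>x. K * h x \<partial>hl) = K * (\<integral>x. h x \<partial>hl)" by simp
    also have "(\<integral>x. h x \<partial>hl) \<le> d e"
      unfolding h_def d_def using I
      by (simp add: add_mono integral_norm_mult_le[OF L(5,1)] integral_norm_mult_le[OF L(5,3)]
        integral_norm_mult_le[OF L(6,2)] integral_norm_mult_le[OF L(6,4)])
    finally show ?thesis using K0 by (simp add: mult_left_mono)
  qed
  have sum: "(\<Sum>e=1..N. L2norm (\<lambda>x. p e x - p' e x) * L2norm (q e)) \<le> H1_norm N (\<lambda>e x. p e x - p' e x) * R"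
    if "H1_norm N q \<le> R" for p p' q
  proof -
    have "(\<Sum>e=1..N. L2norm (\<lambda>x. p e x - p' e x) * L2norm (q e)) \<le> H1_norm N (\<lambda>e x. p e x - p' e x) * H1_norm N q"
      by (rule sum_mult_le_H1_norm) (auto intro: L2norm_le_H1)
    also have "\<dots> \<le> H1_norm N (\<lambda>e x. p e x - p' e x) * R" using that by (intro mult_left_mono) auto
    finally show ?thesis .
  qed
  have "\<bar>quartic N a b c u v - quartic N a b c u' v'\<bar> \<le> (\<Sum>e=1..N. K * d e)"
    unfolding quartic_def sum_subtractf[symmetric] by (rule order_trans[OF sum_abs sum_mono[OF edge]])
  also have "\<dots> = K * (\<Sum>e=1..N. d e)" by (simp add: sum_distrib_left)
  also have "(\<Sum>e=1..N. d e) \<le> 2 * R * (H1_norm N (\<lambda>e x. u e x - u' e x) + H1_norm N (\<lambda>e x. v e x - v' e x))"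
    using sum[OF R(1), of u u'] sum[OF R(3), of u u'] sum[OF R(2), of v v'] sum[OF R(4), of v v']
    unfolding d_def by (simp add: sum.distrib algebra_simps)
  finally have 1: "\<bar>quartic N a b c u v - quartic N a b c u' v'\<bar>
      \<le> K * (2 * R * (H1_norm N (\<lambda>e x. u e x - u' e x) + H1_norm N (\<lambda>e x. v e x - v' e x)))"
    using K0 by (simp add: mult_left_mono)
  have e: "K * (2 * R) = 4 * (\<bar>a\<bar> + 2 * \<bar>b\<bar> + \<bar>c\<bar>) * R ^ 3"
    by (simp add: K_def power2_eq_square power3_eq_cube)
  then have "K * (2 * R * (H1_norm N (\<lambda>e x. u e x - u' e x) + H1_norm N (\<lambda>e x. v e x - v' e x)))
    = 4 * (\<bar>a\<bar> + 2 * \<bar>b\<bar> + \<bar>c\<bar>) * R ^ 3 * (H1_norm N (\<lambda>e x. u e x - u' e x) + H1_norm N (\<lambda>e x. v e x - v' e x))"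
    unfolding e[symmetric] by (simp add: mult.assoc)
  with 1 show ?thesis by simp
qed

context nls_flow begin

text \<open>Continuity in time gives the quartic energy an antiderivative, which the proof of energy
  conservation uses.\<close>

lemma quartic_continuous: "isCont (\<lambda>t. quartic N a b c (u t) (v t)) t"
proof -
  obtain R where R: "0 \<le> R" "\<And>s. \<bar>s\<bar> \<le> \<bar>t\<bar> + 1 \<Longrightarrow> H1_norm N (u s) \<le> R"
    using H1_curve_bounded[OF u, where T="\<bar>t\<bar> + 1"] by blast
  obtain R' where R': "0 \<le> R'" "\<And>s. \<bar>s\<bar> \<le> \<bar>t\<bar> + 1 \<Longrightarrow> H1_norm N (v s) \<le> R'"
    using H1_curve_bounded[OF v, where T="\<bar>t\<bar> + 1"] by blast
  define M where "M = max R R'"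
  define K where "K = 4 * (\<bar>a\<bar> + 2 * \<bar>b\<bar> + \<bar>c\<bar>) * M ^ 3"
  have "((\<lambda>s. K * (H1_norm N (\<lambda>e x. u s e x - u t e x) + H1_norm N (\<lambda>e x. v s e x - v t e x))) \<longlongrightarrow> K * (0 + 0)) (at t)"
    using u v by (intro tendsto_intros) (simp_all add: H1_curve_def)
  then have lim: "((\<lambda>s. K * (H1_norm N (\<lambda>e x. u s e x - u t e x) + H1_norm N (\<lambda>e x. v s e x - v t e x))) \<longlongrightarrow> 0) (at t)"
    by simp
  have "\<forall>\<^sub>F s in at t. dist s t < 1" unfolding eventually_at by (intro exI[of _ 1]) auto
  then have le: "\<forall>\<^sub>F s in at t. norm (quartic N a b c (u s) (v s) - quartic N a b c (u t) (v t))
      \<le> K * (H1_norm N (\<lambda>e x. u s e x - u t e x) + H1_norm N (\<lambda>e x. v s e x - v t e x))"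
  proof eventually_elim
    case (elim s)
    then have s: "\<bar>s\<bar> \<le> \<bar>t\<bar> + 1" by (auto simp: dist_real_def)
    show ?case unfolding K_def real_norm_def
      using R(2)[OF s] R'(2)[OF s] R(2)[of t] R'(2)[of t] by (intro quartic_lipschitz uH vH) (auto simp: M_def)
  qed
  show ?thesis unfolding isCont_def by (rule LIM_zero_cancel, rule Lim_null_comparison[OF le lim])
qed

lemma shifted_overlap_deriv:
  "((\<lambda>s. Im (L2_inner N (u (s + r)) (u s))) has_real_derivative
    - Re (L2_inner N (u (t+r)) (cubic a b (u t) (v t)) - L2_inner N (cubic a b (u (t+r)) (v (t+r))) (u t))) (at t)"
proof -
  have "((\<lambda>s. Im (L2_inner N (u (s + r)) (u s))) has_vector_derivative
      Im (du (t + r) (u t) + cnj (du t (u (t + r))))) (at t)"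
    by (rule bounded_linear.has_vector_derivative[OF bounded_linear_Im
      inner_has_derivative[OF H1_curve_shift[OF u] u C1_dual_shift[OF du] du]])
  moreover have "Im (du (t + r) (u t) + cnj (du t (u (t + r))))
     = - Re (L2_inner N (u (t+r)) (cubic a b (u t) (v t)) - L2_inner N (cubic a b (u (t+r)) (v (t+r))) (u t))"
  proof -
    have "minus_Delta N \<gamma> (u t) (u (t + r)) = cnj (minus_Delta N \<gamma> (u (t + r)) (u t))"
      by (simp add: minus_Delta_cnj)
    moreover have "L2_inner N (u (t+r)) (cubic a b (u t) (v t)) = cnj (L2_inner N (cubic a b (u t) (v t)) (u (t+r)))"
      by (simp add: L2_inner_cnj)
    ultimately show ?thesis unfolding du_eq[OF uH] by simp
  qed
  ultimately show ?thesis by (simp add: has_real_derivative_iff_has_vector_derivative)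
qed

lemma overlap_deriv:
  "((\<lambda>s. Im (L2_inner N (u s) (u t))) has_real_derivative Im (du t (u t))) (at t)"
proof -
  have "H1_curve N (\<lambda>s. u t)" using uH by (simp add: H1_curve_def H1_norm_zero)
  from bounded_linear.has_vector_derivative[OF bounded_linear_Im
      has_vector_derivative_quotient[OF inner_difference_quotient[OF u this du]]]
  show ?thesis by (simp add: has_real_derivative_iff_has_vector_derivative)
qed

text \<open>
  The pairing of \<open>du\<close> with itself makes no sense at this regularity, so the energy cannot be
  differentiated directly. In \<open>Im \<langle>u(t+r), u(t)\<rangle>\<close> the operator drops out of the time derivative by
  symmetry, and what remains is a difference of quartic energies up to \<open>o(r)\<close>; dividing by \<open>r\<close> and
  letting \<open>r \<rightarrow> 0\<close> recovers the quadratic part of the energy.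
\<close>

lemma energy_conserved: "energy N \<gamma> a b c (u t) (v t) = energy N \<gamma> a b c (u 0) (v 0)"
proof -
  define q where "q t = quartic N a b c (u t) (v t)" for t
  define A where "A t = Re (minus_Delta N \<gamma> (u t) (u t)) + Re (minus_Delta N \<gamma> (v t) (v t))" for t
  have "\<exists>F. \<forall>x::real. - \<infinity> < ereal x \<longrightarrow> ereal x < \<infinity> \<longrightarrow> (F has_vector_derivative q x) (at x)"
    by (rule einterval_antiderivative) (auto simp: q_def quartic_continuous)
  then obtain P where P: "\<And>x. (P has_real_derivative q x) (at x)"
    by (auto simp: has_real_derivative_iff_has_vector_derivative)
  define y where "y r t = Im (L2_inner N (u (t + r)) (u t)) + Im (L2_inner N (v (t + r)) (v t))" for r t
  \<comment> \<open>The derivative of the overlap \<open>y r\<close> is half the increment of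
    \<open>q\<close> up to o(r). Subtracting half the increment of \<open>P\<close> leaves a
    function of time whose derivative is o(r).\<close>
  define Z where "Z r t = y r t - (P (t + r) - P t) / 2" for r t
  define K where "K r t = Re (L2_inner N (u (t+r)) (cubic a b (u t) (v t)) - L2_inner N (cubic a b (u (t+r)) (v (t+r))) (u t))
      + Re (L2_inner N (v (t+r)) (cubic c b (v t) (u t)) - L2_inner N (cubic c b (v (t+r)) (u (t+r))) (v t))" for r t
  interpret sw: nls_flow N \<gamma> c b a v u dv du by (rule swap)
  have dy: "(y r has_real_derivative - K r t) (at t)" for r t
    unfolding y_def[abs_def] K_def
    by (rule DERIV_cong[OF DERIV_add[OF shifted_overlap_deriv sw.shifted_overlap_deriv]]) simp
  have dZ: "(Z r has_real_derivative (- K r t - (q (t + r) - q t) / 2)) (at t)" for r t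
    unfolding Z_def[abs_def]
    by (rule derivative_eq_intros dy DERIV_chain2[OF P, of "\<lambda>t. t + r"] P refl | simp)+
  define T where "T = \<bar>t\<bar> + 1"
  obtain R1 where R1: "0 \<le> R1" "\<And>s. \<bar>s\<bar> \<le> T \<Longrightarrow> H1_norm N (u s) \<le> R1"
    using H1_curve_bounded[OF u, where T=T] by blast
  obtain R2 where R2: "0 \<le> R2" "\<And>s. \<bar>s\<bar> \<le> T \<Longrightarrow> H1_norm N (v s) \<le> R2"
    using H1_curve_bounded[OF v, where T=T] by blast
  define R where "R = max R1 R2"
  have R: "0 \<le> R" "\<And>s. \<bar>s\<bar> \<le> T \<Longrightarrow> H1_norm N (u s) \<le> R" "\<And>s. \<bar>s\<bar> \<le> T \<Longrightarrow> H1_norm N (v s) \<le> R"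
    using R1(1) order_trans[OF R1(2) max.cobounded1] order_trans[OF R2(2) max.cobounded2] by (auto simp: R_def)
  define C where "C = (\<bar>a\<bar> + \<bar>b\<bar> + \<bar>c\<bar>) * R\<^sup>2"
  define L where "L = max ((1 + \<bar>\<gamma>\<bar>) * R + (\<bar>a\<bar> + \<bar>b\<bar>) * R\<^sup>2 * R) ((1 + \<bar>\<gamma>\<bar>) * R + (\<bar>c\<bar> + \<bar>b\<bar>) * R\<^sup>2 * R)"
  have C0: "C \<ge> 0" and L0: "L \<ge> 0" using R(1) by (simp_all add: C_def L_def max_def)
  have bound: "\<bar>Z r t - Z r 0\<bar> \<le> C * L * \<bar>r\<bar> * (\<epsilon> + \<epsilon>) * \<bar>t\<bar>"
    if \<epsilon>: "\<And>s. \<bar>s\<bar> \<le> \<bar>t\<bar> \<Longrightarrow> H1_norm N (\<lambda>e x. u (s + r) e x - u s e x) \<le> \<epsilon>"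
      "\<And>s. \<bar>s\<bar> \<le> \<bar>t\<bar> \<Longrightarrow> H1_norm N (\<lambda>e x. v (s + r) e x - v s e x) \<le> \<epsilon>"
    and r: "\<bar>r\<bar> \<le> 1" for r \<epsilon>
  proof -
    have "norm (Z r t - Z r 0) \<le> (C * L * \<bar>r\<bar> * (\<epsilon> + \<epsilon>)) * norm (t - 0)"
    proof (rule field_differentiable_bound[where S="{-\<bar>t\<bar>..\<bar>t\<bar>}"])
      show "(Z r has_field_derivative (- K r z - (q (z + r) - q z) / 2)) (at z within {-\<bar>t\<bar>..\<bar>t\<bar>})" for z
        by (rule has_field_derivative_at_within[OF dZ])
      fix s assume "s \<in> {-\<bar>t\<bar>..\<bar>t\<bar>}"
      then have s: "\<bar>s\<bar> \<le> \<bar>t\<bar>" by auto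
      then have sT: "\<bar>s\<bar> \<le> T" "\<bar>s + r\<bar> \<le> T" using r by (auto simp: T_def)
      have "\<bar>K r s - (q s - q (s + r)) / 2\<bar>
        \<le> C * (mass N (\<lambda>e x. u (s+r) e x - u s e x) + mass N (\<lambda>e x. v (s+r) e x - v s e x))"
        unfolding K_def q_def C_def by (intro cubic_cross uH vH R sT)
      also have "\<dots> \<le> C * (L * \<bar>r\<bar> * \<epsilon> + L * \<bar>r\<bar> * \<epsilon>)"
      proof (intro mult_left_mono[OF _ C0] add_mono)
        have "mass N (\<lambda>e x. u (s+r) e x - u s e x)
          \<le> ((1 + \<bar>\<gamma>\<bar>) * R + (\<bar>a\<bar> + \<bar>b\<bar>) * R\<^sup>2 * R) * \<bar>s + r - s\<bar> * H1_norm N (\<lambda>e x. u (s+r) e x - u s e x)"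
          by (rule mass_increment[OF R(2,3,1) sT(2,1)])
        also have "\<dots> \<le> L * \<bar>r\<bar> * \<epsilon>" using \<epsilon>(1)[OF s] L0 by (intro mult_mono) (auto simp: L_def)
        finally show "mass N (\<lambda>e x. u (s+r) e x - u s e x) \<le> L * \<bar>r\<bar> * \<epsilon>" .
        have "mass N (\<lambda>e x. v (s+r) e x - v s e x)
          \<le> ((1 + \<bar>\<gamma>\<bar>) * R + (\<bar>c\<bar> + \<bar>b\<bar>) * R\<^sup>2 * R) * \<bar>s + r - s\<bar> * H1_norm N (\<lambda>e x. v (s+r) e x - v s e x)"
          by (rule sw.mass_increment[OF R(3,2,1) sT(2,1)])
        also have "\<dots> \<le> L * \<bar>r\<bar> * \<epsilon>" using \<epsilon>(2)[OF s] L0 by (intro mult_mono) (auto simp: L_def)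
        finally show "mass N (\<lambda>e x. v (s+r) e x - v s e x) \<le> L * \<bar>r\<bar> * \<epsilon>" .
      qed
      also have "\<dots> = C * L * \<bar>r\<bar> * (\<epsilon> + \<epsilon>)" by (simp add: algebra_simps)
      also have "\<bar>K r s - (q s - q (s + r)) / 2\<bar> = norm (- K r s - (q (s + r) - q s) / 2)"
        by (simp add: abs_minus_commute field_simps)
      finally show "norm (- K r s - (q (s + r) - q s) / 2) \<le> C * L * \<bar>r\<bar> * (\<epsilon> + \<epsilon>)" .
    qed auto
    then show ?thesis by simp
  qed
  \<comment> \<open>At fixed s the overlap of u(s) with itself is real, so \<open>Z r s / r\<close>
    is a genuine difference quotient at r = 0. The value -(A - q) - q/2 is minus the energy.\<close>
  have lim: "((\<lambda>r. (Z r s) / r) \<longlongrightarrow> - energy N \<gamma> a b c (u s) (v s)) (at 0)" for s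
  proof -
    have "((\<lambda>t. Im (L2_inner N (u t) (u s)) + Im (L2_inner N (v t) (v s)) - P t / 2)
        has_real_derivative (Im (du s (u s)) + Im (dv s (v s)) - q s / 2)) (at s)"
      by (intro DERIV_diff DERIV_add DERIV_cdivide P overlap_deriv sw.overlap_deriv)
    moreover have "Im (L2_inner N (u s) (u s)) = 0" "Im (L2_inner N (v s) (v s)) = 0"
      by (simp_all add: mass_eq(2))
    moreover have "Im (du s (u s)) + Im (dv s (v s)) = - (A s - q s)"
    proof -
      have "Re (L2_inner N (cubic a b (u s) (v s)) (u s)) + Re (L2_inner N (cubic c b (v s) (u s)) (v s)) = q s"
        using arg_cong[OF quartic_eq_inner[OF uH vH], of Re a b s s c] by (simp add: q_def)
      then show ?thesis unfolding du_eq[OF uH] sw.du_eq[OF vH] by (simp add: A_def)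
    qed
    ultimately have "((\<lambda>r. (y r s - (P (s + r) - P s) / 2) / r) \<longlongrightarrow> - (A s - q s) - q s / 2) (at 0)"
      unfolding DERIV_def y_def by (simp add: diff_divide_distrib algebra_simps)
    moreover have "- (A s - q s) - q s / 2 = - energy N \<gamma> a b c (u s) (v s)"
      by (simp add: energy_def A_def q_def)
    ultimately show ?thesis by (simp add: Z_def)
  qed
  have "((\<lambda>r. (Z r t - Z r 0) / r) \<longlongrightarrow> 0) (at 0)"
  proof (rule tendstoI)
    fix \<epsilon> :: real assume \<epsilon>: "\<epsilon> > 0"
    \<comment> \<open>The summand 1 makes d positive even when the other factors vanish.\<close>
    define d where "d = C * L * 2 * \<bar>t\<bar> + 1"
    define \<epsilon>' where "\<epsilon>' = \<epsilon> / d / 2"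
    have den: "d > 0" unfolding d_def using C0 L0 by (smt (verit) mult_nonneg_nonneg abs_ge_zero)
    have \<epsilon>': "\<epsilon>' > 0" using \<epsilon> den by (simp add: \<epsilon>'_def)
    obtain d1 where d1: "d1 > 0" "\<And>s r. \<bar>s\<bar> \<le> \<bar>t\<bar> \<Longrightarrow> \<bar>r\<bar> < d1 \<Longrightarrow> H1_norm N (\<lambda>e x. u (s + r) e x - u s e x) < \<epsilon>'"
      using H1_curve_uniform[OF u \<epsilon>'] by metis
    obtain d2 where d2: "d2 > 0" "\<And>s r. \<bar>s\<bar> \<le> \<bar>t\<bar> \<Longrightarrow> \<bar>r\<bar> < d2 \<Longrightarrow> H1_norm N (\<lambda>e x. v (s + r) e x - v s e x) < \<epsilon>'"
      using H1_curve_uniform[OF v \<epsilon>'] by metis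
    show "\<forall>\<^sub>F r in at 0. dist ((Z r t - Z r 0) / r) 0 < \<epsilon>"
      unfolding eventually_at
    proof (intro exI[of _ "min 1 (min d1 d2)"] conjI ballI impI)
      show "0 < min 1 (min d1 d2)" using d1 d2 by simp
      fix r :: real assume r: "r \<noteq> 0 \<and> dist r 0 < min 1 (min d1 d2)"
      have "\<bar>Z r t - Z r 0\<bar> \<le> C * L * \<bar>r\<bar> * (\<epsilon>' + \<epsilon>') * \<bar>t\<bar>"
        using r d1 d2 by (intro bound less_imp_le[OF d1(2)] less_imp_le[OF d2(2)]) auto
      also have "\<dots> = (C * L * 2 * \<bar>t\<bar> * \<epsilon>') * \<bar>r\<bar>" by simp
      finally have "\<bar>Z r t - Z r 0\<bar> / \<bar>r\<bar> \<le> C * L * 2 * \<bar>t\<bar> * \<epsilon>'" using r by (simp add: field_simps)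
      also have "\<dots> \<le> d * \<epsilon>'" unfolding d_def using \<epsilon>' by (intro mult_right_mono) auto
      also have "\<dots> = \<epsilon> / 2" using den by (simp add: \<epsilon>'_def)
      also have "\<dots> < \<epsilon>" using \<epsilon> by simp
      finally show "dist ((Z r t - Z r 0) / r) 0 < \<epsilon>" by (simp add: dist_real_def)
    qed
  qed
  moreover have "((\<lambda>r. (Z r t - Z r 0) / r) \<longlongrightarrow> - energy N \<gamma> a b c (u t) (v t) - - energy N \<gamma> a b c (u 0) (v 0)) (at 0)"
    unfolding diff_divide_distrib by (intro tendsto_diff lim)
  ultimately have "0 = - energy N \<gamma> a b c (u t) (v t) - - energy N \<gamma> a b c (u 0) (v 0)"
    using LIM_unique by blast
  then show ?thesis by simp
qed

end

section \<open>The soliton profile\<close>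

lemma tanh_artanh_real:
  fixes x :: real
  assumes "\<bar>x\<bar> < 1"
  shows "tanh (artanh x) = x"
proof -
  have p: "1 + x > 0" "1 - x > 0" using assms by auto
  have "exp (- 2 * artanh x) = exp (- ln ((1 + x) / (1 - x)))" by (simp add: artanh_def)
  also have "\<dots> = (1 - x) / (1 + x)" using p by (simp add: exp_minus)
  finally have e: "exp (- 2 * artanh x) = (1 - x) / (1 + x)" .
  show ?thesis unfolding tanh_real_altdef e using p by (simp add: divide_simps)
qed

lemma nonneg_FTC_halfline:
  fixes f F :: "real \<Rightarrow> real"
  assumes d: "\<And>x. (F has_real_derivative f x) (at x)" and c: "continuous_on UNIV f"
    and nn: "\<And>x. 0 \<le> x \<Longrightarrow> 0 \<le> f x" and lim: "(F \<longlongrightarrow> L) at_top"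
  shows "integrable hl f" "(\<integral>x. f x \<partial>hl) = L - F 0"
proof -
  have m: "f \<in> borel_measurable borel" by (rule borel_measurable_continuous_onI[OF c])
  have "F 0 \<le> L"
  proof (rule tendsto_lowerbound[OF lim])
    show "\<forall>\<^sub>F x in at_top. F 0 \<le> F x"
      using eventually_ge_at_top[of 0]
      by eventually_elim (rule DERIV_nonneg_imp_nondecreasing, auto intro: d nn)
  qed simp
  have n: "(\<integral>\<^sup>+x. ennreal (f x) * indicator {0..} x \<partial>lborel) = ennreal (L - F 0)"
    by (rule nn_integral_FTC_atLeast[OF m d nn lim])
  have "has_bochner_integral lborel (\<lambda>x. indicator {0..} x *\<^sub>R f x) (L - F 0)"
  proof (rule has_bochner_integral_nn_integral)
    show "(\<lambda>x. indicat_real {0..} x *\<^sub>R f x) \<in> borel_measurable lborel" using m by measurable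
    show "AE x in lborel. 0 \<le> indicat_real {0..} x *\<^sub>R f x"
      using nn by (auto split: split_indicator)
    show "0 \<le> L - F 0" using \<open>F 0 \<le> L\<close> by simp
    show "(\<integral>\<^sup>+ x. ennreal (indicat_real {0..} x *\<^sub>R f x) \<partial>lborel) = ennreal (L - F 0)"
      unfolding n[symmetric] by (intro nn_integral_cong) (auto split: split_indicator)
  qed
  then show "integrable hl f" "(\<integral>x. f x \<partial>hl) = L - F 0"
    by (auto simp: has_bochner_integral_iff integrable_restrict_space integral_restrict_space)
qed

text \<open>One edge of the soliton. The parameter q is -\<phi>'(0)/\<phi>(0), later \<gamma>/N. Its
  positivity puts the half-line on the decreasing side of the sech profile, so that Q \<ge> q > 0
  and division by Q is harmless.\<close>

locale soliton_profile =
  fixes q \<omega> :: real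
  assumes q: "0 < q" and q_less: "q < sqrt \<omega>"
begin

definition Q :: "real \<Rightarrow> real" where
  "Q x = sqrt \<omega> * tanh (sqrt \<omega> * x + artanh (q / sqrt \<omega>))"

definition \<phi> :: "real \<Rightarrow> real" where
  "\<phi> x = sqrt (2 * \<omega>) * (1 / cosh (sqrt \<omega> * x + artanh (q / sqrt \<omega>)))"

lemma sqrt_pos: "0 < sqrt \<omega>" using q q_less by linarith

lemma \<omega>_pos: "0 < \<omega>" using sqrt_pos by simp

lemma Q_0: "Q 0 = q"
proof -
  have "\<bar>q / sqrt \<omega>\<bar> < 1" using q q_less sqrt_pos by simp
  then show ?thesis using sqrt_pos by (simp add: Q_def tanh_artanh_real)
qed

lemma Q_deriv: "(Q has_real_derivative (\<omega> - (Q x)\<^sup>2)) (at x)"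
proof -
  have "(Q has_real_derivative sqrt \<omega> * ((1 - (tanh (sqrt \<omega> * x + artanh (q / sqrt \<omega>)))\<^sup>2) * sqrt \<omega>)) (at x)"
    unfolding Q_def[abs_def] by (auto intro!: derivative_eq_intros)
  moreover have "sqrt \<omega> * ((1 - (tanh (sqrt \<omega> * x + artanh (q / sqrt \<omega>)))\<^sup>2) * sqrt \<omega>) = \<omega> - (Q x)\<^sup>2"
    using \<omega>_pos by (simp add: Q_def power_mult_distrib algebra_simps)
  ultimately show ?thesis by simp
qed

lemma Q_less: "Q x < sqrt \<omega>"
  using sqrt_pos tanh_real_lt_1 by (simp add: Q_def)

lemma Q_ge: "0 \<le> x \<Longrightarrow> q \<le> Q x"
  using sqrt_pos by (subst Q_0[symmetric]) (simp add: Q_def)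

lemma Q_pos: "0 \<le> x \<Longrightarrow> 0 < Q x"
  using Q_ge[of x] q by linarith

lemma Q_lim: "(Q \<longlongrightarrow> sqrt \<omega>) at_top"
proof -
  have "filterlim (\<lambda>x. artanh (q / sqrt \<omega>) + sqrt \<omega> * x) at_top at_top"
    using sqrt_pos by (intro filterlim_tendsto_add_at_top[OF tendsto_const]
        filterlim_tendsto_pos_mult_at_top[OF tendsto_const _ filterlim_ident])
  from filterlim_compose[OF tanh_real_at_top this]
  have "((\<lambda>x. sqrt \<omega> * tanh (artanh (q / sqrt \<omega>) + sqrt \<omega> * x)) \<longlongrightarrow> sqrt \<omega> * 1) at_top"
    by (intro tendsto_intros)
  then show ?thesis by (simp add: Q_def[abs_def] add.commute)
qed

text \<open>Combined with the Riccati equation for Q this says \<phi>^2 = 2 Q', which makes the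
  integrals of the profile explicit.\<close>

lemma \<phi>_sq: "(\<phi> x)\<^sup>2 = 2 * (\<omega> - (Q x)\<^sup>2)"
proof -
  define y where "y = sqrt \<omega> * x + artanh (q / sqrt \<omega>)"
  have "cosh y \<noteq> 0" using cosh_real_pos[of y] by simp
  then have "1 - (tanh y)\<^sup>2 = ((cosh y)\<^sup>2 - (sinh y)\<^sup>2) / (cosh y)\<^sup>2"
    by (simp add: tanh_def power_divide diff_divide_distrib)
  then have e: "(1 / cosh y)\<^sup>2 = 1 - (tanh y)\<^sup>2"
    unfolding hyperbolic_pythagoras by (simp add: power_divide)
  show ?thesis unfolding \<phi>_def Q_def y_def[symmetric] power_mult_distrib e
    using \<omega>_pos by (simp add: algebra_simps)
qed

lemma \<phi>_pos: "0 < \<phi> x"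
  using \<omega>_pos by (simp add: \<phi>_def)

lemma \<phi>_deriv: "(\<phi> has_real_derivative (- Q x * \<phi> x)) (at x)"
proof -
  define y where "y = sqrt \<omega> * x + artanh (q / sqrt \<omega>)"
  have c: "cosh y \<noteq> 0" using cosh_real_pos[of y] by simp
  have "(\<phi> has_real_derivative (sqrt (2 * \<omega>) * (- (sinh y * sqrt \<omega>) / (cosh y)\<^sup>2))) (at x)"
    unfolding \<phi>_def[abs_def] y_def using c
    by (auto intro!: derivative_eq_intros simp: y_def power2_eq_square)
  moreover have "sqrt (2 * \<omega>) * (- (sinh y * sqrt \<omega>) / (cosh y)\<^sup>2) = - Q x * \<phi> x"
    unfolding \<phi>_def Q_def y_def[symmetric] by (simp add: tanh_def power2_eq_square)
  ultimately show ?thesis by simp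
qed

lemma continuous_Q: "continuous_on A Q" and continuous_\<phi>: "continuous_on A \<phi>"
  by (rule DERIV_continuous_on[OF has_field_derivative_at_within[OF Q_deriv]])
     (rule DERIV_continuous_on[OF has_field_derivative_at_within[OF \<phi>_deriv]])

lemma \<phi>_le: "0 \<le> x \<Longrightarrow> \<phi> x \<le> \<phi> 0"
proof -
  assume "0 \<le> x"
  then have "(\<phi> x)\<^sup>2 \<le> (\<phi> 0)\<^sup>2" unfolding \<phi>_sq Q_0 using Q_ge[of x] q by (auto intro: power_mono)
  then show ?thesis by (rule power2_le_imp_le) (rule less_imp_le[OF \<phi>_pos])
qed

lemma \<phi>_sq_integrable: "integrable hl (\<lambda>x. (\<phi> x)\<^sup>2)"
  and \<phi>_sq_integral: "(\<integral>x. (\<phi> x)\<^sup>2 \<partial>hl) = 2 * (sqrt \<omega> - q)"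
proof -
  have d: "((\<lambda>x. 2 * Q x) has_real_derivative (\<phi> x)\<^sup>2) (at x)" for x
    unfolding \<phi>_sq using DERIV_cmult[OF Q_deriv] .
  have c: "continuous_on UNIV (\<lambda>x. (\<phi> x)\<^sup>2)" by (intro continuous_intros continuous_\<phi>)
  have lim: "((\<lambda>x. 2 * Q x) \<longlongrightarrow> 2 * sqrt \<omega>) at_top" by (intro tendsto_intros Q_lim)
  show "integrable hl (\<lambda>x. (\<phi> x)\<^sup>2)" "(\<integral>x. (\<phi> x)\<^sup>2 \<partial>hl) = 2 * (sqrt \<omega> - q)"
    using nonneg_FTC_halfline[OF d c _ lim] by (simp_all add: Q_0)
qed

text \<open>The antiderivative is -1/(2 Q), since Q' = \<phi>^2/2. The integrand is the square of
  the function F that enters the completed square.\<close>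

lemma weight_integral:
  shows "integrable hl (\<lambda>x. (\<phi> x / (2 * Q x))\<^sup>2)"
    and "(\<integral>x. (\<phi> x / (2 * Q x))\<^sup>2 \<partial>hl) = (1 / q - 1 / sqrt \<omega>) / 2"
proof -
  have i: "integrable hl (\<lambda>x. (\<phi> x / (2 * Q x))\<^sup>2)"
  proof (rule Bochner_Integration.integrable_bound)
    show "integrable hl (\<lambda>x. (1 / (4 * q\<^sup>2)) * (\<phi> x)\<^sup>2)" by (intro integrable_mult_right \<phi>_sq_integrable)
    show "(\<lambda>x. (\<phi> x / (2 * Q x))\<^sup>2) \<in> borel_measurable hl"
      using Q_pos by (intro continuous_measurable_hl continuous_intros continuous_\<phi> continuous_Q) fastforce
    show "AE x in hl. norm ((\<phi> x / (2 * Q x))\<^sup>2) \<le> norm ((1 / (4 * q\<^sup>2)) * (\<phi> x)\<^sup>2)"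
    proof (rule AE_I2)
      fix x assume "x \<in> space hl"
      then have "q\<^sup>2 \<le> (Q x)\<^sup>2" using Q_ge[of x] q by (intro power_mono) auto
      then have "(\<phi> x)\<^sup>2 / (4 * (Q x)\<^sup>2) \<le> (\<phi> x)\<^sup>2 / (4 * q\<^sup>2)" 
        using q Q_pos[of x] \<open>x \<in> space hl\<close> by (intro divide_left_mono) auto
      then show "norm ((\<phi> x / (2 * Q x))\<^sup>2) \<le> norm ((1 / (4 * q\<^sup>2)) * (\<phi> x)\<^sup>2)"
        by (simp add: power_divide power_mult_distrib)
    qed
  qed
  then show "integrable hl (\<lambda>x. (\<phi> x / (2 * Q x))\<^sup>2)" .
  define F where "F x = complex_of_real (- 1 / (2 * Q x))" for x
  have p: "primitive F (\<lambda>x. complex_of_real ((\<phi> x / (2 * Q x))\<^sup>2))"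
    unfolding F_def[abs_def]
  proof (rule primitive_real)
    show "((\<lambda>x. - 1 / (2 * Q x)) has_real_derivative ((\<phi> x / (2 * Q x))\<^sup>2)) (at x)" if "0 \<le> x" for x
      unfolding power_divide \<phi>_sq using Q_pos[OF that]
      by (auto intro!: derivative_eq_intros Q_deriv simp: field_simps power2_eq_square)
    show "continuous_on {0..} (\<lambda>x. (\<phi> x / (2 * Q x))\<^sup>2)"
      using Q_pos by (intro continuous_intros continuous_\<phi> continuous_Q) fastforce
  qed
  have "(F \<longlongrightarrow> F 0 + (\<integral>x. complex_of_real ((\<phi> x / (2 * Q x))\<^sup>2) \<partial>hl)) at_top"
    by (rule primitive_tendsto[OF p integrable_of_real[OF i]])
  moreover have "(F \<longlongrightarrow> complex_of_real (- 1 / (2 * sqrt \<omega>))) at_top"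
    unfolding F_def using sqrt_pos
    by (intro tendsto_of_real tendsto_divide tendsto_mult tendsto_const Q_lim) simp
  ultimately have "F 0 + (\<integral>x. complex_of_real ((\<phi> x / (2 * Q x))\<^sup>2) \<partial>hl) = complex_of_real (- 1 / (2 * sqrt \<omega>))"
    by (rule tendsto_unique[rotated]) simp
  then have "complex_of_real (- 1 / (2 * q)) + complex_of_real (\<integral>x. (\<phi> x / (2 * Q x))\<^sup>2 \<partial>hl)
     = complex_of_real (- 1 / (2 * sqrt \<omega>))"
    by (simp only: F_def Q_0 integral_complex_of_real)
  then have "- 1 / (2 * q) + (\<integral>x. (\<phi> x / (2 * Q x))\<^sup>2 \<partial>hl) = - 1 / (2 * sqrt \<omega>)"
    unfolding of_real_add[symmetric] of_real_eq_iff .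
  then show "(\<integral>x. (\<phi> x / (2 * Q x))\<^sup>2 \<partial>hl) = (1 / q - 1 / sqrt \<omega>) / 2"
    by (simp add: field_simps)
qed

lemma continuous_bounded_of_real_mult:
  assumes f: "f \<in> L2_halfline" and c: "continuous_on {0..} g" and b: "\<And>x. 0 \<le> x \<Longrightarrow> \<bar>g x\<bar> \<le> C"
  shows "(\<lambda>x. complex_of_real (g x) * f x) \<in> L2_halfline"
  by (rule L2_mult_bounded[OF f continuous_measurable_hl[OF continuous_on_of_real[OF c]], where C=C])
    (simp add: b)

lemma \<phi>_L2: "(\<lambda>x. complex_of_real (\<phi> x)) \<in> L2_halfline"
  unfolding L2_iff using \<phi>_sq_integrable continuous_measurable_hl[OF continuous_on_of_real[OF continuous_\<phi>]]
  by simp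

lemma deriv_\<phi>_L2: "(\<lambda>x. complex_of_real (- Q x * \<phi> x)) \<in> L2_halfline"
  unfolding of_real_mult
  by (rule continuous_bounded_of_real_mult[OF \<phi>_L2 continuous_on_minus[OF continuous_Q], where C="sqrt \<omega>"])
    (simp add: less_imp_le[OF Q_less] abs_of_pos[OF Q_pos])

lemma cubic_\<phi>_L2: "(\<lambda>x. complex_of_real ((\<phi> x) ^ 3 - \<omega> * \<phi> x)) \<in> L2_halfline"
proof -
  have "(\<lambda>x. complex_of_real ((\<phi> x)\<^sup>2 - \<omega>) * complex_of_real (\<phi> x)) \<in> L2_halfline"
  proof (rule continuous_bounded_of_real_mult[OF \<phi>_L2])
    show "continuous_on {0..} (\<lambda>x. (\<phi> x)\<^sup>2 - \<omega>)" by (intro continuous_intros continuous_\<phi>)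
    show "\<bar>(\<phi> x)\<^sup>2 - \<omega>\<bar> \<le> \<omega>" for x
    proof -
      have "(\<phi> x)\<^sup>2 \<le> 2 * \<omega>" unfolding \<phi>_sq by simp
      then show ?thesis by (simp add: abs_le_iff)
    qed
  qed
  then show ?thesis by (simp add: algebra_simps power2_eq_square power3_eq_cube)
qed

lemma \<phi>_primitive: "primitive (\<lambda>x. complex_of_real (\<phi> x)) (\<lambda>x. complex_of_real (- Q x * \<phi> x))"
  by (rule primitive_real[OF \<phi>_deriv]) (intro continuous_intros continuous_\<phi> continuous_Q)

lemma \<phi>_H1: "(\<lambda>x. complex_of_real (\<phi> x)) \<in> H1_halfline"
  by (rule H1I[OF \<phi>_L2 deriv_\<phi>_L2 \<phi>_primitive])

lemma wderiv_\<phi>: "AE x in hl. wderiv (\<lambda>x. complex_of_real (\<phi> x)) x = complex_of_real (- Q x * \<phi> x)"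
  by (rule wderiv_AE[OF \<phi>_H1 \<phi>_primitive])

end

section \<open>Coercivity of the second variation\<close>

text \<open>
  For \<open>\<epsilon> = 0\<close>, \<open>A = \<phi>'' / \<phi>'\<close> is the logarithmic derivative of the zero mode \<open>\<phi>'\<close> and \<open>F\<close> solves
  \<open>F' + A F = \<phi>\<close>. The correction \<open>\<epsilon> / Q\<^sup>2\<close> turns nonnegativity into coercivity. The first four terms
  on the left are the derivative of \<open>A |w|\<^sup>2 + 2 t F Re w\<close>.
\<close>

lemma edge_pointwise:
  fixes q Q \<omega> \<epsilon> f t :: real and y z :: complex
  defines "A \<equiv> \<omega> / Q - 2 * Q + \<epsilon> / Q\<^sup>2"
    and "A' \<equiv> (\<omega> - Q\<^sup>2) * (- \<omega> / Q\<^sup>2 - 2 - 2 * \<epsilon> / Q ^ 3)"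
    and "F \<equiv> - f / (2 * Q)" and "F' \<equiv> f * \<omega> / (2 * Q\<^sup>2)"
  assumes q: "0 < q" "q \<le> Q" "Q < sqrt \<omega>" and \<epsilon>: "0 < \<epsilon>" "\<epsilon> \<le> q ^ 3"
    and f: "f\<^sup>2 = 2 * (\<omega> - Q\<^sup>2)"
  shows "2 * A * Re (z * cnj y) + A' * (cmod z)\<^sup>2 + 2 * t * F' * Re z + 2 * t * F * Re y
      + (\<epsilon> / (2 * sqrt \<omega>)) * (cmod z)\<^sup>2 - \<epsilon> * t\<^sup>2 * (sqrt \<omega> / (2 * q ^ 6)) * f\<^sup>2 - 2 * t * (f * Re z) - t\<^sup>2 * F\<^sup>2
    \<le> (cmod y)\<^sup>2 + (\<omega> - 3 * f\<^sup>2) * (cmod z)\<^sup>2"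
proof -
  define \<sigma> where "\<sigma> = sqrt \<omega>"
  have \<sigma>: "0 < \<sigma>" "Q < \<sigma>" "0 < Q" using q unfolding \<sigma>_def by linarith+
  have "0 \<le> (cmod (y - of_real A * z - of_real (t * F)))\<^sup>2" by simp
  also have "\<dots> = (cmod y)\<^sup>2 + A\<^sup>2 * (cmod z)\<^sup>2 + t\<^sup>2 * F\<^sup>2 - 2 * A * Re (z * cnj y) - 2 * t * F * Re y + 2 * t * A * F * Re z"
    unfolding cmod_power2 by (simp add: power2_eq_square algebra_simps)
  finally have sq: "0 \<le> \<dots>" .
  \<comment> \<open>For \<epsilon> = 0 this is the Riccati form A' + A^2 = \<omega> - 3 \<phi>^2 of
    the equation satisfied by \<phi>'; the right side is what the correction gains.\<close>
  have AA: "\<omega> - 3 * f\<^sup>2 - A' - A\<^sup>2 = 2 * \<epsilon> / Q - \<epsilon>\<^sup>2 / Q ^ 4"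
    unfolding f A_def A'_def using \<sigma> by (simp add: field_simps power2_eq_square power3_eq_cube power4_eq_xxxx)
  have FF: "A * F + F' = f - \<epsilon> * f / (2 * Q ^ 3)"
    unfolding A_def F_def F'_def using \<sigma> by (simp add: field_simps power2_eq_square power3_eq_cube)
  have Q3: "q ^ 3 \<le> Q ^ 3" using q by (intro power_mono) auto
  \<comment> \<open>From \<epsilon> \<le> q^3 \<le> Q^3 the quadratic loss is at most half of the
    linear gain 2 \<epsilon>/Q, and Q < \<sigma> makes the remainder uniform in x.\<close>
  have g1: "\<epsilon> / \<sigma> \<le> 2 * \<epsilon> / Q - \<epsilon>\<^sup>2 / Q ^ 4"
  proof -
    have "\<epsilon>\<^sup>2 / Q ^ 4 \<le> \<epsilon> * Q ^ 3 / Q ^ 4"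
      unfolding power2_eq_square using \<epsilon> Q3 \<sigma> by (intro divide_right_mono mult_left_mono) auto
    also have "\<dots> = \<epsilon> / Q" using \<sigma> by (simp add: power3_eq_cube power4_eq_xxxx)
    moreover have "2 * \<epsilon> / Q = \<epsilon> / Q + \<epsilon> / Q" by (simp add: add_divide_distrib[symmetric])
    ultimately have "\<epsilon> / Q \<le> 2 * \<epsilon> / Q - \<epsilon>\<^sup>2 / Q ^ 4" by linarith
    moreover have "\<epsilon> / \<sigma> \<le> \<epsilon> / Q" using \<epsilon> \<sigma> by (intro divide_left_mono) auto
    ultimately show ?thesis by linarith
  qed
  \<comment> \<open>The correction also disturbs F' + A F = f. Young's inequality with weight
    \<sigma> pays for the defect with half of the gain \<epsilon>/\<sigma>, which leaves the
    \<epsilon>/(2 \<sigma>) of the statement, and with a multiple of t^2 f^2.\<close>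
  have g2: "- ((cmod z)\<^sup>2 / (2 * \<sigma>) + t\<^sup>2 * f\<^sup>2 * \<sigma> / (2 * q ^ 6)) \<le> t * f * Re z / Q ^ 3"
  proof -
    define p where "p = \<bar>t\<bar> * \<bar>f\<bar> / q ^ 3"
    have "\<bar>t * f * Re z / Q ^ 3\<bar> = \<bar>t\<bar> * \<bar>f\<bar> * \<bar>Re z\<bar> / Q ^ 3" using \<sigma> by (simp add: abs_mult)
    also have "\<dots> \<le> \<bar>t\<bar> * \<bar>f\<bar> * cmod z / q ^ 3"
      using q Q3 by (intro frac_le mult_left_mono abs_Re_le_cmod) auto
    also have "\<dots> = p * cmod z" by (simp add: p_def)
    also have "\<dots> \<le> (cmod z)\<^sup>2 / (2 * \<sigma>) + p\<^sup>2 * \<sigma> / 2"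
    proof -
      have "0 \<le> (cmod z - \<sigma> * p)\<^sup>2 / (2 * \<sigma>)" using \<sigma> by simp
      then show ?thesis using \<sigma> by (simp add: power2_diff field_simps power2_eq_square)
    qed
    also have "p\<^sup>2 * \<sigma> / 2 = t\<^sup>2 * f\<^sup>2 * \<sigma> / (2 * q ^ 6)"
      by (simp add: p_def power_divide power_mult_distrib flip: power_mult)
    finally show ?thesis by (metis abs_le_D2 minus_le_iff)
  qed
  have "(\<epsilon> / \<sigma>) * (cmod z)\<^sup>2 \<le> (\<omega> - 3 * f\<^sup>2 - A' - A\<^sup>2) * (cmod z)\<^sup>2"
    unfolding AA using g1 by (intro mult_right_mono) auto
  moreover have "\<epsilon> * (- ((cmod z)\<^sup>2 / (2 * \<sigma>) + t\<^sup>2 * f\<^sup>2 * \<sigma> / (2 * q ^ 6))) \<le> \<epsilon> * (t * f * Re z / Q ^ 3)"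
    using g2 \<epsilon> by (intro mult_left_mono) auto
  moreover have "2 * t * (A * F + F') * Re z = 2 * t * (f * Re z) - \<epsilon> * (t * f * Re z / Q ^ 3)"
    unfolding FF by (simp add: field_simps)
  ultimately show ?thesis using sq unfolding \<sigma>_def[symmetric] by (simp add: algebra_simps)
qed

context soliton_profile begin

lemma potential_integrable:
  assumes w: "w \<in> L2_halfline"
  shows "integrable hl (\<lambda>x. (\<omega> - 3 * (\<phi> x)\<^sup>2) * (cmod (w x))\<^sup>2)"
proof (rule integrable_bounded_mult[OF _ _ L2_integrable_sq[OF w]])
  show "(\<lambda>x. \<omega> - 3 * (\<phi> x)\<^sup>2) \<in> borel_measurable hl"
    by (intro continuous_measurable_hl continuous_intros continuous_\<phi>)
  show "\<bar>\<omega> - 3 * (\<phi> x)\<^sup>2\<bar> \<le> \<omega> + 3 * (\<phi> 0)\<^sup>2" if "0 \<le> x" for x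
    using power_mono[OF \<phi>_le[OF that] less_imp_le[OF \<phi>_pos], of 2] \<omega>_pos zero_le_power2[of "\<phi> x"]
      zero_le_power2[of "\<phi> 0"] unfolding abs_le_iff by linarith
qed

lemma \<phi>_Re_integrable:
  assumes w: "w \<in> L2_halfline"
  shows "integrable hl (\<lambda>x. \<phi> x * Re (w x))"
  using integrable_Re[OF L2_integrable_mult[OF \<phi>_L2 w]] by simp

text \<open>The pointwise inequality is integrated. The total derivative contributes only its value
  at the vertex, where Q = q; the two terms in t^2 come from the explicit integrals of F^2 and
  \<phi>^2.\<close>

lemma edge_form_lower:
  assumes w: "w \<in> H1_halfline" and w0: "w 0 = of_real w0" and \<epsilon>: "0 < \<epsilon>" "\<epsilon> \<le> q ^ 3"
  shows "(\<epsilon> / (2 * sqrt \<omega>)) * (L2norm w)\<^sup>2 - 2 * t * (\<integral>x. \<phi> x * Re (w x) \<partial>hl)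
      - (\<omega> / q - 2 * q + \<epsilon> / q\<^sup>2) * w0\<^sup>2 + t * \<phi> 0 * w0 / q - t\<^sup>2 * ((1 / q - 1 / sqrt \<omega>) / 2)
      - \<epsilon> * t\<^sup>2 * (sqrt \<omega> / (2 * q ^ 6)) * (2 * (sqrt \<omega> - q))
    \<le> (L2norm (wderiv w))\<^sup>2 + (\<integral>x. (\<omega> - 3 * (\<phi> x)\<^sup>2) * (cmod (w x))\<^sup>2 \<partial>hl)"
proof -
  define y where "y = wderiv w"
  define A where "A x = \<omega> / Q x - 2 * Q x + \<epsilon> / (Q x)\<^sup>2" for x
  define A' where "A' x = (\<omega> - (Q x)\<^sup>2) * (- \<omega> / (Q x)\<^sup>2 - 2 - 2 * \<epsilon> / (Q x) ^ 3)" for x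
  define F where "F x = - \<phi> x / (2 * Q x)" for x
  define F' where "F' x = \<phi> x * \<omega> / (2 * (Q x)\<^sup>2)" for x
  have wL: "w \<in> L2_halfline" and yL: "y \<in> L2_halfline" and pw: "primitive w y"
    using H1_wderiv[OF w] by (simp_all add: y_def)
  have Qn: "Q x \<noteq> 0" if "x \<in> {0..}" for x using Q_pos[of x] that by auto
  have cA: "continuous_on {0..} A" and cA': "continuous_on {0..} A'" and cF: "continuous_on {0..} F"
    and cF': "continuous_on {0..} F'"
    unfolding A_def A'_def F_def F'_def using Qn
    by (auto intro!: continuous_intros continuous_Q continuous_\<phi>)
  have dA: "(A has_real_derivative A' x) (at x)" and dF: "(F has_real_derivative F' x) (at x)" if "0 \<le> x" for x
  proof -
    have n: "Q x \<noteq> 0" using Q_pos[OF that] by simp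
    show "(A has_real_derivative A' x) (at x)"
      unfolding A_def[abs_def] A'_def
      by (rule derivative_eq_intros Q_deriv refl n | simp add: n)+
         (use n in \<open>simp add: field_simps power2_eq_square power3_eq_cube power4_eq_xxxx\<close>)
    show "(F has_real_derivative F' x) (at x)"
      unfolding F_def[abs_def] F'_def
      by (rule derivative_eq_intros Q_deriv \<phi>_deriv refl n | simp add: n)+
         (use n in \<open>simp add: field_simps power2_eq_square power3_eq_cube\<close>)
  qed
  have inv: "1 / Q x \<le> 1 / q" "0 < 1 / Q x" if "0 \<le> x" for x
    using Q_ge[OF that] Q_pos[OF that] q by (auto intro: divide_left_mono)
  have pw_inv: "1 / (Q x) ^ n \<le> 1 / q ^ n" "0 \<le> 1 / (Q x) ^ n" if "0 \<le> x" for x n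
    using power_mono[of "1 / Q x" "1 / q" n] inv[OF that] by (auto simp: power_one_over)
  have Qs: "0 \<le> \<omega> - (Q x)\<^sup>2" "\<omega> - (Q x)\<^sup>2 \<le> \<omega>" if "0 \<le> x" for x
    using \<phi>_sq[of x] zero_le_power2[of "\<phi> x"] by auto
  have bA: "\<bar>A x\<bar> \<le> \<omega> / q + 2 * sqrt \<omega> + \<epsilon> / q\<^sup>2" if x: "0 \<le> x" for x
  proof -
    have "\<omega> * (1 / Q x) \<le> \<omega> * (1 / q)" "\<epsilon> * (1 / (Q x)\<^sup>2) \<le> \<epsilon> * (1 / q\<^sup>2)"
      by (rule mult_left_mono[OF inv(1)[OF x]], use \<omega>_pos in simp)
         (rule mult_left_mono[OF pw_inv(1)[OF x]], use \<epsilon> in simp)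
    moreover have "0 \<le> \<omega> / Q x" "0 \<le> \<epsilon> / (Q x)\<^sup>2" using Q_pos[OF x] \<omega>_pos \<epsilon> by auto
    ultimately show ?thesis using Q_less[of x] Q_pos[OF x] unfolding A_def abs_le_iff by auto
  qed
  have bA': "\<bar>A' x\<bar> \<le> \<omega> * (\<omega> / q\<^sup>2 + 2 + 2 * \<epsilon> / q ^ 3)" if x: "0 \<le> x" for x
  proof -
    have "\<omega> * (1 / (Q x)\<^sup>2) \<le> \<omega> * (1 / q\<^sup>2)" "2 * \<epsilon> * (1 / (Q x) ^ 3) \<le> 2 * \<epsilon> * (1 / q ^ 3)"
      by (rule mult_left_mono[OF pw_inv(1)[OF x]], use \<omega>_pos in simp)
         (rule mult_left_mono[OF pw_inv(1)[OF x]], use \<epsilon> in simp)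
    moreover have "0 \<le> \<omega> / (Q x)\<^sup>2" "0 \<le> 2 * \<epsilon> / (Q x) ^ 3" using Q_pos[OF x] \<omega>_pos \<epsilon> by auto
    ultimately have "\<bar>- \<omega> / (Q x)\<^sup>2 - 2 - 2 * \<epsilon> / (Q x) ^ 3\<bar> \<le> \<omega> / q\<^sup>2 + 2 + 2 * \<epsilon> / q ^ 3"
      unfolding abs_le_iff by auto
    then show ?thesis unfolding A'_def abs_mult using Qs[OF x] \<omega>_pos by (intro mult_mono) auto
  qed
  have FL: "(\<lambda>x. complex_of_real (F x)) \<in> L2_halfline"
  proof -
    have "(\<lambda>x. complex_of_real (- 1 / (2 * Q x)) * complex_of_real (\<phi> x)) \<in> L2_halfline"
    proof (rule continuous_bounded_of_real_mult[OF \<phi>_L2])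
      show "continuous_on {0..} (\<lambda>x. - 1 / (2 * Q x))" using Qn by (auto intro!: continuous_intros continuous_Q)
      show "\<bar>- 1 / (2 * Q x)\<bar> \<le> 1 / q" if "0 \<le> x" for x
      proof -
        have e: "\<bar>- 1 / (2 * Q x)\<bar> = (1 / Q x) / 2" by (simp add: abs_mult abs_of_pos[OF Q_pos[OF that]])
        have half: "s / 2 \<le> B" if "s \<le> B" "0 < s" for s B :: real using that by simp
        show ?thesis unfolding e by (rule half[OF inv[OF that]])
      qed
    qed
    then show ?thesis by (simp add: F_def)
  qed
  have F'L: "(\<lambda>x. complex_of_real (F' x)) \<in> L2_halfline"
  proof -
    have "(\<lambda>x. complex_of_real (\<omega> / (2 * (Q x)\<^sup>2)) * complex_of_real (\<phi> x)) \<in> L2_halfline"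
    proof (rule continuous_bounded_of_real_mult[OF \<phi>_L2])
      show "continuous_on {0..} (\<lambda>x. \<omega> / (2 * (Q x)\<^sup>2))" using Qn by (auto intro!: continuous_intros continuous_Q)
      show "\<bar>\<omega> / (2 * (Q x)\<^sup>2)\<bar> \<le> \<omega> / 2 * (1 / q\<^sup>2)" if "0 \<le> x" for x
        using mult_left_mono[OF pw_inv(1)[OF that, of 2], of "\<omega> / 2"] \<omega>_pos by simp
    qed
    then show ?thesis by (simp add: F'_def mult.commute)
  qed
  \<comment> \<open>The function A |w|^2 + 2 t F Re w, written with conjugates so that the product
    rule for complex primitives applies; \<open>D\<close> is its derivative.\<close>
  define P where "P x = (complex_of_real (A x) * w x) * cnj (w x) + of_real t * (complex_of_real (F x) * (w x + cnj (w x)))" for x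
  define D where "D x = ((complex_of_real (A x) * w x) * cnj (y x) + (complex_of_real (A x) * y x + complex_of_real (A' x) * w x) * cnj (w x))
      + of_real t * (complex_of_real (F x) * (y x + cnj (y x)) + complex_of_real (F' x) * (w x + cnj (w x)))" for x
  have pP: "primitive P D"
    unfolding P_def D_def
    by (intro primitive_add primitive_scale primitive_mult primitive_cnj primitive_real dA dF cA' cF' pw)
  have L: "(\<lambda>x. complex_of_real (A x) * w x) \<in> L2_halfline" "(\<lambda>x. complex_of_real (A x) * y x) \<in> L2_halfline"
    "(\<lambda>x. complex_of_real (A' x) * w x) \<in> L2_halfline"
    by (rule continuous_bounded_of_real_mult[OF wL cA bA] continuous_bounded_of_real_mult[OF yL cA bA]
        continuous_bounded_of_real_mult[OF wL cA' bA']; assumption)+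
  have iP: "integrable hl P"
    unfolding P_def
    by (intro Bochner_Integration.integrable_add integrable_mult_right L2_integrable_mult L2_add L2_cnj L wL FL)
  have iD: "integrable hl D"
    unfolding D_def
    by (intro Bochner_Integration.integrable_add integrable_mult_right L2_integrable_mult L2_add L2_cnj L wL yL FL F'L)
  have "integral\<^sup>L hl D = - P 0" by (rule primitive_integral[OF pP iP iD])
  then have "(\<integral>x. Re (D x) \<partial>hl) = Re (- P 0)" using integral_Re[OF iD] by simp
  also have "\<dots> = - A 0 * w0\<^sup>2 - 2 * t * F 0 * w0"
    by (simp add: P_def w0 power2_eq_square)
  finally have ID: "(\<integral>x. Re (D x) \<partial>hl) = - A 0 * w0\<^sup>2 - 2 * t * F 0 * w0" .
  have iRD: "integrable hl (\<lambda>x. Re (D x))" by (rule integrable_Re[OF iD])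
  have iF: "integrable hl (\<lambda>x. (F x)\<^sup>2)" "(\<integral>x. (F x)\<^sup>2 \<partial>hl) = (1 / q - 1 / sqrt \<omega>) / 2"
    using weight_integral by (simp_all add: F_def)
  note I = iRD L2_integrable_sq[OF wL] \<phi>_sq_integrable \<phi>_Re_integrable[OF wL] iF(1)
  define B where "B x = Re (D x) + (\<epsilon> / (2 * sqrt \<omega>)) * (cmod (w x))\<^sup>2 - \<epsilon> * t\<^sup>2 * (sqrt \<omega> / (2 * q ^ 6)) * (\<phi> x)\<^sup>2
      - 2 * t * (\<phi> x * Re (w x)) - t\<^sup>2 * (F x)\<^sup>2" for x
  have iB: "integrable hl B" unfolding B_def
    by (intro Bochner_Integration.integrable_add Bochner_Integration.integrable_diff integrable_mult_right I)
  have "(\<integral>x. B x \<partial>hl) = - A 0 * w0\<^sup>2 - 2 * t * F 0 * w0 + (\<epsilon> / (2 * sqrt \<omega>)) * (L2norm w)\<^sup>2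
     - \<epsilon> * t\<^sup>2 * (sqrt \<omega> / (2 * q ^ 6)) * (2 * (sqrt \<omega> - q))
     - 2 * t * (\<integral>x. \<phi> x * Re (w x) \<partial>hl) - t\<^sup>2 * ((1 / q - 1 / sqrt \<omega>) / 2)"
    unfolding B_def L2norm_sq ID[symmetric] iF(2)[symmetric] \<phi>_sq_integral[symmetric]
    using I by (simp only: Bochner_Integration.integral_add Bochner_Integration.integral_diff
        Bochner_Integration.integrable_add Bochner_Integration.integrable_diff integrable_mult_right integral_mult_right_zero)
  moreover have "(\<integral>x. B x \<partial>hl) \<le> (\<integral>x. (cmod (y x))\<^sup>2 + (\<omega> - 3 * (\<phi> x)\<^sup>2) * (cmod (w x))\<^sup>2 \<partial>hl)"
  proof (rule integral_mono[OF iB])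
    show "integrable hl (\<lambda>x. (cmod (y x))\<^sup>2 + (\<omega> - 3 * (\<phi> x)\<^sup>2) * (cmod (w x))\<^sup>2)"
      by (intro Bochner_Integration.integrable_add L2_integrable_sq potential_integrable wL yL)
    fix x assume "x \<in> space hl"
    then have x: "0 \<le> x" by simp
    have "Re (D x) = 2 * A x * Re (w x * cnj (y x)) + A' x * (cmod (w x))\<^sup>2 + 2 * t * F' x * Re (w x) + 2 * t * F x * Re (y x)"
      unfolding D_def cmod_power2 by (simp add: power2_eq_square algebra_simps)
    then show "B x \<le> (cmod (y x))\<^sup>2 + (\<omega> - 3 * (\<phi> x)\<^sup>2) * (cmod (w x))\<^sup>2"
      unfolding B_def A_def A'_def F_def F'_def
      using edge_pointwise[OF q Q_ge[OF x] Q_less \<epsilon> \<phi>_sq, of "w x" "y x" t] by simp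
  qed
  moreover have "(\<integral>x. (cmod (y x))\<^sup>2 + (\<omega> - 3 * (\<phi> x)\<^sup>2) * (cmod (w x))\<^sup>2 \<partial>hl)
     = (L2norm (wderiv w))\<^sup>2 + (\<integral>x. (\<omega> - 3 * (\<phi> x)\<^sup>2) * (cmod (w x))\<^sup>2 \<partial>hl)"
    unfolding L2norm_sq y_def[symmetric]
    by (intro Bochner_Integration.integral_add L2_integrable_sq potential_integrable wL yL)
  moreover have "- A 0 * w0\<^sup>2 - 2 * t * F 0 * w0 = - (\<omega> / q - 2 * q + \<epsilon> / q\<^sup>2) * w0\<^sup>2 + t * \<phi> 0 * w0 / q"
    using q by (simp add: A_def F_def Q_0 field_simps)
  ultimately show ?thesis by linarith
qed

text \<open>|w(0)|^2 is minus the integral of the derivative of |w|^2. Young's inequality is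
  weighted so that the derivative of w enters with the factor 1/2; as \<gamma> = N q, the vertex
  term then costs half of the kinetic energy of each edge.\<close>

lemma trace_le:
  assumes w: "w \<in> H1_halfline"
  shows "q * (cmod (w 0))\<^sup>2 \<le> (L2norm (wderiv w))\<^sup>2 / 2 + 2 * q\<^sup>2 * (L2norm w)\<^sup>2"
proof -
  define y where "y = wderiv w"
  have wL: "w \<in> L2_halfline" and yL: "y \<in> L2_halfline" and pw: "primitive w y"
    using H1_wderiv[OF w] by (simp_all add: y_def)
  have I: "integrable hl (\<lambda>x. w x * cnj (w x))" "integrable hl (\<lambda>x. w x * cnj (y x) + y x * cnj (w x))"
    by (intro Bochner_Integration.integrable_add L2_integrable_mult_cnj wL yL)+
  have "(\<integral>x. w x * cnj (y x) + y x * cnj (w x) \<partial>hl) = - (w 0 * cnj (w 0))"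
    by (rule primitive_integral[OF primitive_mult[OF pw primitive_cnj[OF pw]] I])
  then have "cmod (w 0 * cnj (w 0)) = cmod (\<integral>x. w x * cnj (y x) + y x * cnj (w x) \<partial>hl)"
    by (metis norm_minus_cancel)
  then have "q * (cmod (w 0))\<^sup>2 = q * cmod (\<integral>x. w x * cnj (y x) + y x * cnj (w x) \<partial>hl)"
    by (simp add: norm_mult power2_eq_square)
  also have "\<dots> \<le> q * (\<integral>x. cmod (w x * cnj (y x) + y x * cnj (w x)) \<partial>hl)"
    using q by (intro mult_left_mono integral_norm_bound) auto
  also have "\<dots> = (\<integral>x. q * cmod (w x * cnj (y x) + y x * cnj (w x)) \<partial>hl)" by simp
  also have "\<dots> \<le> (\<integral>x. (1 / 2) * (cmod (y x))\<^sup>2 + (2 * q\<^sup>2) * (cmod (w x))\<^sup>2 \<partial>hl)"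
  proof (rule integral_mono)
    show "integrable hl (\<lambda>x. q * cmod (w x * cnj (y x) + y x * cnj (w x)))"
      by (intro integrable_mult_right integrable_norm I)
    show "integrable hl (\<lambda>x. (1 / 2) * (cmod (y x))\<^sup>2 + (2 * q\<^sup>2) * (cmod (w x))\<^sup>2)"
      by (intro Bochner_Integration.integrable_add integrable_mult_right L2_integrable_sq wL yL)
    fix x
    have "cmod (w x * cnj (y x) + y x * cnj (w x)) \<le> 2 * (cmod (w x) * cmod (y x))"
      by (rule order_trans[OF norm_triangle_ineq]) (simp add: norm_mult)
    then have "q * cmod (w x * cnj (y x) + y x * cnj (w x)) \<le> q * (2 * (cmod (w x) * cmod (y x)))"
      using q by (intro mult_left_mono) auto
    also have "\<dots> \<le> (1 / 2) * (cmod (y x))\<^sup>2 + (2 * q\<^sup>2) * (cmod (w x))\<^sup>2"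
      using zero_le_power2[of "cmod (y x) - 2 * q * cmod (w x)"]
      by (simp add: power2_diff power_mult_distrib algebra_simps)
    finally show "q * cmod (w x * cnj (y x) + y x * cnj (w x)) \<le> (1 / 2) * (cmod (y x))\<^sup>2 + (2 * q\<^sup>2) * (cmod (w x))\<^sup>2" .
  qed
  also have "\<dots> = (1 / 2) * (L2norm y)\<^sup>2 + (2 * q\<^sup>2) * (L2norm w)\<^sup>2"
    using L2_integrable_sq[OF wL] L2_integrable_sq[OF yL] by (simp add: L2norm_sq)
  finally show ?thesis by (simp add: y_def)
qed

end

lemma Re_minus_Delta_self:
  "Re (minus_Delta N \<gamma> u u) = (\<Sum>e=1..N. (L2norm (wderiv (u e)))\<^sup>2) - \<gamma> * (cmod (u 1 0))\<^sup>2"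
proof -
  have "(\<integral>x. wderiv (u e) x * cnj (wderiv (u e) x) \<partial>hl) = of_real ((L2norm (wderiv (u e)))\<^sup>2)" for e
    unfolding complex_norm_square[symmetric] L2norm_sq by (rule integral_complex_of_real)
  then have "minus_Delta N \<gamma> u u = of_real ((\<Sum>e=1..N. (L2norm (wderiv (u e)))\<^sup>2) - \<gamma> * (cmod (u 1 0))\<^sup>2)"
    by (simp add: minus_Delta_hl mult.assoc flip: complex_norm_square)
  then show ?thesis by simp
qed

definition scalar_energy :: "nat \<Rightarrow> real \<Rightarrow> graph_fun \<Rightarrow> real" where
  "scalar_energy N \<gamma> u = Re (minus_Delta N \<gamma> u u) - (\<Sum>e=1..N. \<integral>x. (cmod (u e x)) ^ 4 \<partial>hl) / 2"

lemma H1_integrable_pow4: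
  assumes f: "f \<in> H1_halfline" shows "integrable hl (\<lambda>x. (cmod (f x)) ^ 4)"
  using integrable_quartic_density[OF f f, of 1 0 0]
  by (simp add: quartic_density_def power2_eq_square power4_eq_xxxx mult.assoc)

text \<open>The condition \<gamma> = N q shares the point interaction equally among the edges, so
  that each edge carries the term q |w(0)|^2.\<close>

locale star_soliton = soliton_profile q \<omega> for q \<omega> :: real +
  fixes N :: nat and \<gamma> :: real
  assumes N: "1 \<le> N" and \<gamma>: "\<gamma> = real N * q"
begin

definition \<Phi> :: graph_fun where
  "\<Phi> = (\<lambda>e x. complex_of_real (\<phi> x))"

text \<open>On real perturbations this is the second variation of the action. On the imaginary part
  the true potential \<omega> - \<phi>^2 is replaced by the smaller \<omega> - 3 \<phi>^2, so that
  in general it is a lower bound.\<close>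

definition second_variation :: "graph_fun \<Rightarrow> real" where
  "second_variation w = (\<Sum>e=1..N. (L2norm (wderiv (w e)))\<^sup>2 + (\<integral>x. (\<omega> - 3 * (\<phi> x)\<^sup>2) * (cmod (w e x))\<^sup>2 \<partial>hl))
     - \<gamma> * (cmod (w 1 0))\<^sup>2"

definition overlap :: "graph_fun \<Rightarrow> real" where
  "overlap w = (\<Sum>e=1..N. \<integral>x. \<phi> x * Re (w e x) \<partial>hl)"

lemma \<Phi>_H1: "\<Phi> \<in> H1_graph N"
  by (rule H1_graphI) (simp_all add: \<Phi>_def \<phi>_H1)

text \<open>All edges have the same vertex value w0, so one multiplier t serves them all. After
  summation the vertex contributes N (K - q w0^2), a nonnegative quantity that absorbs the pairing
  with the soliton by Young's inequality.\<close>

lemma second_variation_lower_L2: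
  obtains \<delta> where "0 < \<delta>" "\<And>w w0. w \<in> H1_graph N \<Longrightarrow> w 1 0 = of_real w0 \<Longrightarrow>
    \<delta> * (\<Sum>e=1..N. (L2norm (w e))\<^sup>2) \<le> second_variation w + 4 * sqrt \<omega> * (overlap w)\<^sup>2"
proof -
  define \<sigma> where "\<sigma> = sqrt \<omega>"
  have \<sigma>: "0 < \<sigma>" "q < \<sigma>" "\<sigma>\<^sup>2 = \<omega>" using sqrt_pos q_less \<omega>_pos by (simp_all add: \<sigma>_def)
  define h where "h = \<phi> 0"
  have h: "0 < h" "h\<^sup>2 = 2 * (\<omega> - q\<^sup>2)" using \<phi>_pos[of 0] \<phi>_sq[of 0] by (simp_all add: h_def Q_0)
  define S where "S = 1 / q\<^sup>2 + h\<^sup>2 * ((\<sigma> / (2 * q ^ 6)) * (2 * (\<sigma> - q)))"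
  have S: "0 < S" unfolding S_def using q \<sigma> h(1) by (intro add_pos_nonneg) auto
  \<comment> \<open>\<open>S\<close> collects what the \<epsilon>-correction costs at the vertex.
    The second bound makes this cost at most half of the h^2/(2 \<sigma>) available there.\<close>
  define \<epsilon> where "\<epsilon> = min (q ^ 3) (h\<^sup>2 / (4 * \<sigma>) / S)"
  have "0 < h\<^sup>2 / (4 * \<sigma>) / S" using \<sigma>(1) h(1) S by (intro divide_pos_pos zero_less_power) auto
  then have \<epsilon>: "0 < \<epsilon>" "\<epsilon> \<le> q ^ 3" using q unfolding \<epsilon>_def by auto
  have "\<epsilon> \<le> h\<^sup>2 / (4 * \<sigma>) / S" unfolding \<epsilon>_def by (rule min.cobounded2)
  then have \<epsilon>S: "\<epsilon> * S \<le> h\<^sup>2 / (4 * \<sigma>)" by (simp only: pos_le_divide_eq[OF S])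
  show thesis
  proof (rule that)
    show "0 < \<epsilon> / (2 * \<sigma>)" using \<epsilon> \<sigma> by simp
    fix w w0 assume w: "w \<in> H1_graph N" and w0: "w 1 0 = of_real w0"
    \<comment> \<open>With this multiplier, the terms -\<omega>/q + q + h^2/(2 q) of the vertex
      coefficient cancel, because h^2 = 2 (\<omega> - q^2).\<close>
    define t where "t = h * w0"
    define K where "K = - (\<omega> / q - 2 * q + \<epsilon> / q\<^sup>2) * w0\<^sup>2 + t * h * w0 / q - t\<^sup>2 * ((1 / q - 1 / \<sigma>) / 2)
      - \<epsilon> * t\<^sup>2 * (\<sigma> / (2 * q ^ 6)) * (2 * (\<sigma> - q))"
    define B where "B = (h\<^sup>2 / (4 * \<sigma>)) * w0\<^sup>2"
    have Kq: "K - q * w0\<^sup>2 = (h\<^sup>2 / (2 * \<sigma>) - \<epsilon> * S) * w0\<^sup>2"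
    proof -
      have "K - q * w0\<^sup>2 = (- \<omega> / q + q + h\<^sup>2 / (2 * q) + h\<^sup>2 / (2 * \<sigma>) - \<epsilon> * S) * w0\<^sup>2"
        unfolding K_def t_def S_def by (simp add: power_mult_distrib power2_eq_square field_simps)
      also have "- \<omega> / q + q + h\<^sup>2 / (2 * q) = 0"
        unfolding h(2) using q by (simp add: field_simps power2_eq_square)
      finally show ?thesis by simp
    qed
    have "(h\<^sup>2 / (4 * \<sigma>)) * w0\<^sup>2 \<le> (h\<^sup>2 / (2 * \<sigma>) - \<epsilon> * S) * w0\<^sup>2"
    proof (rule mult_right_mono)
      have "h\<^sup>2 / (2 * \<sigma>) = h\<^sup>2 / (4 * \<sigma>) + h\<^sup>2 / (4 * \<sigma>)" by simp
      then show "h\<^sup>2 / (4 * \<sigma>) \<le> h\<^sup>2 / (2 * \<sigma>) - \<epsilon> * S" using \<epsilon>S by linarith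
    qed simp
    then have K1: "B \<le> K - q * w0\<^sup>2" by (simp only: Kq B_def)
    \<comment> \<open>The contribution of a single edge already suffices, so the estimate needs no
      constant depending on N.\<close>
    have "0 \<le> B" using \<sigma> by (simp add: B_def)
    then have "0 \<le> K - q * w0\<^sup>2" using K1 by (rule order_trans)
    then have "1 * (K - q * w0\<^sup>2) \<le> real N * (K - q * w0\<^sup>2)" using N by (intro mult_right_mono) auto
    with K1 have K2: "B \<le> real N * (K - q * w0\<^sup>2)" unfolding mult_1 by (rule order_trans)
    have "(\<Sum>e=1..N. (\<epsilon> / (2 * \<sigma>)) * (L2norm (w e))\<^sup>2 - 2 * t * (\<integral>x. \<phi> x * Re (w e x) \<partial>hl) + K)
       \<le> (\<Sum>e=1..N. (L2norm (wderiv (w e)))\<^sup>2 + (\<integral>x. (\<omega> - 3 * (\<phi> x)\<^sup>2) * (cmod (w e x))\<^sup>2 \<partial>hl))"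
    proof (rule sum_mono)
      fix e assume e: "e \<in> {1..N}"
      have "w e 0 = of_real w0" using H1_graphD(2)[OF w e] w0 by simp
      from edge_form_lower[OF H1_graphD(1)[OF w e] this \<epsilon>, of t]
      show "(\<epsilon> / (2 * \<sigma>)) * (L2norm (w e))\<^sup>2 - 2 * t * (\<integral>x. \<phi> x * Re (w e x) \<partial>hl) + K
        \<le> (L2norm (wderiv (w e)))\<^sup>2 + (\<integral>x. (\<omega> - 3 * (\<phi> x)\<^sup>2) * (cmod (w e x))\<^sup>2 \<partial>hl)"
        unfolding K_def h_def[symmetric] \<sigma>_def[symmetric] by linarith
    qed
    moreover have "(\<Sum>e=1..N. (\<epsilon> / (2 * \<sigma>)) * (L2norm (w e))\<^sup>2 - 2 * t * (\<integral>x. \<phi> x * Re (w e x) \<partial>hl) + K)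
      = (\<epsilon> / (2 * \<sigma>)) * (\<Sum>e=1..N. (L2norm (w e))\<^sup>2) - 2 * t * overlap w + real N * K"
      unfolding overlap_def by (simp only: sum.distrib sum_subtractf sum_distrib_left sum_constant card_atLeastAtMost) simp
    moreover have "\<gamma> * (cmod (w 1 0))\<^sup>2 = real N * (q * w0\<^sup>2)" unfolding w0 \<gamma> by simp
    ultimately have 1: "(\<epsilon> / (2 * \<sigma>)) * (\<Sum>e=1..N. (L2norm (w e))\<^sup>2) - 2 * t * overlap w + real N * (K - q * w0\<^sup>2)
       \<le> second_variation w"
      unfolding second_variation_def right_diff_distrib by linarith
    \<comment> \<open>Young's inequality, with the constant 4 \<sigma> fixed by B having coefficient
      h^2/(4 \<sigma>).\<close>
    have 2: "2 * t * overlap w \<le> B + 4 * \<sigma> * (overlap w)\<^sup>2"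
    proof -
      have "0 \<le> (h * w0 - 4 * \<sigma> * overlap w)\<^sup>2 / (4 * \<sigma>)" using \<sigma> by simp
      also have "\<dots> = B + 4 * \<sigma> * (overlap w)\<^sup>2 - 2 * t * overlap w"
        unfolding t_def B_def using \<sigma>(1) by (simp add: power2_diff power_mult_distrib field_simps power2_eq_square)
      finally show ?thesis by linarith
    qed
    show "\<epsilon> / (2 * \<sigma>) * (\<Sum>e=1..N. (L2norm (w e))\<^sup>2) \<le> second_variation w + 4 * sqrt \<omega> * (overlap w)\<^sup>2"
      unfolding \<sigma>_def[symmetric] using 1 2 K2 by linarith
  qed
qed

text \<open>A Garding-type bound: \<phi>^2 \<le> 2 \<omega> bounds the potential below by -5
  \<omega>, and \<open>trace_le\<close> spends half of the kinetic energy on the vertex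
  term.\<close>

lemma second_variation_lower_deriv:
  assumes w: "w \<in> H1_graph N"
  shows "(\<Sum>e=1..N. (L2norm (wderiv (w e)))\<^sup>2) / 2 - (5 * \<omega> + 2 * q\<^sup>2) * (\<Sum>e=1..N. (L2norm (w e))\<^sup>2) \<le> second_variation w"
proof -
  have "(\<Sum>e=1..N. (L2norm (wderiv (w e)))\<^sup>2 / 2 - (5 * \<omega> + 2 * q\<^sup>2) * (L2norm (w e))\<^sup>2)
     \<le> (\<Sum>e=1..N. (L2norm (wderiv (w e)))\<^sup>2 + (\<integral>x. (\<omega> - 3 * (\<phi> x)\<^sup>2) * (cmod (w e x))\<^sup>2 \<partial>hl) - q * (cmod (w 1 0))\<^sup>2)"
  proof (rule sum_mono)
    fix e assume e: "e \<in> {1..N}"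
    note H = H1_graphD(1)[OF w e]
    have "(\<integral>x. (- 5 * \<omega>) * (cmod (w e x))\<^sup>2 \<partial>hl) \<le> (\<integral>x. (\<omega> - 3 * (\<phi> x)\<^sup>2) * (cmod (w e x))\<^sup>2 \<partial>hl)"
    proof (intro integral_mono integrable_mult_right H1_integrable_sq potential_integrable H1_L2 H)
      fix x
      have "(\<phi> x)\<^sup>2 \<le> 2 * \<omega>" unfolding \<phi>_sq by simp
      then show "(- 5 * \<omega>) * (cmod (w e x))\<^sup>2 \<le> (\<omega> - 3 * (\<phi> x)\<^sup>2) * (cmod (w e x))\<^sup>2"
        by (intro mult_right_mono) auto
    qed
    then have "- 5 * \<omega> * (L2norm (w e))\<^sup>2 \<le> (\<integral>x. (\<omega> - 3 * (\<phi> x)\<^sup>2) * (cmod (w e x))\<^sup>2 \<partial>hl)"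
      by (simp add: L2norm_sq)
    moreover have "q * (cmod (w 1 0))\<^sup>2 \<le> (L2norm (wderiv (w e)))\<^sup>2 / 2 + 2 * q\<^sup>2 * (L2norm (w e))\<^sup>2"
      using trace_le[OF H] H1_graphD(2)[OF w e] by simp
    ultimately show "(L2norm (wderiv (w e)))\<^sup>2 / 2 - (5 * \<omega> + 2 * q\<^sup>2) * (L2norm (w e))\<^sup>2
      \<le> (L2norm (wderiv (w e)))\<^sup>2 + (\<integral>x. (\<omega> - 3 * (\<phi> x)\<^sup>2) * (cmod (w e x))\<^sup>2 \<partial>hl) - q * (cmod (w 1 0))\<^sup>2"
      unfolding distrib_right by linarith
  qed
  then show ?thesis
    unfolding second_variation_def unfolding \<gamma>
    by (simp add: sum_subtractf sum_distrib_left sum_divide_distrib mult.assoc)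
qed

text \<open>Adding a small multiple of the previous bound to the L2 bound brings in the derivatives.
  The multiplier \<tau> is chosen so that the L2 loss is \<delta>/2, half of what is
  available.\<close>

lemma second_variation_coercive:
  obtains \<kappa> C where "0 < \<kappa>" "0 \<le> C" "\<And>w w0. w \<in> H1_graph N \<Longrightarrow> w 1 0 = of_real w0 \<Longrightarrow>
    \<kappa> * (H1_norm N w)\<^sup>2 \<le> second_variation w + C * (overlap w)\<^sup>2"
proof -
  obtain \<delta> where \<delta>: "0 < \<delta>" "\<And>w w0. w \<in> H1_graph N \<Longrightarrow> w 1 0 = of_real w0 \<Longrightarrow>
    \<delta> * (\<Sum>e=1..N. (L2norm (w e))\<^sup>2) \<le> second_variation w + 4 * sqrt \<omega> * (overlap w)\<^sup>2"
    using second_variation_lower_L2 by blast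
  define K where "K = 5 * \<omega> + 2 * q\<^sup>2"
  have K: "0 < K" using \<omega>_pos q by (simp add: K_def add_pos_pos)
  define \<tau> where "\<tau> = \<delta> / (2 * K)"
  have \<tau>: "0 < \<tau>" "\<tau> * K = \<delta> / 2" using \<delta>(1) K by (simp_all add: \<tau>_def)
  define m where "m = min (\<delta> / 2) (\<tau> / 2)"
  have m: "0 < m" "m \<le> \<delta> / 2" "m \<le> \<tau> / 2" using \<delta>(1) \<tau>(1) by (simp_all add: m_def)
  show thesis
  proof (rule that)
    show "0 < m / (1 + \<tau>)" using m \<tau> by simp
    show "0 \<le> 4 * sqrt \<omega> / (1 + \<tau>)" using sqrt_pos \<tau> by simp
    fix w w0 assume w: "w \<in> H1_graph N" and w0: "w 1 0 = complex_of_real w0"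
    define M where "M = (\<Sum>e=1..N. (L2norm (w e))\<^sup>2)"
    define D where "D = (\<Sum>e=1..N. (L2norm (wderiv (w e)))\<^sup>2)"
    have MD: "0 \<le> M" "0 \<le> D" by (simp_all add: M_def D_def sum_nonneg)
    have n: "(H1_norm N w)\<^sup>2 = M + D"
      by (simp add: H1_norm_sq H1_halfline_norm_sq M_def D_def sum.distrib)
    have 1: "\<delta> * M \<le> second_variation w + 4 * sqrt \<omega> * (overlap w)\<^sup>2"
      unfolding M_def by (rule \<delta>(2)[OF w w0])
    have "\<tau> * (D / 2 - K * M) \<le> \<tau> * second_variation w"
      using second_variation_lower_deriv[OF w] \<tau>(1) unfolding D_def M_def K_def by (intro mult_left_mono) auto
    then have 2: "\<tau> / 2 * D - \<delta> / 2 * M \<le> \<tau> * second_variation w"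
      unfolding right_diff_distrib mult.assoc[symmetric] \<tau>(2) by (simp add: mult.commute)
    have "m * (M + D) \<le> \<delta> / 2 * M + \<tau> / 2 * D"
      unfolding distrib_left using m MD by (intro add_mono mult_right_mono) auto
    also have "\<dots> \<le> (1 + \<tau>) * second_variation w + 4 * sqrt \<omega> * (overlap w)\<^sup>2"
      using 1 2 unfolding distrib_right by linarith
    finally have "m * (M + D) / (1 + \<tau>) \<le> ((1 + \<tau>) * second_variation w + 4 * sqrt \<omega> * (overlap w)\<^sup>2) / (1 + \<tau>)"
      using \<tau>(1) by (intro divide_right_mono) auto
    also have "\<dots> = second_variation w + 4 * sqrt \<omega> / (1 + \<tau>) * (overlap w)\<^sup>2"
      using \<tau>(1) unfolding add_divide_distrib by simp
    finally show "m / (1 + \<tau>) * (H1_norm N w)\<^sup>2 \<le> second_variation w + 4 * sqrt \<omega> / (1 + \<tau>) * (overlap w)\<^sup>2"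
      unfolding n by simp
  qed
qed

text \<open>Weak form of \<phi>'' = \<omega> \<phi> - \<phi>^3. Integration by parts leaves q
  \<phi>(0) times the conjugate vertex value on each edge, and the N copies cancel the \<gamma>-term
  of the form.\<close>

lemma standing_wave_equation:
  assumes w: "w \<in> H1_graph N"
  shows "minus_Delta N \<gamma> \<Phi> w = L2_inner N (\<lambda>e x. of_real ((\<phi> x) ^ 3 - \<omega> * \<phi> x)) w"
proof -
  have edge: "(\<integral>x. wderiv (\<Phi> e) x * cnj (wderiv (w e) x) \<partial>hl)
     = of_real (q * \<phi> 0) * cnj (w 1 0) + (\<integral>x. of_real ((\<phi> x) ^ 3 - \<omega> * \<phi> x) * cnj (w e x) \<partial>hl)"
    if e: "e \<in> {1..N}" for e
  proof -
    note H = H1_graphD(1)[OF w e]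
    define d where "d x = complex_of_real (- Q x * \<phi> x)" for x
    define d2 where "d2 x = complex_of_real (\<omega> * \<phi> x - (\<phi> x) ^ 3)" for x
    have pd: "primitive d d2"
      unfolding d_def d2_def
    proof (rule primitive_real)
      fix x
      have "\<omega> * \<phi> x - (\<phi> x) ^ 3 = \<phi> x * (\<omega> - (\<phi> x)\<^sup>2)" by (simp add: power2_eq_square power3_eq_cube algebra_simps)
      also have "\<dots> = - (\<omega> - (Q x)\<^sup>2) * \<phi> x + - Q x * (- Q x * \<phi> x)"
        unfolding \<phi>_sq by (simp add: power2_eq_square algebra_simps)
      finally show "((\<lambda>x. - Q x * \<phi> x) has_real_derivative \<omega> * \<phi> x - (\<phi> x) ^ 3) (at x)"
        by (intro DERIV_cong[OF DERIV_mult[OF DERIV_minus[OF Q_deriv] \<phi>_deriv]]) simp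
      show "continuous_on {0..} (\<lambda>x. \<omega> * \<phi> x - (\<phi> x) ^ 3)" by (intro continuous_intros continuous_\<phi>)
    qed
    have dL: "d \<in> L2_halfline" unfolding d_def by (rule deriv_\<phi>_L2)
    have d2L: "d2 \<in> L2_halfline" unfolding d2_def[abs_def] using L2_uminus[OF cubic_\<phi>_L2] by simp
    have I: "integrable hl (\<lambda>x. d x * cnj (w e x))" "integrable hl (\<lambda>x. d x * cnj (wderiv (w e) x))"
      "integrable hl (\<lambda>x. d2 x * cnj (w e x))"
      by (intro L2_integrable_mult_cnj dL d2L H1_L2 wderiv_L2 H)+
    have "(\<integral>x. d x * cnj (wderiv (w e) x) + d2 x * cnj (w e x) \<partial>hl) = - (d 0 * cnj (w e 0))"
      by (rule primitive_integral[OF primitive_mult[OF pd primitive_cnj[OF wderiv_primitive[OF H]]] I(1)])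
        (intro Bochner_Integration.integrable_add I)
    then have "(\<integral>x. d x * cnj (wderiv (w e) x) \<partial>hl) = of_real (q * \<phi> 0) * cnj (w e 0) - (\<integral>x. d2 x * cnj (w e x) \<partial>hl)"
      using I by (simp add: d_def Q_0 algebra_simps)
    moreover have "(\<integral>x. wderiv (\<Phi> e) x * cnj (wderiv (w e) x) \<partial>hl) = (\<integral>x. d x * cnj (wderiv (w e) x) \<partial>hl)"
      unfolding \<Phi>_def d_def
      by (rule inner_cong_AE[OF wderiv_\<phi> AE_I2[OF refl]])
        (intro deriv_\<phi>_L2 wderiv_L2[OF \<phi>_H1] wderiv_L2[OF H])+
    moreover have "(\<integral>x. of_real ((\<phi> x) ^ 3 - \<omega> * \<phi> x) * cnj (w e x) \<partial>hl) = - (\<integral>x. d2 x * cnj (w e x) \<partial>hl)"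
      unfolding integral_minus[symmetric] d2_def by (intro Bochner_Integration.integral_cong) (auto simp: algebra_simps)
    ultimately show ?thesis using H1_graphD(2)[OF w e] by simp
  qed
  have "(\<Sum>e=1..N. \<integral>x. wderiv (\<Phi> e) x * cnj (wderiv (w e) x) \<partial>hl)
     = of_real \<gamma> * (of_real (\<phi> 0) * cnj (w 1 0)) + L2_inner N (\<lambda>e x. of_real ((\<phi> x) ^ 3 - \<omega> * \<phi> x)) w"
    unfolding L2_inner_hl using edge by (simp add: sum.distrib \<gamma> mult.assoc)
  then show ?thesis unfolding minus_Delta_hl by (simp add: \<Phi>_def)
qed

end

section \<open>Coercivity of the scalar energy\<close>

text \<open>
  The value at \<open>0\<close> is \<open>1\<close> and not \<open>sgn 0 = 0\<close>: a function vanishing at the vertex must not count as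
  close to the orbit of the soliton.
\<close>

definition phase :: "complex \<Rightarrow> complex" where
  "phase z = (if z = 0 then 1 else sgn z)"

lemma cmod_phase [simp]: "cmod (phase z) = 1"
  by (simp add: phase_def norm_sgn)

lemma cnj_phase_mult: "cnj (phase z) * z = of_real (cmod z)"
proof (cases "z = 0")
  case False
  then have "cnj (phase z) * z = of_real ((cmod z)\<^sup>2) / of_real (cmod z)"
    unfolding complex_norm_square by (simp add: phase_def sgn_eq mult.commute)
  then show ?thesis using False by (simp add: power2_eq_square)
qed simp

lemma phase_diff_le:
  assumes "z \<noteq> 0" "w \<noteq> 0"
  shows "cmod (phase z - phase w) \<le> 2 * cmod (z - w) / cmod w"
proof -
  have "phase z - phase w = z / of_real (cmod z) - w / of_real (cmod w)"
    using assms by (simp add: phase_def sgn_eq)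
  also have "\<dots> = (z / of_real (cmod z)) * (of_real (cmod w - cmod z) / of_real (cmod w)) + (z - w) / of_real (cmod w)"
    using assms by (simp add: field_simps)
  also have "cmod \<dots> \<le> 1 * (cmod (w - z) / cmod w) + cmod (z - w) / cmod w"
  proof (intro order_trans[OF norm_triangle_ineq] add_mono)
    have "cmod (of_real (cmod w - cmod z) / of_real (cmod w)) = \<bar>cmod w - cmod z\<bar> / cmod w"
      unfolding norm_divide norm_of_real by simp
    also have "\<dots> \<le> cmod (w - z) / cmod w" by (intro divide_right_mono norm_triangle_ineq3) auto
    finally show "cmod ((z / of_real (cmod z)) * (of_real (cmod w - cmod z) / of_real (cmod w))) \<le> 1 * (cmod (w - z) / cmod w)"
      unfolding norm_mult using assms by (intro mult_mono) (auto simp: norm_divide)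
    show "cmod ((z - w) / of_real (cmod w)) \<le> cmod (z - w) / cmod w" by (simp add: norm_divide)
  qed
  finally show ?thesis by (simp add: norm_minus_commute)
qed

lemma mass_scale: "mass N (\<lambda>e x. k * u e x) = (cmod k)\<^sup>2 * mass N u"
  by (simp add: mass_def norm_mult power_mult_distrib sum_distrib_left)

lemma minus_Delta_scale_self:
  assumes u: "u \<in> H1_graph N"
  shows "minus_Delta N \<gamma> (\<lambda>e x. k * u e x) (\<lambda>e x. k * u e x) = of_real ((cmod k)\<^sup>2) * minus_Delta N \<gamma> u u"
proof -
  have "minus_Delta N \<gamma> u (\<lambda>e x. k * u e x) = cnj (k * minus_Delta N \<gamma> u u)"
    unfolding minus_Delta_scale_left[OF u u, symmetric] by (simp add: minus_Delta_cnj)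
  then show ?thesis
    unfolding minus_Delta_scale_left[OF u H1_graph_scale[OF u]] complex_norm_square by (simp add: minus_Delta_cnj)
qed

lemma scalar_energy_rotate:
  assumes "u \<in> H1_graph N" "cmod z = 1"
  shows "scalar_energy N \<gamma> (\<lambda>e x. z * u e x) = scalar_energy N \<gamma> u"
  using assms by (simp add: scalar_energy_def minus_Delta_scale_self norm_mult)

text \<open>The exact quadratic part is (\<omega> - f^2) |w|^2 - 2 f^2 (Re w)^2. Estimating (Re w)^2
  by |w|^2 gives the potential \<omega> - 3 f^2 for all complex w; the cubic and quartic remainders
  are |w|^2 times powers of the sup bound n.\<close>

lemma quartic_expansion_le:
  fixes f \<omega> h n :: real and w :: complex
  assumes f: "0 \<le> f" "f \<le> h" and w: "cmod w \<le> n"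
  shows "(\<omega> - 3 * f\<^sup>2) * (cmod w)\<^sup>2 - (2 * h * n + n\<^sup>2 / 2) * (cmod w)\<^sup>2
     \<le> 2 * ((f ^ 3 - \<omega> * f) * Re w) + \<omega> * ((cmod (of_real f + w))\<^sup>2 - (cmod (of_real f))\<^sup>2)
       - ((cmod (of_real f + w)) ^ 4 - (cmod (complex_of_real f)) ^ 4) / 2"
proof -
  define p where "p = Re w"
  define s where "s = (cmod w)\<^sup>2"
  have e: "(cmod (of_real f + w))\<^sup>2 = f\<^sup>2 + 2 * f * p + s"
    by (simp add: s_def p_def cmod_add_sq)
  have e4: "x ^ 4 = (x\<^sup>2)\<^sup>2" for x :: real by (simp flip: power_mult)
  have ps: "p\<^sup>2 \<le> s" "\<bar>p\<bar> \<le> cmod w" unfolding p_def s_def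
    using abs_Re_le_cmod[of w] by (auto simp: cmod_power2)
  have "f * p * s \<le> h * n * s"
  proof -
    have "f * p \<le> f * \<bar>p\<bar>" using f by (intro mult_left_mono) auto
    also have "\<dots> \<le> h * n" using f w ps(2) by (intro mult_mono) auto
    finally show ?thesis by (rule mult_right_mono) (simp add: s_def)
  qed
  moreover have "s * s \<le> n\<^sup>2 * s"
    using w by (intro mult_right_mono) (auto simp: s_def intro!: power_mono)
  moreover have "f\<^sup>2 * p\<^sup>2 \<le> f\<^sup>2 * s" using ps by (intro mult_left_mono) auto
  moreover have "2 * ((f ^ 3 - \<omega> * f) * p) + \<omega> * (f\<^sup>2 + 2 * f * p + s - f\<^sup>2) - ((f\<^sup>2 + 2 * f * p + s)\<^sup>2 - (f\<^sup>2)\<^sup>2) / 2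
     = \<omega> * s - f\<^sup>2 * s - 2 * (f\<^sup>2 * p\<^sup>2) - 2 * (f * p * s) - s * s / 2"
    by (simp add: power2_eq_square power3_eq_cube algebra_simps)
  ultimately have "(\<omega> - 3 * f\<^sup>2) * s - (2 * h * n + n\<^sup>2 / 2) * s
     \<le> 2 * ((f ^ 3 - \<omega> * f) * p) + \<omega> * (f\<^sup>2 + 2 * f * p + s - f\<^sup>2) - ((f\<^sup>2 + 2 * f * p + s)\<^sup>2 - (f\<^sup>2)\<^sup>2) / 2"
    by (simp add: algebra_simps)
  then show ?thesis unfolding e4 e s_def[symmetric] p_def[symmetric] by simp
qed

context star_soliton begin

lemma mass_expansion:
  assumes w: "w \<in> H1_graph N"
  shows "mass N (\<lambda>e x. \<Phi> e x + w e x) = mass N \<Phi> + 2 * overlap w + mass N w"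
proof -
  have "(\<integral>x. (cmod (\<Phi> e x + w e x))\<^sup>2 \<partial>hl)
     = (\<integral>x. (cmod (\<Phi> e x))\<^sup>2 \<partial>hl) + 2 * (\<integral>x. \<phi> x * Re (w e x) \<partial>hl) + (\<integral>x. (cmod (w e x))\<^sup>2 \<partial>hl)"
    if e: "e \<in> {1..N}" for e
  proof -
    note H = H1_graphD(1)[OF \<Phi>_H1 e] H1_graphD(1)[OF w e]
    have "(cmod (\<Phi> e x + w e x))\<^sup>2 = (cmod (\<Phi> e x))\<^sup>2 + 2 * (\<phi> x * Re (w e x)) + (cmod (w e x))\<^sup>2" for x
      unfolding cmod_add_sq by (simp add: \<Phi>_def)
    then show ?thesis
      using H1_integrable_sq[OF H(1)] H1_integrable_sq[OF H(2)] \<phi>_Re_integrable[OF H1_L2[OF H(2)]] by simp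
  qed
  then show ?thesis by (simp add: mass_def overlap_def sum.distrib sum_distrib_left)
qed

text \<open>The soliton is a critical point of scalar energy plus \<omega> times mass: the linear
  term of the form is twice the pairing with \<phi>^3 - \<omega> \<phi>, and the linear terms of
  mass and quartic energy cancel it.\<close>

lemma action_expansion:
  assumes w: "w \<in> H1_graph N"
  defines "n \<equiv> H1_norm N w"
  shows "second_variation w - (2 * \<phi> 0 * n + n\<^sup>2 / 2) * n\<^sup>2
     \<le> scalar_energy N \<gamma> (\<lambda>e x. \<Phi> e x + w e x) - scalar_energy N \<gamma> \<Phi>
       + \<omega> * (mass N (\<lambda>e x. \<Phi> e x + w e x) - mass N \<Phi>)"
proof -
  define U where "U = (\<lambda>e x. \<Phi> e x + w e x)"
  have UH: "U \<in> H1_graph N" unfolding U_def by (rule H1_graph_add[OF \<Phi>_H1 w])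
  define g where "g x = complex_of_real ((\<phi> x) ^ 3 - \<omega> * \<phi> x)" for x
  have n0: "0 \<le> n" by (simp add: n_def)
  have "minus_Delta N \<gamma> U U = minus_Delta N \<gamma> \<Phi> U + minus_Delta N \<gamma> w U"
    unfolding U_def[abs_def] by (rule minus_Delta_add_left[OF \<Phi>_H1 w UH[unfolded U_def]])
  also have "minus_Delta N \<gamma> \<Phi> U = cnj (minus_Delta N \<gamma> \<Phi> \<Phi> + minus_Delta N \<gamma> w \<Phi>)"
    using minus_Delta_add_left[OF \<Phi>_H1 w \<Phi>_H1, of \<gamma>] minus_Delta_cnj[of N \<gamma> U \<Phi>] by (simp add: U_def)
  also have "minus_Delta N \<gamma> w U = cnj (minus_Delta N \<gamma> \<Phi> w + minus_Delta N \<gamma> w w)"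
    using minus_Delta_add_left[OF \<Phi>_H1 w w, of \<gamma>] minus_Delta_cnj[of N \<gamma> U w] by (simp add: U_def)
  finally have "Re (minus_Delta N \<gamma> U U) = Re (minus_Delta N \<gamma> \<Phi> \<Phi>) + Re (minus_Delta N \<gamma> w w)
      + Re (minus_Delta N \<gamma> w \<Phi>) + Re (minus_Delta N \<gamma> \<Phi> w)"
    by simp
  moreover have "Re (minus_Delta N \<gamma> w \<Phi>) = Re (minus_Delta N \<gamma> \<Phi> w)"
    using arg_cong[OF minus_Delta_cnj[of N \<gamma> w \<Phi>], of Re] by simp
  ultimately have D: "Re (minus_Delta N \<gamma> U U) = Re (minus_Delta N \<gamma> \<Phi> \<Phi>) + Re (minus_Delta N \<gamma> w w)
      + 2 * Re (L2_inner N (\<lambda>e. g) w)"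
    unfolding standing_wave_equation[OF w] g_def by simp
  have edge: "(\<integral>x. (\<omega> - 3 * (\<phi> x)\<^sup>2) * (cmod (w e x))\<^sup>2 \<partial>hl) - (2 * \<phi> 0 * n + n\<^sup>2 / 2) * (L2norm (w e))\<^sup>2
     \<le> 2 * Re (\<integral>x. g x * cnj (w e x) \<partial>hl) + \<omega> * ((\<integral>x. (cmod (U e x))\<^sup>2 \<partial>hl) - (\<integral>x. (cmod (\<Phi> e x))\<^sup>2 \<partial>hl))
       - ((\<integral>x. (cmod (U e x)) ^ 4 \<partial>hl) - (\<integral>x. (cmod (\<Phi> e x)) ^ 4 \<partial>hl)) / 2" (is "?L \<le> ?R")
    if e: "e \<in> {1..N}" for e
  proof -
    note H = H1_graphD(1)[OF \<Phi>_H1 e] H1_graphD(1)[OF w e] H1_graphD(1)[OF UH e]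
    have gL: "g \<in> L2_halfline" unfolding g_def by (rule cubic_\<phi>_L2)
    have ig: "integrable hl (\<lambda>x. g x * cnj (w e x))" by (rule L2_integrable_mult_cnj[OF gL H1_L2[OF H(2)]])
    note I = potential_integrable[OF H1_L2[OF H(2)]] H1_integrable_sq[OF H(2)] integrable_Re[OF ig]
      H1_integrable_sq[OF H(3)] H1_integrable_sq[OF H(1)] H1_integrable_pow4[OF H(3)] H1_integrable_pow4[OF H(1)]
    have "?L = (\<integral>x. (\<omega> - 3 * (\<phi> x)\<^sup>2) * (cmod (w e x))\<^sup>2 - (2 * \<phi> 0 * n + n\<^sup>2 / 2) * (cmod (w e x))\<^sup>2 \<partial>hl)"
      using I(1,2) by (simp add: L2norm_sq)
    also have "\<dots> \<le> (\<integral>x. 2 * Re (g x * cnj (w e x)) + \<omega> * ((cmod (U e x))\<^sup>2 - (cmod (\<Phi> e x))\<^sup>2)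
        - ((cmod (U e x)) ^ 4 - (cmod (\<Phi> e x)) ^ 4) / 2 \<partial>hl)"
    proof (rule integral_mono)
      show "integrable hl (\<lambda>x. (\<omega> - 3 * (\<phi> x)\<^sup>2) * (cmod (w e x))\<^sup>2 - (2 * \<phi> 0 * n + n\<^sup>2 / 2) * (cmod (w e x))\<^sup>2)"
        by (intro Bochner_Integration.integrable_diff integrable_mult_right I)
      show "integrable hl (\<lambda>x. 2 * Re (g x * cnj (w e x)) + \<omega> * ((cmod (U e x))\<^sup>2 - (cmod (\<Phi> e x))\<^sup>2)
        - ((cmod (U e x)) ^ 4 - (cmod (\<Phi> e x)) ^ 4) / 2)"
        by (intro Bochner_Integration.integrable_add Bochner_Integration.integrable_diff integrable_mult_right integrable_divide I)
      fix x assume "x \<in> space hl"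
      then have x: "0 \<le> x" by simp
      have "cmod (w e x) \<le> n" unfolding n_def by (rule graph_sup_bound[OF w e x])
      from quartic_expansion_le[OF less_imp_le[OF \<phi>_pos] \<phi>_le[OF x] this, of \<omega>]
      show "(\<omega> - 3 * (\<phi> x)\<^sup>2) * (cmod (w e x))\<^sup>2 - (2 * \<phi> 0 * n + n\<^sup>2 / 2) * (cmod (w e x))\<^sup>2
        \<le> 2 * Re (g x * cnj (w e x)) + \<omega> * ((cmod (U e x))\<^sup>2 - (cmod (\<Phi> e x))\<^sup>2)
        - ((cmod (U e x)) ^ 4 - (cmod (\<Phi> e x)) ^ 4) / 2"
        unfolding U_def \<Phi>_def g_def by simp
    qed
    also have "\<dots> = ?R"
      using I(3-7) by (simp add: integral_Re[OF ig] del: times_complex.sel)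
    finally show ?thesis .
  qed
  have "(\<Sum>e=1..N. (\<integral>x. (\<omega> - 3 * (\<phi> x)\<^sup>2) * (cmod (w e x))\<^sup>2 \<partial>hl)) - (2 * \<phi> 0 * n + n\<^sup>2 / 2) * (\<Sum>e=1..N. (L2norm (w e))\<^sup>2)
     \<le> 2 * Re (L2_inner N (\<lambda>e. g) w) + \<omega> * (mass N U - mass N \<Phi>)
       - ((\<Sum>e=1..N. \<integral>x. (cmod (U e x)) ^ 4 \<partial>hl) - (\<Sum>e=1..N. \<integral>x. (cmod (\<Phi> e x)) ^ 4 \<partial>hl)) / 2"
    using sum_mono[of "{1..N}", OF edge]
    by (simp add: sum.distrib sum_subtractf mass_def L2_inner_hl flip: sum_distrib_left sum_divide_distrib)
  moreover have "(2 * \<phi> 0 * n + n\<^sup>2 / 2) * (\<Sum>e=1..N. (L2norm (w e))\<^sup>2) \<le> (2 * \<phi> 0 * n + n\<^sup>2 / 2) * n\<^sup>2"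
  proof (rule mult_left_mono)
    show "(\<Sum>e=1..N. (L2norm (w e))\<^sup>2) \<le> n\<^sup>2"
      unfolding n_def H1_norm_sq by (intro sum_mono) (simp add: H1_halfline_norm_sq)
    show "0 \<le> 2 * \<phi> 0 * n + n\<^sup>2 / 2" using n0 \<phi>_pos[of 0] by simp
  qed
  ultimately show ?thesis
    unfolding second_variation_def scalar_energy_def U_def[symmetric] D Re_minus_Delta_self[of N \<gamma> w]
    by (simp add: sum.distrib diff_divide_distrib)
qed

text \<open>The distance to one particular rotation, read off at the vertex. It is not the infimum
  over rotations but bounds it from above.\<close>

definition phase_dist :: "graph_fun \<Rightarrow> real" where
  "phase_dist U = H1_norm N (\<lambda>e x. U e x - phase (U 1 0) * \<Phi> e x)"

text \<open>Twice the overlap of the perturbation with the soliton is the mass defect minus the mass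
  of the perturbation. Its square is thus of fourth order apart from the defect, and a small radius
  \<rho> absorbs it together with the remainder of the expansion.\<close>

lemma scalar_coercive:
  obtains \<kappa> \<rho> C where "0 < \<kappa>" "0 < \<rho>" "\<rho> \<le> \<phi> 0 / 2" "0 \<le> C"
    "\<And>U. U \<in> H1_graph N \<Longrightarrow> phase_dist U \<le> \<rho> \<Longrightarrow> \<bar>mass N U - mass N \<Phi>\<bar> \<le> 1 \<Longrightarrow>
      \<kappa> * (phase_dist U)\<^sup>2 \<le> scalar_energy N \<gamma> U - scalar_energy N \<gamma> \<Phi> + C * \<bar>mass N U - mass N \<Phi>\<bar>"
proof -
  obtain \<kappa> C where \<kappa>: "0 < \<kappa>" "0 \<le> C" "\<And>w w0. w \<in> H1_graph N \<Longrightarrow> w 1 0 = of_real w0 \<Longrightarrow>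
    \<kappa> * (H1_norm N w)\<^sup>2 \<le> second_variation w + C * (overlap w)\<^sup>2"
    using second_variation_coercive by blast
  define h where "h = \<phi> 0"
  have h: "0 < h" using \<phi>_pos by (simp add: h_def)
  \<comment> \<open>The sum of the coefficients of all remainders: for n \<le> \<rho> \<le> 1 they
    total at most \<rho> B n^2.\<close>
  define B where "B = 2 * h + 1 / 2 + C / 2"
  have B: "0 < B" using h \<kappa> by (simp add: B_def add_pos_nonneg)
  define \<rho> where "\<rho> = min (min 1 (h / 2)) (\<kappa> / 2 / B)"
  have \<rho>: "0 < \<rho>" "\<rho> \<le> 1" "\<rho> \<le> h / 2" "\<rho> * B \<le> \<kappa> / 2"
  proof -
    show "0 < \<rho>" using h \<kappa> B by (simp add: \<rho>_def)
    show "\<rho> \<le> 1" "\<rho> \<le> h / 2" by (simp_all add: \<rho>_def)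
    have "\<rho> \<le> \<kappa> / 2 / B" by (simp add: \<rho>_def)
    then show "\<rho> * B \<le> \<kappa> / 2" by (simp only: pos_le_divide_eq[OF B])
  qed
  show thesis
  proof (rule that)
    show "0 < \<kappa> / 2" "0 < \<rho>" "\<rho> \<le> \<phi> 0 / 2" using \<kappa> \<rho> by (simp_all add: h_def)
    show "0 \<le> \<omega> + C / 2" using \<omega>_pos \<kappa> by simp
    fix U assume U: "U \<in> H1_graph N" and d: "phase_dist U \<le> \<rho>" and m: "\<bar>mass N U - mass N \<Phi>\<bar> \<le> 1"
    define z where "z = phase (U 1 0)"
    have z: "cmod z = 1" "cnj z * z = 1" "z * cnj z = 1"
      using complex_norm_square[of z] by (simp_all add: z_def mult.commute)
    \<comment> \<open>Rotating U back, and not \<Phi> forward, makes the perturbation real at the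
      vertex, as coercivity requires.\<close>
    define w where "w = (\<lambda>e x. cnj z * U e x - \<Phi> e x)"
    have w: "w \<in> H1_graph N" unfolding w_def by (rule H1_graph_diff[OF H1_graph_scale[OF U] \<Phi>_H1])
    have w0: "w 1 0 = of_real (cmod (U 1 0) - \<phi> 0)"
      by (simp add: w_def z_def cnj_phase_mult \<Phi>_def)
    define n where "n = H1_norm N w"
    have n: "n = phase_dist U"
    proof -
      have "w = (\<lambda>e x. cnj z * (U e x - z * \<Phi> e x))"
        unfolding w_def using z by (simp add: right_diff_distrib mult.assoc[symmetric])
      then have "n = cmod (cnj z) * H1_norm N (\<lambda>e x. U e x - z * \<Phi> e x)"
        unfolding n_def by (simp only: H1_norm_scale[OF H1_graph_diff[OF U H1_graph_scale[OF \<Phi>_H1]]])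
      then show ?thesis using z by (simp add: phase_dist_def z_def)
    qed
    have n0: "0 \<le> n" "n \<le> \<rho>" using d by (simp_all add: n[symmetric]) (simp add: n_def)
    have Uw: "(\<lambda>e x. \<Phi> e x + w e x) = (\<lambda>e x. cnj z * U e x)" by (simp add: w_def)
    define dM where "dM = mass N U - mass N \<Phi>"
    have mU: "mass N (\<lambda>e x. \<Phi> e x + w e x) = mass N U" unfolding Uw mass_scale using z by simp
    have eU: "scalar_energy N \<gamma> (\<lambda>e x. \<Phi> e x + w e x) = scalar_energy N \<gamma> U"
      unfolding Uw by (rule scalar_energy_rotate[OF U]) (use z in simp)
    have A: "second_variation w - (2 * h * n + n\<^sup>2 / 2) * n\<^sup>2
      \<le> scalar_energy N \<gamma> U - scalar_energy N \<gamma> \<Phi> + \<omega> * dM"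
      using action_expansion[OF w] unfolding mU eU n_def[symmetric] h_def[symmetric] dM_def .
    \<comment> \<open>The assumption that the mass defect is at most 1 lets its square be bounded by
      the defect itself.\<close>
    have ov: "(overlap w)\<^sup>2 \<le> (\<bar>dM\<bar> + n\<^sup>2 * n\<^sup>2) / 2"
    proof -
      have "2 * overlap w = dM - mass N w" using mass_expansion[OF w] unfolding mU dM_def by simp
      moreover have "0 \<le> mass N w" "mass N w \<le> n\<^sup>2" using mass_nonneg[of N w] mass_le[of N w] by (simp_all add: n_def)
      ultimately have "\<bar>2 * overlap w\<bar> \<le> \<bar>dM\<bar> + n\<^sup>2" by linarith
      then have "(2 * overlap w)\<^sup>2 \<le> (\<bar>dM\<bar> + n\<^sup>2)\<^sup>2" by (metis abs_ge_zero power2_abs power_mono)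
      also have "\<dots> \<le> 2 * (\<bar>dM\<bar>\<^sup>2 + (n\<^sup>2)\<^sup>2)"
        using two_mult_le[of "\<bar>dM\<bar>" "n\<^sup>2"] by (simp add: power2_sum)
      also have "\<bar>dM\<bar>\<^sup>2 \<le> \<bar>dM\<bar>" using m mult_right_mono[of "\<bar>dM\<bar>" 1 "\<bar>dM\<bar>"] by (simp add: dM_def power2_eq_square)
      finally show ?thesis by (simp add: power2_eq_square)
    qed
    have nn: "n\<^sup>2 \<le> \<rho>" "n\<^sup>2 \<le> n"
      using n0 \<rho>(2) mult_mono[of n \<rho> n 1] mult_left_mono[of n 1 n] by (simp_all add: power2_eq_square)
    have "(2 * h * n + n\<^sup>2 / 2) * n\<^sup>2 + C * ((n\<^sup>2 * n\<^sup>2) / 2) = (2 * h * n + n\<^sup>2 / 2 + C / 2 * n\<^sup>2) * n\<^sup>2"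
      by (simp add: algebra_simps)
    also have "\<dots> \<le> (\<rho> * B) * n\<^sup>2"
    proof (rule mult_right_mono)
      have "2 * h * n \<le> 2 * h * \<rho>" "C / 2 * n\<^sup>2 \<le> C / 2 * \<rho>" using n0 h \<kappa>(2) nn by (auto intro!: mult_left_mono)
      then show "2 * h * n + n\<^sup>2 / 2 + C / 2 * n\<^sup>2 \<le> \<rho> * B" using nn unfolding B_def by (simp add: algebra_simps)
    qed simp
    also have "\<dots> \<le> (\<kappa> / 2) * n\<^sup>2" using \<rho>(4) by (intro mult_right_mono) auto
    finally have small: "(2 * h * n + n\<^sup>2 / 2) * n\<^sup>2 + C * ((n\<^sup>2 * n\<^sup>2) / 2) \<le> (\<kappa> / 2) * n\<^sup>2" .
    have "\<kappa> * n\<^sup>2 \<le> second_variation w + C * (overlap w)\<^sup>2" unfolding n_def by (rule \<kappa>(3)[OF w w0])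
    also have "C * (overlap w)\<^sup>2 \<le> C * ((\<bar>dM\<bar> + n\<^sup>2 * n\<^sup>2) / 2)" by (rule mult_left_mono[OF ov \<kappa>(2)])
    also have "\<dots> = C / 2 * \<bar>dM\<bar> + C * ((n\<^sup>2 * n\<^sup>2) / 2)" by (simp add: algebra_simps add_divide_distrib)
    finally have "\<kappa> * n\<^sup>2 \<le> second_variation w + (C / 2 * \<bar>dM\<bar> + C * ((n\<^sup>2 * n\<^sup>2) / 2))" by simp
    moreover have "\<omega> * dM \<le> \<omega> * \<bar>dM\<bar>" using \<omega>_pos by (intro mult_left_mono) auto
    ultimately have "\<kappa> * n\<^sup>2 - (\<kappa> / 2) * n\<^sup>2 \<le> scalar_energy N \<gamma> U - scalar_energy N \<gamma> \<Phi> + (\<omega> * \<bar>dM\<bar> + C / 2 * \<bar>dM\<bar>)"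
      using A small by linarith
    then show "\<kappa> / 2 * (phase_dist U)\<^sup>2
      \<le> scalar_energy N \<gamma> U - scalar_energy N \<gamma> \<Phi> + (\<omega> + C / 2) * \<bar>mass N U - mass N \<Phi>\<bar>"
      unfolding n[symmetric] dM_def[symmetric] distrib_right by simp
  qed
qed

text \<open>
  The phase jumps where \<open>U\<close> vanishes at the vertex; there the distance exceeds \<open>\<rho>\<close>, so truncation
  restores continuity.
\<close>

lemma phase_dist_lipschitz:
  assumes U: "U \<in> H1_graph N" and V: "V \<in> H1_graph N" and \<rho>: "0 < \<rho>" "\<rho> \<le> \<phi> 0 / 2"
  shows "min (phase_dist U) \<rho> \<le> min (phase_dist V) \<rho>
     + (2 + 4 * H1_norm N \<Phi> / \<phi> 0) * H1_norm N (\<lambda>e x. U e x - V e x)"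
proof -
  define h where "h = \<phi> 0"
  have h: "0 < h" using \<phi>_pos by (simp add: h_def)
  define s where "s = H1_norm N (\<lambda>e x. U e x - V e x)"
  have s: "0 \<le> s" by (simp add: s_def)
  define L where "L = 2 + 4 * H1_norm N \<Phi> / h"
  have L: "2 \<le> L" using h by (simp add: L_def)
  \<comment> \<open>In the first two cases the right side already reaches the truncation level:
    trivially, or because L s \<ge> h/2 \<ge> \<rho>. In the third the vertex value of V is at least
    h/2 and that of U is nonzero, so the phases differ by at most 4 s/h.\<close>
  consider "\<rho> \<le> phase_dist V" | "h / 4 \<le> s" | "phase_dist V < \<rho>" "s < h / 4" by linarith
  then have "min (phase_dist U) \<rho> \<le> min (phase_dist V) \<rho> + L * s"
  proof cases
    case 1
    then show ?thesis using mult_nonneg_nonneg[OF order_trans[OF zero_le_numeral L] s] by (simp add: min_def)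
  next
    case 2
    have "2 * (h / 4) \<le> L * s" using 2 L h by (intro mult_mono) auto
    moreover have "0 \<le> phase_dist V" by (simp add: phase_dist_def)
    ultimately show ?thesis using \<rho> unfolding h_def[symmetric] by linarith
  next
    case 3
    have e1: "1 \<in> {1..N}" using N by simp
    have "cmod (U 1 0 - V 1 0) \<le> s"
      unfolding s_def using graph_sup_bound[OF H1_graph_diff[OF U V] e1, of 0] by simp
    moreover have "cmod (V 1 0 - phase (V 1 0) * of_real h) \<le> phase_dist V"
      unfolding phase_dist_def
      using graph_sup_bound[OF H1_graph_diff[OF V H1_graph_scale[OF \<Phi>_H1]] e1, of 0 "phase (V 1 0)"]
      by (simp add: \<Phi>_def h_def)
    moreover have "h - cmod (V 1 0) \<le> cmod (V 1 0 - phase (V 1 0) * of_real h)"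
      using norm_triangle_ineq2[of "phase (V 1 0) * of_real h" "V 1 0"] h
      by (simp add: norm_mult norm_minus_commute)
    ultimately have V0: "h / 2 \<le> cmod (V 1 0)" and UV: "cmod (U 1 0 - V 1 0) \<le> s"
      using 3 \<rho> unfolding h_def[symmetric] by linarith+
    have "cmod (V 1 0) - cmod (U 1 0) \<le> s"
      using norm_triangle_ineq2[of "V 1 0" "U 1 0"] UV by (simp add: norm_minus_commute)
    then have nz: "U 1 0 \<noteq> 0" "V 1 0 \<noteq> 0" using V0 3 h by auto
    have "cmod (phase (U 1 0) - phase (V 1 0)) \<le> 2 * cmod (U 1 0 - V 1 0) / cmod (V 1 0)"
      by (rule phase_diff_le[OF nz])
    also have "\<dots> \<le> 2 * s / (h / 2)" using UV V0 h s by (intro frac_le) auto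
    finally have ph: "cmod (phase (V 1 0) - phase (U 1 0)) \<le> 4 * s / h" by (simp add: norm_minus_commute)
    have "phase_dist U = H1_norm N (\<lambda>e x. (U e x - V e x) + ((V e x - phase (V 1 0) * \<Phi> e x)
        + (phase (V 1 0) - phase (U 1 0)) * \<Phi> e x))"
      unfolding phase_dist_def by (simp add: algebra_simps)
    also have "\<dots> \<le> s + (phase_dist V + cmod (phase (V 1 0) - phase (U 1 0)) * H1_norm N \<Phi>)"
      unfolding s_def phase_dist_def H1_norm_scale[OF \<Phi>_H1, symmetric]
      by (intro order_trans[OF H1_norm_triangle] add_mono order_refl H1_graph_diff H1_graph_add H1_graph_scale U V \<Phi>_H1)
    also have "cmod (phase (V 1 0) - phase (U 1 0)) * H1_norm N \<Phi> \<le> (4 * s / h) * H1_norm N \<Phi>"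
      by (intro mult_right_mono ph) simp
    finally have "phase_dist U \<le> phase_dist V + (s + 4 * H1_norm N \<Phi> / h * s)" by (simp add: algebra_simps)
    also have "s + 4 * H1_norm N \<Phi> / h * s \<le> L * s" using s unfolding L_def distrib_right by simp
    finally show ?thesis using 3 by simp
  qed
  then show ?thesis by (simp add: L_def h_def s_def)
qed

end

section \<open>Comparison of the system with two scalar equations\<close>

lemma scalar_energy_scale:
  assumes u: "u \<in> H1_graph N" and k: "0 < k"
  shows "k\<^sup>2 * scalar_energy N \<gamma> (\<lambda>e x. of_real (1 / k) * u e x)
    = Re (minus_Delta N \<gamma> u u) - (\<Sum>e=1..N. \<integral>x. (cmod (u e x)) ^ 4 / k\<^sup>2 \<partial>hl) / 2"
proof -
  have "(cmod (of_real (1 / k) * u e x)) ^ 4 = (1 / k\<^sup>2) * ((cmod (u e x)) ^ 4 / k\<^sup>2)" for e x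
    using k by (simp add: norm_mult norm_divide power_mult_distrib power_divide power2_eq_square power4_eq_xxxx)
  then have "(\<Sum>e=1..N. \<integral>x. (cmod (of_real (1 / k) * u e x)) ^ 4 \<partial>hl)
      = (1 / k\<^sup>2) * (\<Sum>e=1..N. \<integral>x. (cmod (u e x)) ^ 4 / k\<^sup>2 \<partial>hl)"
    unfolding sum_distrib_left by (simp only: integral_mult_right_zero)
  moreover have "(cmod (complex_of_real (1 / k)))\<^sup>2 = 1 / k\<^sup>2" using k by (simp add: norm_divide power_divide)
  ultimately have "scalar_energy N \<gamma> (\<lambda>e x. of_real (1 / k) * u e x)
      = (1 / k\<^sup>2) * Re (minus_Delta N \<gamma> u u) - (1 / k\<^sup>2) * (\<Sum>e=1..N. \<integral>x. (cmod (u e x)) ^ 4 / k\<^sup>2 \<partial>hl) / 2"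
    unfolding scalar_energy_def minus_Delta_scale_self[OF u] by (simp only: Re_complex_of_real times_complex.sel Im_complex_of_real)
  then show ?thesis using k by (simp add: right_diff_distrib)
qed

text \<open>The quadratic form \<open>a X\<^sup>2 + 2 b X Y + c Y\<^sup>2\<close> falls short of \<open>X\<^sup>2 / k1\<^sup>2 + Y\<^sup>2 / k2\<^sup>2\<close> by
  \<open>b (k2 X / k1 - k1 Y / k2)\<^sup>2\<close>, so the system decouples from below.\<close>

lemma quartic_density_le:
  assumes k: "0 < k1" "0 < k2" "a * k1\<^sup>2 + b * k2\<^sup>2 = 1" "b * k1\<^sup>2 + c * k2\<^sup>2 = 1" "0 < b"
  shows "quartic_density a b c z w \<le> (cmod z) ^ 4 / k1\<^sup>2 + (cmod w) ^ 4 / k2\<^sup>2"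
proof -
  define X where "X = (cmod z)\<^sup>2" define Y where "Y = (cmod w)\<^sup>2"
  have a: "a = (1 - b * k2\<^sup>2) / k1\<^sup>2" and c: "c = (1 - b * k1\<^sup>2) / k2\<^sup>2"
    using k by (simp_all add: field_simps)
  have "0 \<le> b * (k2 * X / k1 - k1 * Y / k2)\<^sup>2" using k by simp
  also have "\<dots> = X * X / k1\<^sup>2 + Y * Y / k2\<^sup>2 - ((a * X + b * Y) * X + (b * X + c * Y) * Y)"
    unfolding a c using k(1,2) by (simp add: field_simps power2_eq_square)
  finally have "(a * X + b * Y) * X + (b * X + c * Y) * Y \<le> X * X / k1\<^sup>2 + Y * Y / k2\<^sup>2" by linarith
  moreover have "(cmod z) ^ 4 = X * X" "(cmod w) ^ 4 = Y * Y" by (simp_all add: X_def Y_def power2_eq_square power4_eq_xxxx)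
  ultimately show ?thesis unfolding quartic_density_def X_def[symmetric] Y_def[symmetric] by (simp only:)
qed

lemma energy_ge_scalar:
  assumes u: "u \<in> H1_graph N" and v: "v \<in> H1_graph N"
    and k: "0 < k1" "0 < k2" "a * k1\<^sup>2 + b * k2\<^sup>2 = 1" "b * k1\<^sup>2 + c * k2\<^sup>2 = 1" "0 < b"
  shows "k1\<^sup>2 * scalar_energy N \<gamma> (\<lambda>e x. of_real (1 / k1) * u e x)
    + k2\<^sup>2 * scalar_energy N \<gamma> (\<lambda>e x. of_real (1 / k2) * v e x) \<le> energy N \<gamma> a b c u v"
proof -
  have "quartic N a b c u v \<le> (\<Sum>e=1..N. (\<integral>x. (cmod (u e x)) ^ 4 / k1\<^sup>2 \<partial>hl) + (\<integral>x. (cmod (v e x)) ^ 4 / k2\<^sup>2 \<partial>hl))"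
    unfolding quartic_def
  proof (rule sum_mono)
    fix e assume e: "e \<in> {1..N}"
    note H = H1_graphD(1)[OF u e] H1_graphD(1)[OF v e]
    have I: "integrable hl (\<lambda>x. (cmod (u e x)) ^ 4 / k1\<^sup>2)" "integrable hl (\<lambda>x. (cmod (v e x)) ^ 4 / k2\<^sup>2)"
      by (intro integrable_divide H1_integrable_pow4 H)+
    have "(\<integral>x. quartic_density a b c (u e x) (v e x) \<partial>hl) \<le> (\<integral>x. (cmod (u e x)) ^ 4 / k1\<^sup>2 + (cmod (v e x)) ^ 4 / k2\<^sup>2 \<partial>hl)"
      by (intro integral_mono integrable_quartic_density H Bochner_Integration.integrable_add I quartic_density_le k)
    then show "(\<integral>x. quartic_density a b c (u e x) (v e x) \<partial>hl)
      \<le> (\<integral>x. (cmod (u e x)) ^ 4 / k1\<^sup>2 \<partial>hl) + (\<integral>x. (cmod (v e x)) ^ 4 / k2\<^sup>2 \<partial>hl)"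
      unfolding Bochner_Integration.integral_add[OF I] .
  qed
  then show ?thesis
    unfolding scalar_energy_scale[OF u k(1)] scalar_energy_scale[OF v k(2)] energy_def sum.distrib by linarith
qed

lemma energy_proportional:
  assumes w: "w \<in> H1_graph N"
    and k: "a * k1\<^sup>2 + b * k2\<^sup>2 = 1" "b * k1\<^sup>2 + c * k2\<^sup>2 = 1"
  shows "energy N \<gamma> a b c (\<lambda>e x. of_real k1 * w e x) (\<lambda>e x. of_real k2 * w e x)
    = (k1\<^sup>2 + k2\<^sup>2) * scalar_energy N \<gamma> w"
proof -
  have "quartic_density a b c (of_real k1 * z) (of_real k2 * z) = (k1\<^sup>2 + k2\<^sup>2) * (cmod z) ^ 4" for z
  proof -
    have "quartic_density a b c (of_real k1 * z) (of_real k2 * z)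
      = ((a * k1\<^sup>2 + b * k2\<^sup>2) * k1\<^sup>2 + (b * k1\<^sup>2 + c * k2\<^sup>2) * k2\<^sup>2) * (cmod z) ^ 4"
      unfolding quartic_density_def norm_mult norm_of_real power_mult_distrib power2_abs
      by (simp add: power4_eq_xxxx power2_eq_square algebra_simps)
    then show ?thesis unfolding k by simp
  qed
  then have "quartic N a b c (\<lambda>e x. of_real k1 * w e x) (\<lambda>e x. of_real k2 * w e x)
    = (k1\<^sup>2 + k2\<^sup>2) * (\<Sum>e=1..N. \<integral>x. (cmod (w e x)) ^ 4 \<partial>hl)"
    unfolding quartic_def by (simp add: sum_distrib_left)
  then show ?thesis
    unfolding energy_def scalar_energy_def minus_Delta_scale_self[OF w] by (simp add: algebra_simps)
qed

section \<open>Dependence of the conserved quantities on the initial data\<close>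

lemma mass_diff_le:
  assumes u: "u \<in> H1_graph N" and w: "w \<in> H1_graph N" and R: "H1_norm N u \<le> R" "H1_norm N w \<le> R"
  shows "\<bar>mass N u - mass N w\<bar> \<le> 2 * R * H1_norm N (\<lambda>e x. u e x - w e x)"
proof -
  define d where "d = (\<lambda>e x. u e x - w e x)"
  have d: "d \<in> H1_graph N" unfolding d_def by (rule H1_graph_diff[OF u w])
  note L = H1_graph_L2[OF u] H1_graph_L2[OF w] H1_graph_L2[OF d]
  have "L2_inner N u u - L2_inner N w w = L2_inner N d u + L2_inner N w d"
    unfolding d_def L2_inner_diff_left[OF L(1,2,1)] L2_inner_diff_right[OF L(1,2,2)] by simp
  then have "mass N u - mass N w = Re (L2_inner N d u + L2_inner N w d)"
    unfolding mass_eq(1) by (metis minus_complex.sel(1))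
  also have "\<bar>\<dots>\<bar> \<le> cmod (L2_inner N d u) + cmod (L2_inner N w d)"
    by (rule order_trans[OF abs_Re_le_cmod norm_triangle_ineq])
  also have "\<dots> \<le> H1_norm N d * R + R * H1_norm N d"
    by (intro add_mono order_trans[OF L2_inner_le] mult_left_mono mult_right_mono u w d R) auto
  finally show ?thesis by (simp add: d_def)
qed

lemma Re_minus_Delta_diff_le:
  assumes u: "u \<in> H1_graph N" and w: "w \<in> H1_graph N" and R: "H1_norm N u \<le> R" "H1_norm N w \<le> R" and N: "1 \<le> N"
  shows "\<bar>Re (minus_Delta N \<gamma> u u) - Re (minus_Delta N \<gamma> w w)\<bar> \<le> (1 + \<bar>\<gamma>\<bar>) * (2 * R * H1_norm N (\<lambda>e x. u e x - w e x))"
proof -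
  define d where "d = (\<lambda>e x. u e x - w e x)"
  have d: "d \<in> H1_graph N" unfolding d_def by (rule H1_graph_diff[OF u w])
  have u_eq: "u = (\<lambda>e x. d e x + w e x)" by (simp add: d_def)
  have "minus_Delta N \<gamma> u u = minus_Delta N \<gamma> d u + minus_Delta N \<gamma> w u"
    by (subst (1) u_eq) (rule minus_Delta_add_left[OF d w u])
  also have "minus_Delta N \<gamma> w u = cnj (minus_Delta N \<gamma> d w + minus_Delta N \<gamma> w w)"
    unfolding minus_Delta_add_left[OF d w w, symmetric] u_eq[symmetric] by (simp add: minus_Delta_cnj)
  finally have "Re (minus_Delta N \<gamma> u u) - Re (minus_Delta N \<gamma> w w) = Re (minus_Delta N \<gamma> d u + minus_Delta N \<gamma> d w)"
    by simp
  also have "\<bar>\<dots>\<bar> \<le> cmod (minus_Delta N \<gamma> d u) + cmod (minus_Delta N \<gamma> d w)"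
    by (rule order_trans[OF abs_Re_le_cmod norm_triangle_ineq])
  also have "\<dots> \<le> (1 + \<bar>\<gamma>\<bar>) * (H1_norm N d * R) + (1 + \<bar>\<gamma>\<bar>) * (H1_norm N d * R)"
    by (intro add_mono order_trans[OF minus_Delta_le] mult_left_mono u w d R N) auto
  finally show ?thesis by (simp add: d_def algebra_simps)
qed

lemma X_dist_components:
  shows "H1_norm N (\<lambda>e x. fst p e x - fst r e x) \<le> X_dist N p r"
    and "H1_norm N (\<lambda>e x. snd p e x - snd r e x) \<le> X_dist N p r"
  by (simp_all add: X_dist_def X_norm_def real_le_rsqrt)

section \<open>The standing wave as a solution of the system\<close>

lemma dual_norm_abs_le:
  assumes "\<And>w. w \<in> H1_graph N \<Longrightarrow> cmod (F w) \<le> B * H1_norm N w" and "0 \<le> B"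
  shows "\<bar>dual_norm N F\<bar> \<le> B"
proof -
  define S where "S = {w \<in> H1_graph N. H1_norm N w \<le> 1}"
  \<comment> \<open>The zero function makes the supremum one over a nonempty set and bounds it
    below, which gives control of the absolute value.\<close>
  have z: "(\<lambda>e x. 0) \<in> S"
    unfolding S_def by (auto simp: H1_norm_zero intro!: H1_graphI H1I[of _ "\<lambda>x. 0"])
      (simp_all add: L2_iff primitive_def set_integrable_def)
  have le: "cmod (F w) \<le> B" if "w \<in> S" for w
    using assms(1)[of w] mult_left_mono[of "H1_norm N w" 1 B] assms(2) that by (auto simp: S_def)
  have "dual_norm N F \<le> B" unfolding dual_norm_def S_def[symmetric] using z le by (intro cSUP_least) auto
  moreover have "cmod (F (\<lambda>e x. 0)) \<le> dual_norm N F"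
    unfolding dual_norm_def S_def[symmetric] by (rule cSUP_upper[OF z]) (auto intro!: bdd_aboveI2[of _ _ B] le)
  ultimately show ?thesis using norm_ge_zero[of "F (\<lambda>e x. 0)"] by linarith
qed

lemma L2_inner_H1_dual:
  assumes z: "z \<in> H1_graph N" shows "L2_inner N z \<in> H1_dual N"
  unfolding H1_dual_def
proof (intro CollectI conjI ballI allI)
  show "L2_inner N z (\<lambda>e x. w e x + y e x) = L2_inner N z w + L2_inner N z y"
    if "w \<in> H1_graph N" "y \<in> H1_graph N" for w y
    by (rule L2_inner_add_right) (intro H1_graph_L2 that z)+
  show "L2_inner N z (\<lambda>e x. k * w e x) = cnj k * L2_inner N z w" for k w by (rule L2_inner_scale_right)
  show "\<exists>C. \<forall>w\<in>H1_graph N. cmod (L2_inner N z w) \<le> C * H1_norm N w" using L2_inner_le[OF z] by blast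
qed

text \<open>The curve stays in one complex line, so dual norms of its increments are at most a
  scalar modulus times a fixed norm. This supplies the regularity that a solution must have.\<close>

lemma C1_dual_scalar_multiple:
  assumes z: "z \<in> H1_graph N" and d: "\<And>t. (f has_vector_derivative f' t) (at t)" and c: "\<And>t. isCont f' t"
  shows "C1_dual N (\<lambda>t e x. f t * z e x) (\<lambda>t. L2_inner N (\<lambda>e x. f' t * z e x))"
proof -
  have bound: "\<bar>dual_norm N (\<lambda>w. k * L2_inner N z w)\<bar> \<le> cmod k * H1_norm N z" for k
    using L2_inner_le[OF z] by (intro dual_norm_abs_le) (auto simp: norm_mult mult.assoc intro!: mult_left_mono)
  have lim: "((\<lambda>s. dual_norm N (\<lambda>w. k s * L2_inner N z w)) \<longlongrightarrow> 0) (at t)" if "(k \<longlongrightarrow> 0) (at t)" for k and t :: real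
  proof (rule Lim_null_comparison)
    show "\<forall>\<^sub>F s in at t. norm (dual_norm N (\<lambda>w. k s * L2_inner N z w)) \<le> cmod (k s) * H1_norm N z"
      using bound by (intro always_eventually) simp
    show "((\<lambda>s. cmod (k s) * H1_norm N z) \<longlongrightarrow> 0) (at t)"
      using tendsto_mult_right[OF tendsto_norm_zero[OF that], of "H1_norm N z"] by simp
  qed
  show ?thesis
    unfolding C1_dual_def
  proof (intro conjI allI)
    fix t
    show "L2_inner N (\<lambda>e x. f' t * z e x) \<in> H1_dual N" by (rule L2_inner_H1_dual[OF H1_graph_scale[OF z]])
    have "((\<lambda>s. (f s - f t) / of_real (s - t) - f' t) \<longlongrightarrow> 0) (at t)"
      by (rule LIM_zero[OF iffD1[OF has_vector_derivative_iff_quotient d]])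
    note l = lim[OF this]
    have e: "(\<lambda>w. (L2_inner N (\<lambda>e x. f s * z e x) w - L2_inner N (\<lambda>e x. f t * z e x) w) / of_real (s - t)
       - L2_inner N (\<lambda>e x. f' t * z e x) w) = (\<lambda>w. ((f s - f t) / of_real (s - t) - f' t) * L2_inner N z w)" for s
      unfolding L2_inner_scale_left by (simp add: left_diff_distrib diff_divide_distrib)
    show "((\<lambda>s. dual_norm N (\<lambda>w. (L2_inner N (\<lambda>e x. f s * z e x) w - L2_inner N (\<lambda>e x. f t * z e x) w) / of_real (s - t)
       - L2_inner N (\<lambda>e x. f' t * z e x) w)) \<longlongrightarrow> 0) (at t)"
      unfolding e by (rule l)
    have "((\<lambda>s. f' s - f' t) \<longlongrightarrow> 0) (at t)" using c[of t] by (intro LIM_zero) (simp add: isCont_def)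
    note l = lim[OF this]
    have e: "(\<lambda>w. L2_inner N (\<lambda>e x. f' s * z e x) w - L2_inner N (\<lambda>e x. f' t * z e x) w)
       = (\<lambda>w. (f' s - f' t) * L2_inner N z w)" for s
      unfolding L2_inner_scale_left by (simp add: left_diff_distrib)
    show "((\<lambda>s. dual_norm N (\<lambda>w. L2_inner N (\<lambda>e x. f' s * z e x) w - L2_inner N (\<lambda>e x. f' t * z e x) w)) \<longlongrightarrow> 0) (at t)"
      unfolding e by (rule l)
  qed
qed

context star_soliton begin

text \<open>The amplitude equations turn both cubic terms into the same \<phi>^3 times the scalar
  factor of the component, so both equations reduce to the scalar one for the soliton.\<close>

lemma standing_wave_solution:
  assumes k: "a * k1\<^sup>2 + b * k2\<^sup>2 = 1" "b * k1\<^sup>2 + c * k2\<^sup>2 = 1"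
  shows "global_solution N \<gamma> a b c (\<lambda>t e x. cis (\<omega> * t) * (of_real k1 * \<Phi> e x)) (\<lambda>t e x. cis (\<omega> * t) * (of_real k2 * \<Phi> e x))"
proof -
  define f where "f k t = cis (\<omega> * t) * complex_of_real k" for k t
  define f' where "f' k t = \<i> * of_real \<omega> * cis (\<omega> * t) * complex_of_real k" for k t
  have shape: "(\<lambda>t e x. cis (\<omega> * t) * (of_real k * \<Phi> e x)) = (\<lambda>t e x. f k t * \<Phi> e x)" for k
    by (simp add: f_def mult.assoc)
  have d: "(f k has_vector_derivative f' k t) (at t)" for k t
  proof -
    have "((\<lambda>t. cis (\<omega> * t) * complex_of_real k) has_derivative (\<lambda>h. (\<omega> * h) *\<^sub>R (\<i> * cis (\<omega> * t)) * of_real k)) (at t)"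
      by (intro has_derivative_mult_left has_derivative_cis has_derivative_mult_right has_derivative_ident)
    moreover have "(\<omega> * h) *\<^sub>R (\<i> * cis (\<omega> * t)) * of_real k = h *\<^sub>R f' k t" for h
      by (simp add: f'_def scaleR_conv_of_real)
    ultimately show ?thesis unfolding has_vector_derivative_def f_def by simp
  qed
  have c: "isCont (f' k) t" for k t
  proof -
    have "isCont (f k) t" using has_vector_derivative_continuous[OF d] .
    then have "isCont (\<lambda>t. \<i> * of_real \<omega> * f k t) t" by (intro continuous_intros)
    moreover have "(\<lambda>t. \<i> * of_real \<omega> * f k t) = f' k" by (simp add: f'_def f_def mult.assoc fun_eq_iff)
    ultimately show ?thesis by simp
  qed
  have X: "((\<lambda>s. X_dist N (\<lambda>e x. f k1 s * \<Phi> e x, \<lambda>e x. f k2 s * \<Phi> e x) (\<lambda>e x. f k1 t * \<Phi> e x, \<lambda>e x. f k2 t * \<Phi> e x)) \<longlongrightarrow> 0) (at t)" for t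
  proof -
    have "X_dist N (\<lambda>e x. f k1 s * \<Phi> e x, \<lambda>e x. f k2 s * \<Phi> e x) (\<lambda>e x. f k1 t * \<Phi> e x, \<lambda>e x. f k2 t * \<Phi> e x)
      = sqrt ((cmod (f k1 s - f k1 t) * H1_norm N \<Phi>)\<^sup>2 + (cmod (f k2 s - f k2 t) * H1_norm N \<Phi>)\<^sup>2)" for s
      by (simp add: X_dist_def X_norm_def left_diff_distrib[symmetric] H1_norm_scale[OF \<Phi>_H1])
    moreover have "((\<lambda>s. sqrt ((cmod (f k1 s - f k1 t) * H1_norm N \<Phi>)\<^sup>2 + (cmod (f k2 s - f k2 t) * H1_norm N \<Phi>)\<^sup>2))
      \<longlongrightarrow> sqrt ((cmod (f k1 t - f k1 t) * H1_norm N \<Phi>)\<^sup>2 + (cmod (f k2 t - f k2 t) * H1_norm N \<Phi>)\<^sup>2)) (at t)"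
      using has_vector_derivative_continuous[OF d] by (intro tendsto_intros) (simp_all add: isCont_def)
    ultimately show ?thesis by simp
  qed
  have eq: "\<i> * L2_inner N (\<lambda>e x. f' k t * \<Phi> e x) w - minus_Delta N \<gamma> (\<lambda>e x. f k t * \<Phi> e x) w
      + L2_inner N (cubic p r (\<lambda>e x. f k t * \<Phi> e x) (\<lambda>e x. f l t * \<Phi> e x)) w = 0"
    if w: "w \<in> H1_graph N" and pr: "p * k\<^sup>2 + r * l\<^sup>2 = 1" for k l p r t w
  proof -
    have nf: "(cmod (f k t * \<Phi> e x))\<^sup>2 = k\<^sup>2 * (\<phi> x)\<^sup>2" for k e x
      by (simp add: f_def \<Phi>_def norm_mult power_mult_distrib)
    have "cubic p r (\<lambda>e x. f k t * \<Phi> e x) (\<lambda>e x. f l t * \<Phi> e x) = (\<lambda>e x. f k t * of_real ((\<phi> x) ^ 3))"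
    proof (intro ext)
      fix e x
      have "p * (k\<^sup>2 * (\<phi> x)\<^sup>2) + r * (l\<^sup>2 * (\<phi> x)\<^sup>2) = (p * k\<^sup>2 + r * l\<^sup>2) * (\<phi> x)\<^sup>2" by (simp add: algebra_simps)
      then have "p * (k\<^sup>2 * (\<phi> x)\<^sup>2) + r * (l\<^sup>2 * (\<phi> x)\<^sup>2) = (\<phi> x)\<^sup>2" using pr by simp
      then show "cubic p r (\<lambda>e x. f k t * \<Phi> e x) (\<lambda>e x. f l t * \<Phi> e x) e x = f k t * of_real ((\<phi> x) ^ 3)"
        unfolding cubic_def nf by (simp add: \<Phi>_def power2_eq_square power3_eq_cube)
    qed
    then have 1: "L2_inner N (cubic p r (\<lambda>e x. f k t * \<Phi> e x) (\<lambda>e x. f l t * \<Phi> e x)) w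
      = f k t * L2_inner N (\<lambda>e x. of_real ((\<phi> x) ^ 3)) w" by (simp add: L2_inner_scale_left)
    have c3: "cubic 1 0 \<Phi> \<Phi> = (\<lambda>e x. of_real ((\<phi> x) ^ 3))"
      by (simp add: cubic_def \<Phi>_def fun_eq_iff power2_eq_square power3_eq_cube)
    have "L2_inner N (\<lambda>e x. of_real ((\<phi> x) ^ 3 - \<omega> * \<phi> x)) w = L2_inner N (\<lambda>e x. cubic 1 0 \<Phi> \<Phi> e x - of_real \<omega> * \<Phi> e x) w"
      unfolding c3 by (simp add: \<Phi>_def)
    also have "\<dots> = L2_inner N (cubic 1 0 \<Phi> \<Phi>) w - of_real \<omega> * L2_inner N \<Phi> w"
      unfolding L2_inner_scale_left[symmetric]
      by (rule L2_inner_diff_left[OF cubic_L2[OF \<Phi>_H1 \<Phi>_H1] H1_graph_L2[OF H1_graph_scale[OF \<Phi>_H1]] H1_graph_L2[OF w]])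
    finally have 2: "minus_Delta N \<gamma> (\<lambda>e x. f k t * \<Phi> e x) w
      = f k t * (L2_inner N (\<lambda>e x. of_real ((\<phi> x) ^ 3)) w - of_real \<omega> * L2_inner N \<Phi> w)"
      unfolding minus_Delta_scale_left[OF \<Phi>_H1 w] standing_wave_equation[OF w] c3 by simp
    have 3: "\<i> * L2_inner N (\<lambda>e x. f' k t * \<Phi> e x) w = - of_real \<omega> * f k t * L2_inner N \<Phi> w"
    proof -
      have "\<i> * f' k t = (\<i> * \<i>) * (of_real \<omega> * f k t)" by (simp only: f'_def f_def mult.assoc mult.left_commute)
      then have "\<i> * f' k t = - of_real \<omega> * f k t" by simp
      then show ?thesis unfolding L2_inner_scale_left by (metis mult.assoc)
    qed
    show ?thesis unfolding 1 2 3 by (simp add: algebra_simps)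
  qed
  have k': "c * k2\<^sup>2 + b * k1\<^sup>2 = 1" using k(2) by simp
  show ?thesis
    unfolding global_solution_def shape
  proof (intro conjI allI exI ballI)
    show "(\<lambda>e x. f k1 t * \<Phi> e x) \<in> H1_graph N" "(\<lambda>e x. f k2 t * \<Phi> e x) \<in> H1_graph N" for t
      by (rule H1_graph_scale[OF \<Phi>_H1])+
    show "C1_dual N (\<lambda>t e x. f k1 t * \<Phi> e x) (\<lambda>t. L2_inner N (\<lambda>e x. f' k1 t * \<Phi> e x))"
      "C1_dual N (\<lambda>t e x. f k2 t * \<Phi> e x) (\<lambda>t. L2_inner N (\<lambda>e x. f' k2 t * \<Phi> e x))"
      by (rule C1_dual_scalar_multiple[OF \<Phi>_H1 d c])+
  qed (use X eq[OF _ k(1)] eq[OF _ k'] in auto)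
qed

end

section \<open>Orbital stability\<close>

lemma H1_curve_scale:
  assumes "H1_curve N u" shows "H1_curve N (\<lambda>t e x. k * u t e x)"
  unfolding H1_curve_def
proof (intro conjI allI)
  have uH: "u t \<in> H1_graph N" for t using assms by (simp add: H1_curve_def)
  show "(\<lambda>e x. k * u t e x) \<in> H1_graph N" for t by (rule H1_graph_scale[OF uH])
  show "((\<lambda>s. H1_norm N (\<lambda>e x. k * u s e x - k * u t e x)) \<longlongrightarrow> 0) (at t)" for t
  proof -
    have "((\<lambda>s. cmod k * H1_norm N (\<lambda>e x. u s e x - u t e x)) \<longlongrightarrow> cmod k * 0) (at t)"
      using assms by (intro tendsto_intros) (simp add: H1_curve_def)
    then show ?thesis
      by (simp add: right_diff_distrib[symmetric] H1_norm_scale[OF H1_graph_diff[OF uH uH]])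
  qed
qed

lemma global_solution_flow:
  assumes N: "1 \<le> N" and g: "global_solution N \<gamma> a b c u v"
  obtains du dv where "nls_flow N \<gamma> a b c u v du dv"
proof -
  have uH: "u t \<in> H1_graph N" "v t \<in> H1_graph N" for t using g by (simp_all add: global_solution_def)
  have X: "((\<lambda>s. X_dist N (u s, v s) (u t, v t)) \<longlongrightarrow> 0) (at t)" for t using g by (simp add: global_solution_def)
  have u: "H1_curve N u" and v: "H1_curve N v"
    unfolding H1_curve_def
    using X_dist_components(1)[where p="(u s, v s)" and r="(u t, v t)" for s t]
      X_dist_components(2)[where p="(u s, v s)" and r="(u t, v t)" for s t]
    by (auto intro!: uH Lim_null_comparison[OF _ X] always_eventually)
  obtain du dv where "C1_dual N u du" "C1_dual N v dv" and eq:
    "\<forall>t. \<forall>w\<in>H1_graph N.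
           \<i> * du t w - minus_Delta N \<gamma> (u t) w + L2_inner N (cubic a b (u t) (v t)) w = 0 \<and>
           \<i> * dv t w - minus_Delta N \<gamma> (v t) w + L2_inner N (cubic c b (v t) (u t)) w = 0"
    using g unfolding global_solution_def by blast
  then show thesis using N u v by (intro that[of du dv]) (unfold_locales, auto)
qed

context star_soliton begin

lemma phase_dist_\<Phi>: "phase_dist \<Phi> = 0"
proof -
  have "phase (\<Phi> 1 0) = 1" using \<phi>_pos[of 0] by (simp add: \<Phi>_def phase_def sgn_eq)
  then show ?thesis by (simp add: phase_dist_def H1_norm_zero)
qed

lemma phase_dist_nonneg: "0 \<le> phase_dist U"
  by (simp add: phase_dist_def)

lemma truncated_phase_dist_continuous:
  assumes u: "H1_curve N u" and \<rho>: "0 < \<rho>" "\<rho> \<le> \<phi> 0 / 2"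
  shows "isCont (\<lambda>t. min (phase_dist (u t)) \<rho>) t"
  unfolding isCont_def
proof (rule LIM_zero_cancel, rule Lim_null_comparison)
  have uH: "u t \<in> H1_graph N" for t using u by (simp add: H1_curve_def)
  define L where "L = 2 + 4 * H1_norm N \<Phi> / \<phi> 0"
  have "((\<lambda>s. L * H1_norm N (\<lambda>e x. u s e x - u t e x)) \<longlongrightarrow> L * 0) (at t)"
    using u by (intro tendsto_intros) (simp add: H1_curve_def)
  then show "((\<lambda>s. L * H1_norm N (\<lambda>e x. u s e x - u t e x)) \<longlongrightarrow> 0) (at t)" by simp
  have "\<bar>min (phase_dist (u s)) \<rho> - min (phase_dist (u t)) \<rho>\<bar> \<le> L * H1_norm N (\<lambda>e x. u s e x - u t e x)" for s
    using phase_dist_lipschitz[OF uH uH \<rho>, of s t] phase_dist_lipschitz[OF uH uH \<rho>, of t s]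
      H1_norm_diff_commute[OF uH uH, of s t] unfolding L_def[symmetric] by simp
  then show "\<forall>\<^sub>F s in at t. norm (min (phase_dist (u s)) \<rho> - min (phase_dist (u t)) \<rho>)
      \<le> L * H1_norm N (\<lambda>e x. u s e x - u t e x)"
    by (intro always_eventually) simp
qed

text \<open>The unit factor read off at the vertex becomes an angle, so that
  \<open>phase_dist\<close> can bound the infimum over rotations.\<close>

lemma phase_rotate_dist:
  assumes u: "u \<in> H1_graph N" and k: "0 < k"
  obtains \<theta> where "H1_norm N (\<lambda>e x. u e x - phase_rotate \<theta> (\<lambda>e x. of_real k * \<Phi> e x) e x)
    = k * phase_dist (\<lambda>e x. of_real (1 / k) * u e x)"
proof -
  define z where "z = phase (of_real (1 / k) * u 1 0)"
  have n: "cmod z = 1" unfolding z_def by (rule cmod_phase)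
  then have "z \<noteq> 0" by auto
  with n have z: "cis (Arg z) = z" by (simp add: cis_Arg sgn_eq)
  have "(\<lambda>e x. u e x - phase_rotate (Arg z) (\<lambda>e x. of_real k * \<Phi> e x) e x)
    = (\<lambda>e x. of_real k * (of_real (1 / k) * u e x - z * \<Phi> e x))"
    using k by (simp add: phase_rotate_def z right_diff_distrib fun_eq_iff)
  then have "H1_norm N (\<lambda>e x. u e x - phase_rotate (Arg z) (\<lambda>e x. of_real k * \<Phi> e x) e x)
    = cmod (of_real k) * H1_norm N (\<lambda>e x. of_real (1 / k) * u e x - z * \<Phi> e x)"
    by (simp only: H1_norm_scale[OF H1_graph_diff[OF H1_graph_scale[OF u] H1_graph_scale[OF \<Phi>_H1]]])
  then show thesis using k by (intro that[of "Arg z"]) (simp add: phase_dist_def z_def)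
qed

text \<open>Where the weighted squared distance G is below r, coercivity and the conservation laws
  force it down to \<tau> \<le> r/2. The values strictly between r/2 and r are therefore never
  taken, and a continuous G that starts below r cannot leave.\<close>

lemma orbitally_stable_standing_wave:
  assumes k: "0 < k1" "0 < k2" "a * k1\<^sup>2 + b * k2\<^sup>2 = 1" "b * k1\<^sup>2 + c * k2\<^sup>2 = 1" "0 < b"
  shows "orbitally_stable N \<gamma> a b c (\<lambda>e x. of_real k1 * \<Phi> e x) (\<lambda>e x. of_real k2 * \<Phi> e x)"
  unfolding orbitally_stable_def
proof (intro allI impI)
  fix \<epsilon> :: real assume \<epsilon>: "0 < \<epsilon>"
  obtain \<kappa> \<rho> C where \<kappa>: "0 < \<kappa>" and \<rho>: "0 < \<rho>" "\<rho> \<le> \<phi> 0 / 2" and C: "0 \<le> C" and coercive: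
    "\<And>U. U \<in> H1_graph N \<Longrightarrow> phase_dist U \<le> \<rho> \<Longrightarrow> \<bar>mass N U - mass N \<Phi>\<bar> \<le> 1 \<Longrightarrow>
      \<kappa> * (phase_dist U)\<^sup>2 \<le> scalar_energy N \<gamma> U - scalar_energy N \<gamma> \<Phi> + C * \<bar>mass N U - mass N \<Phi>\<bar>"
    using scalar_coercive by metis
  define \<Phi>1 where "\<Phi>1 = (\<lambda>e x. complex_of_real k1 * \<Phi> e x)"
  define \<Phi>2 where "\<Phi>2 = (\<lambda>e x. complex_of_real k2 * \<Phi> e x)"
  have \<Phi>H: "\<Phi>1 \<in> H1_graph N" "\<Phi>2 \<in> H1_graph N" unfolding \<Phi>1_def \<Phi>2_def by (rule H1_graph_scale[OF \<Phi>_H1])+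
  define R where "R = H1_norm N \<Phi>1 + H1_norm N \<Phi>2 + 1"
  have R: "1 \<le> R" "H1_norm N \<Phi>1 \<le> R" "H1_norm N \<Phi>2 \<le> R" "H1_norm N \<Phi>1 + 1 \<le> R" "H1_norm N \<Phi>2 + 1 \<le> R"
    by (simp_all add: R_def)
  define m where "m = min (k1\<^sup>2) (k2\<^sup>2)"
  have m: "0 < m" "m \<le> k1\<^sup>2" "m \<le> k2\<^sup>2" using k by (simp_all add: m_def)
  \<comment> \<open>Since m is the smaller weight, G < r makes both truncated distances smaller than
    \<rho>, so that the truncation is inactive.\<close>
  define r where "r = m * \<rho>\<^sup>2"
  have r: "0 < r" using m \<rho> by (simp add: r_def)
  define \<tau> where "\<tau> = min (r / 2) ((\<epsilon> / 2)\<^sup>2)"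
  have \<tau>: "0 < \<tau>" "\<tau> \<le> r / 2" "\<tau> \<le> (\<epsilon> / 2)\<^sup>2" using r \<epsilon> by (simp_all add: \<tau>_def)
  define L where "L = 2 + 4 * H1_norm N \<Phi> / \<phi> 0"
  have L: "2 \<le> L" using \<phi>_pos[of 0] by (simp add: L_def)
  define KQ where "KQ = 4 * (\<bar>a\<bar> + 2 * \<bar>b\<bar> + \<bar>c\<bar>) * R ^ 3"
  define KE where "KE = 2 * ((1 + \<bar>\<gamma>\<bar>) * (2 * R)) + KQ"
  \<comment> \<open>\<open>KE\<close> bounds the energy defect, the next term the two mass defects
    of size 2 R s each; the summand 1 makes K positive.\<close>
  define K where "K = KE + C * (4 * R) + 1"
  have K: "0 < K" using R C by (simp add: K_def KE_def KQ_def add_nonneg_pos)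
  \<comment> \<open>The four bounds give, in this order: initial data of norm at most R; mass
    defects at most 1; a total defect of at most \<kappa> \<tau>; and G below r at time 0.\<close>
  define \<eta> where "\<eta> = min (min 1 (m / (2 * R))) (min (\<kappa> * \<tau> / K) (r / (4 * L\<^sup>2)))"
  have \<eta>: "0 < \<eta>" "\<eta> \<le> 1" "\<eta> \<le> m / (2 * R)" "\<eta> \<le> \<kappa> * \<tau> / K" "\<eta> \<le> r / (4 * L\<^sup>2)"
    using m R \<kappa> \<tau> K r L by (simp_all add: \<eta>_def)
  have stable: "(SUP t\<in>{0..}. INF \<theta>1. INF \<theta>2.
      ereal (X_dist N (u t, v t) (phase_rotate \<theta>1 \<Phi>1, phase_rotate \<theta>2 \<Phi>2))) < ereal \<epsilon>"
    if close: "X_dist N (u 0, v 0) (\<Phi>1, \<Phi>2) < \<eta>" and sol: "global_solution N \<gamma> a b c u v" for u v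
  proof -
    obtain du dv where "nls_flow N \<gamma> a b c u v du dv" by (rule global_solution_flow[OF N sol])
    then interpret flow: nls_flow N \<gamma> a b c u v du dv .
    interpret sw: nls_flow N \<gamma> c b a v u dv du by (rule flow.swap)
    note uH = flow.uH and vH = flow.vH
    define s where "s = X_dist N (u 0, v 0) (\<Phi>1, \<Phi>2)"
    define d1 where "d1 = H1_norm N (\<lambda>e x. u 0 e x - \<Phi>1 e x)"
    define d2 where "d2 = H1_norm N (\<lambda>e x. v 0 e x - \<Phi>2 e x)"
    have d: "0 \<le> d1" "0 \<le> d2" "d1 \<le> s" "d2 \<le> s"
      using X_dist_components[of N "(u 0, v 0)" "(\<Phi>1, \<Phi>2)"] by (simp_all add: d1_def d2_def s_def)
    have s: "0 \<le> s" "s \<le> \<eta>" using d close by (simp_all add: s_def)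
    have un: "H1_norm N (u 0) \<le> R" "H1_norm N (v 0) \<le> R"
      using H1_norm_le_add_diff[OF uH \<Phi>H(1), of 0] H1_norm_le_add_diff[OF vH \<Phi>H(2), of 0] d s \<eta>(2) R(4,5)
      unfolding d1_def[symmetric] d2_def[symmetric] by linarith+
    define U where "U t = (\<lambda>e x. complex_of_real (1 / k1) * u t e x)" for t
    define V where "V t = (\<lambda>e x. complex_of_real (1 / k2) * v t e x)" for t
    have UH: "U t \<in> H1_graph N" and VH: "V t \<in> H1_graph N" for t
      unfolding U_def V_def by (rule H1_graph_scale[OF uH], rule H1_graph_scale[OF vH])
    \<comment> \<open>The weights undo the rescaling by the amplitudes: where the truncation is
      inactive, G is exactly the squared X-distance to the rotations chosen at the vertex.\<close>
    define G where "G t = k1\<^sup>2 * (min (phase_dist (U t)) \<rho>)\<^sup>2 + k2\<^sup>2 * (min (phase_dist (V t)) \<rho>)\<^sup>2" for t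
    have contG: "isCont G t" for t
      unfolding G_def U_def V_def
      by (intro continuous_intros truncated_phase_dist_continuous H1_curve_scale flow.u flow.v \<rho>)
    have massU: "k1\<^sup>2 * \<bar>mass N (U t) - mass N \<Phi>\<bar> \<le> 2 * R * s" for t
    proof -
      have "k1\<^sup>2 * mass N (U t) = mass N (u t)" "k1\<^sup>2 * mass N \<Phi> = mass N \<Phi>1"
        unfolding U_def \<Phi>1_def mass_scale using k by (simp_all add: norm_divide power_divide)
      then have "k1\<^sup>2 * \<bar>mass N (U t) - mass N \<Phi>\<bar> = \<bar>mass N (u t) - mass N \<Phi>1\<bar>"
        by (metis abs_mult abs_power2 right_diff_distrib)
      also have "\<dots> = \<bar>mass N (u 0) - mass N \<Phi>1\<bar>" using flow.mass_u_conserved[of t 0] by simp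
      also have "\<dots> \<le> 2 * R * d1" unfolding d1_def by (rule mass_diff_le[OF uH \<Phi>H(1) un(1) R(2)])
      also have "\<dots> \<le> 2 * R * s" using d R by (intro mult_left_mono) auto
      finally show ?thesis .
    qed
    have massV: "k2\<^sup>2 * \<bar>mass N (V t) - mass N \<Phi>\<bar> \<le> 2 * R * s" for t
    proof -
      have "k2\<^sup>2 * mass N (V t) = mass N (v t)" "k2\<^sup>2 * mass N \<Phi> = mass N \<Phi>2"
        unfolding V_def \<Phi>2_def mass_scale using k by (simp_all add: norm_divide power_divide)
      then have "k2\<^sup>2 * \<bar>mass N (V t) - mass N \<Phi>\<bar> = \<bar>mass N (v t) - mass N \<Phi>2\<bar>"
        by (metis abs_mult abs_power2 right_diff_distrib)
      also have "\<dots> = \<bar>mass N (v 0) - mass N \<Phi>2\<bar>" using sw.mass_u_conserved[of t 0] by simp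
      also have "\<dots> \<le> 2 * R * d2" unfolding d2_def by (rule mass_diff_le[OF vH \<Phi>H(2) un(2) R(3)])
      also have "\<dots> \<le> 2 * R * s" using d R by (intro mult_left_mono) auto
      finally show ?thesis .
    qed
    have le_m: "2 * R * s \<le> m"
    proof -
      have "s \<le> m / (2 * R)" using s \<eta>(3) by linarith
      then show ?thesis using R(1) by (simp add: pos_le_divide_eq mult.commute)
    qed
    \<comment> \<open>Both weights are at least m, so the bound on the weighted mass defect puts
      each scalar defect below the threshold 1 of the coercivity estimate.\<close>
    have small_mass: "x \<le> 1" if "k * x \<le> 2 * R * s" "m \<le> k" for k x
    proof (rule ccontr)
      assume "\<not> x \<le> 1"
      moreover have "0 < k" using m that by linarith
      ultimately have "k * 1 < k * x" by (intro mult_strict_left_mono) auto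
      then show False using that le_m by linarith
    qed
    have E0: "energy N \<gamma> a b c (u t) (v t) - energy N \<gamma> a b c \<Phi>1 \<Phi>2 \<le> KE * s" for t
    proof -
      have "Re (minus_Delta N \<gamma> (u 0) (u 0)) - Re (minus_Delta N \<gamma> \<Phi>1 \<Phi>1) \<le> (1 + \<bar>\<gamma>\<bar>) * (2 * R * d1)"
        using Re_minus_Delta_diff_le[OF uH \<Phi>H(1) un(1) R(2) N, of \<gamma>] unfolding d1_def by linarith
      also have "\<dots> \<le> (1 + \<bar>\<gamma>\<bar>) * (2 * R * s)" using d R by (intro mult_left_mono) auto
      finally have 1: "Re (minus_Delta N \<gamma> (u 0) (u 0)) - Re (minus_Delta N \<gamma> \<Phi>1 \<Phi>1) \<le> (1 + \<bar>\<gamma>\<bar>) * (2 * R * s)" .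
      have "Re (minus_Delta N \<gamma> (v 0) (v 0)) - Re (minus_Delta N \<gamma> \<Phi>2 \<Phi>2) \<le> (1 + \<bar>\<gamma>\<bar>) * (2 * R * d2)"
        using Re_minus_Delta_diff_le[OF vH \<Phi>H(2) un(2) R(3) N, of \<gamma>] unfolding d2_def by linarith
      also have "\<dots> \<le> (1 + \<bar>\<gamma>\<bar>) * (2 * R * s)" using d R by (intro mult_left_mono) auto
      finally have 2: "Re (minus_Delta N \<gamma> (v 0) (v 0)) - Re (minus_Delta N \<gamma> \<Phi>2 \<Phi>2) \<le> (1 + \<bar>\<gamma>\<bar>) * (2 * R * s)" .
      have "\<bar>quartic N a b c (u 0) (v 0) - quartic N a b c \<Phi>1 \<Phi>2\<bar> \<le> 4 * (\<bar>a\<bar> + 2 * \<bar>b\<bar> + \<bar>c\<bar>) * R ^ 3 * (d1 + d2)"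
        unfolding d1_def d2_def by (rule quartic_lipschitz[OF uH vH \<Phi>H un R(2,3)])
      also have "\<dots> \<le> 4 * (\<bar>a\<bar> + 2 * \<bar>b\<bar> + \<bar>c\<bar>) * R ^ 3 * (s + s)" using d R by (intro mult_left_mono) auto
      finally have 3: "- (quartic N a b c (u 0) (v 0) - quartic N a b c \<Phi>1 \<Phi>2) \<le> KQ * s + KQ * s"
        unfolding KQ_def distrib_left by linarith
      have "energy N \<gamma> a b c (u t) (v t) = energy N \<gamma> a b c (u 0) (v 0)" by (rule flow.energy_conserved)
      moreover have "KE * s = (1 + \<bar>\<gamma>\<bar>) * (2 * R * s) + (1 + \<bar>\<gamma>\<bar>) * (2 * R * s) + KQ * s"
        by (simp add: KE_def algebra_simps)
      ultimately show ?thesis using 1 2 3 unfolding energy_def by linarith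
    qed
    \<comment> \<open>The coercivity estimates for U and V are added with weights
      \<open>k1\<^sup>2\<close> and \<open>k2\<^sup>2\<close>. The scalar energies of U and V are
      bounded by the system energy, while equality at the standing wave keeps the constant term
      exact.\<close>
    have trap: "G t \<le> \<tau> \<and> phase_dist (U t) < \<rho> \<and> phase_dist (V t) < \<rho>" if "G t < r" for t
    proof -
      have "m * (min (phase_dist (U t)) \<rho>)\<^sup>2 \<le> k1\<^sup>2 * (min (phase_dist (U t)) \<rho>)\<^sup>2"
        "m * (min (phase_dist (V t)) \<rho>)\<^sup>2 \<le> k2\<^sup>2 * (min (phase_dist (V t)) \<rho>)\<^sup>2"
        using m by (intro mult_right_mono; simp)+
      moreover have "0 \<le> k1\<^sup>2 * (min (phase_dist (U t)) \<rho>)\<^sup>2" "0 \<le> k2\<^sup>2 * (min (phase_dist (V t)) \<rho>)\<^sup>2" by simp_all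
      ultimately have "m * (min (phase_dist (U t)) \<rho>)\<^sup>2 < m * \<rho>\<^sup>2" "m * (min (phase_dist (V t)) \<rho>)\<^sup>2 < m * \<rho>\<^sup>2"
        using that unfolding G_def r_def by linarith+
      then have "(min (phase_dist (U t)) \<rho>)\<^sup>2 < \<rho>\<^sup>2" "(min (phase_dist (V t)) \<rho>)\<^sup>2 < \<rho>\<^sup>2" using m by simp_all
      then have "min (phase_dist (U t)) \<rho> < \<rho>" "min (phase_dist (V t)) \<rho> < \<rho>"
        using \<rho>(1) power2_less_imp_less less_imp_le by metis+
      then have n: "phase_dist (U t) < \<rho>" "phase_dist (V t) < \<rho>" by (simp_all add: min_less_iff_disj)
      have 1: "\<kappa> * (phase_dist (U t))\<^sup>2 \<le> scalar_energy N \<gamma> (U t) - scalar_energy N \<gamma> \<Phi> + C * \<bar>mass N (U t) - mass N \<Phi>\<bar>"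
        by (rule coercive[OF UH less_imp_le[OF n(1)] small_mass[OF massU m(2)]])
      have 2: "\<kappa> * (phase_dist (V t))\<^sup>2 \<le> scalar_energy N \<gamma> (V t) - scalar_energy N \<gamma> \<Phi> + C * \<bar>mass N (V t) - mass N \<Phi>\<bar>"
        by (rule coercive[OF VH less_imp_le[OF n(2)] small_mass[OF massV m(3)]])
      have "\<kappa> * G t = k1\<^sup>2 * (\<kappa> * (phase_dist (U t))\<^sup>2) + k2\<^sup>2 * (\<kappa> * (phase_dist (V t))\<^sup>2)"
        using n by (simp add: G_def algebra_simps)
      also have "\<dots> \<le> k1\<^sup>2 * (scalar_energy N \<gamma> (U t) - scalar_energy N \<gamma> \<Phi> + C * \<bar>mass N (U t) - mass N \<Phi>\<bar>)
         + k2\<^sup>2 * (scalar_energy N \<gamma> (V t) - scalar_energy N \<gamma> \<Phi> + C * \<bar>mass N (V t) - mass N \<Phi>\<bar>)"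
        using 1 2 by (intro add_mono mult_left_mono) auto
      also have "\<dots> = (k1\<^sup>2 * scalar_energy N \<gamma> (U t) + k2\<^sup>2 * scalar_energy N \<gamma> (V t)) - (k1\<^sup>2 + k2\<^sup>2) * scalar_energy N \<gamma> \<Phi>
         + (C * (k1\<^sup>2 * \<bar>mass N (U t) - mass N \<Phi>\<bar>) + C * (k2\<^sup>2 * \<bar>mass N (V t) - mass N \<Phi>\<bar>))"
        by (simp add: algebra_simps)
      also have "\<dots> \<le> (energy N \<gamma> a b c (u t) (v t) - energy N \<gamma> a b c \<Phi>1 \<Phi>2) + (C * (2 * R * s) + C * (2 * R * s))"
      proof (intro add_mono mult_left_mono massU massV C diff_mono)
        show "k1\<^sup>2 * scalar_energy N \<gamma> (U t) + k2\<^sup>2 * scalar_energy N \<gamma> (V t) \<le> energy N \<gamma> a b c (u t) (v t)"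
          unfolding U_def V_def by (rule energy_ge_scalar[OF uH vH k])
        show "energy N \<gamma> a b c \<Phi>1 \<Phi>2 \<le> (k1\<^sup>2 + k2\<^sup>2) * scalar_energy N \<gamma> \<Phi>"
          unfolding \<Phi>1_def \<Phi>2_def energy_proportional[OF \<Phi>_H1 k(3,4)] by simp
      qed
      also have "\<dots> \<le> K * s" using E0[of t] s(1) unfolding K_def distrib_right by (simp add: algebra_simps)
      also have "\<dots> \<le> \<kappa> * \<tau>"
      proof -
        have "s \<le> \<kappa> * \<tau> / K" using s \<eta>(4) by linarith
        then show ?thesis by (simp only: pos_le_divide_eq[OF K] mult.commute)
      qed
      finally have "G t \<le> \<tau>" using \<kappa> by simp
      with n show ?thesis by simp
    qed
    have "G 0 < r"
    proof -
      have dist_le: "kk * min (phase_dist (\<lambda>e x. complex_of_real (1 / kk) * w e x)) \<rho> \<le> L * s"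
        if kk: "0 < kk" and w: "w \<in> H1_graph N" and ws: "H1_norm N (\<lambda>e x. w e x - of_real kk * \<Phi> e x) \<le> s" for kk w
      proof -
        have "(\<lambda>e x. complex_of_real (1 / kk) * w e x - \<Phi> e x) = (\<lambda>e x. of_real (1 / kk) * (w e x - of_real kk * \<Phi> e x))"
          using kk by (simp add: right_diff_distrib)
        then have "H1_norm N (\<lambda>e x. complex_of_real (1 / kk) * w e x - \<Phi> e x)
           = cmod (complex_of_real (1 / kk)) * H1_norm N (\<lambda>e x. w e x - of_real kk * \<Phi> e x)"
          by (simp only: H1_norm_scale[OF H1_graph_diff[OF w H1_graph_scale[OF \<Phi>_H1]]])
        then have e: "kk * H1_norm N (\<lambda>e x. complex_of_real (1 / kk) * w e x - \<Phi> e x)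
           = H1_norm N (\<lambda>e x. w e x - of_real kk * \<Phi> e x)" using kk by (simp add: norm_divide)
        have "min (phase_dist (\<lambda>e x. complex_of_real (1 / kk) * w e x)) \<rho>
          \<le> L * H1_norm N (\<lambda>e x. complex_of_real (1 / kk) * w e x - \<Phi> e x)"
          using phase_dist_lipschitz[OF H1_graph_scale[OF w] \<Phi>_H1 \<rho>, of "complex_of_real (1 / kk)"] \<rho>(1)
          unfolding L_def[symmetric] phase_dist_\<Phi> by simp
        then have "kk * min (phase_dist (\<lambda>e x. complex_of_real (1 / kk) * w e x)) \<rho>
          \<le> kk * (L * H1_norm N (\<lambda>e x. complex_of_real (1 / kk) * w e x - \<Phi> e x))"
          using kk by (intro mult_left_mono) auto
        also have "\<dots> = L * H1_norm N (\<lambda>e x. w e x - of_real kk * \<Phi> e x)" unfolding e[symmetric] by simp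
        also have "\<dots> \<le> L * s" using ws L by (intro mult_left_mono) auto
        finally show ?thesis .
      qed
      have "k1 * min (phase_dist (U 0)) \<rho> \<le> L * s" "k2 * min (phase_dist (V 0)) \<rho> \<le> L * s"
        unfolding U_def V_def using d
        by (intro dist_le k uH vH; simp add: d1_def d2_def \<Phi>1_def \<Phi>2_def)+
      then have "(k1 * min (phase_dist (U 0)) \<rho>)\<^sup>2 \<le> (L * s)\<^sup>2" "(k2 * min (phase_dist (V 0)) \<rho>)\<^sup>2 \<le> (L * s)\<^sup>2"
        using k \<rho> phase_dist_nonneg by (auto intro!: power_mono mult_nonneg_nonneg)
      then have "G 0 \<le> (L * s)\<^sup>2 + (L * s)\<^sup>2" unfolding G_def power_mult_distrib by (rule add_mono)
      also have "\<dots> = 2 * L\<^sup>2 * (s * s)" by (simp add: power2_eq_square)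
      also have "\<dots> \<le> 2 * L\<^sup>2 * (r / (4 * L\<^sup>2))"
      proof (intro mult_left_mono)
        have "s * s \<le> s * 1" using s \<eta>(2) by (intro mult_left_mono) auto
        then show "s * s \<le> r / (4 * L\<^sup>2)" using s \<eta>(5) by linarith
      qed simp
      also have "\<dots> = r / 2" using L by simp
      also have "\<dots> < r" using r by simp
      finally show ?thesis .
    qed
    \<comment> \<open>The level 3 r/4 lies strictly between r/2 and r, hence in the range that
      \<open>trap\<close> excludes; reaching r would require crossing it.\<close>
    have G: "G t < r" if t: "0 \<le> t" for t
    proof (rule ccontr)
      assume "\<not> G t < r"
      then have "3 * r / 4 \<le> G t" using r by linarith
      moreover have "G 0 \<le> 3 * r / 4" using trap[OF \<open>G 0 < r\<close>] \<tau>(2) r by linarith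
      moreover have "continuous_on {0..t} G" using contG by (simp add: continuous_at_imp_continuous_on)
      ultimately obtain y where "G y = 3 * r / 4" using IVT'[of G 0 "3 * r / 4" t] t by blast
      then show False using trap[of y] \<tau>(2) r by linarith
    qed
    \<comment> \<open>The bound \<epsilon>/2 leaves room, since a supremum of values below
      \<epsilon> could still equal \<epsilon>.\<close>
    have "(INF \<theta>1. INF \<theta>2. ereal (X_dist N (u t, v t) (phase_rotate \<theta>1 \<Phi>1, phase_rotate \<theta>2 \<Phi>2))) \<le> ereal (\<epsilon> / 2)"
      if t: "0 \<le> t" for t
    proof -
      have T: "G t \<le> \<tau>" "phase_dist (U t) < \<rho>" "phase_dist (V t) < \<rho>" using trap[OF G[OF t]] by auto
      obtain \<theta>1 where 1: "H1_norm N (\<lambda>e x. u t e x - phase_rotate \<theta>1 \<Phi>1 e x) = k1 * phase_dist (U t)"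
        using phase_rotate_dist[OF uH[of t] k(1)] unfolding \<Phi>1_def U_def by blast
      obtain \<theta>2 where 2: "H1_norm N (\<lambda>e x. v t e x - phase_rotate \<theta>2 \<Phi>2 e x) = k2 * phase_dist (V t)"
        using phase_rotate_dist[OF vH[of t] k(2)] unfolding \<Phi>2_def V_def by blast
      have "X_dist N (u t, v t) (phase_rotate \<theta>1 \<Phi>1, phase_rotate \<theta>2 \<Phi>2) = sqrt (G t)"
        using T by (simp add: X_dist_def X_norm_def 1 2 G_def power_mult_distrib)
      also have "\<dots> \<le> sqrt ((\<epsilon> / 2)\<^sup>2)" using T \<tau>(3) by (intro real_sqrt_le_mono) linarith
      also have "\<dots> = \<epsilon> / 2" using \<epsilon> by simp
      finally show ?thesis by (intro INF_lower2[of \<theta>1] INF_lower2[of \<theta>2]) auto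
    qed
    then have "(SUP t\<in>{0..}. INF \<theta>1. INF \<theta>2.
      ereal (X_dist N (u t, v t) (phase_rotate \<theta>1 \<Phi>1, phase_rotate \<theta>2 \<Phi>2))) \<le> ereal (\<epsilon> / 2)"
      by (intro SUP_least) auto
    also have "\<dots> < ereal \<epsilon>" using \<epsilon> by simp
    finally show ?thesis .
  qed
  show "\<exists>\<eta>>0. \<forall>u\<^sub>0\<in>H1_graph N. \<forall>v\<^sub>0\<in>H1_graph N.
     X_dist N (u\<^sub>0, v\<^sub>0) (\<lambda>e x. of_real k1 * \<Phi> e x, \<lambda>e x. of_real k2 * \<Phi> e x) < \<eta> \<longrightarrow>
     (\<forall>u v. global_solution N \<gamma> a b c u v \<and> u 0 = u\<^sub>0 \<and> v 0 = v\<^sub>0 \<longrightarrow>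
       (SUP t\<in>{0..}. INF \<theta>1. INF \<theta>2. ereal (X_dist N (u t, v t)
          (phase_rotate \<theta>1 (\<lambda>e x. of_real k1 * \<Phi> e x), phase_rotate \<theta>2 (\<lambda>e x. of_real k2 * \<Phi> e x)))) < ereal \<epsilon>)"
    unfolding \<Phi>1_def[symmetric] \<Phi>2_def[symmetric] using \<eta>(1) stable by blast
qed

end

text \<open>Cramer's rule for a linear system in the squared amplitudes. In the first regime the
  numerators and the determinant are all negative, in the second all positive, so the quotients are
  positive in both.\<close>

lemma amplitude_equations:
  fixes a b c :: real
  assumes "(0 < b \<and> b < min a c) \<or> (a > 0 \<and> c > 0 \<and> b > max a c)"
  defines "k1 \<equiv> sqrt ((b - c) / (b\<^sup>2 - a * c))" and "k2 \<equiv> sqrt ((b - a) / (b\<^sup>2 - a * c))"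
  shows "0 < k1" "0 < k2" "a * k1\<^sup>2 + b * k2\<^sup>2 = 1" "b * k1\<^sup>2 + c * k2\<^sup>2 = 1" "0 < b"
proof -
  have pos: "0 < (b - c) / (b\<^sup>2 - a * c)" "0 < (b - a) / (b\<^sup>2 - a * c)" and nz: "b\<^sup>2 - a * c \<noteq> 0" and b: "0 < b"
  proof -
    consider "0 < b" "b < a" "b < c" | "0 < a" "0 < c" "a < b" "c < b" using assms(1) by auto
    then have "(b - c) / (b\<^sup>2 - a * c) > 0 \<and> (b - a) / (b\<^sup>2 - a * c) > 0 \<and> b\<^sup>2 - a * c \<noteq> 0 \<and> 0 < b"
    proof cases
      case 1
      then have "b * b < a * c" by (intro mult_strict_mono) auto
      then show ?thesis using 1 by (auto simp: power2_eq_square intro!: divide_neg_neg)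
    next
      case 2
      then have "a * c < b * b" by (intro mult_strict_mono) auto
      then show ?thesis using 2 by (auto simp: power2_eq_square)
    qed
    then show "0 < (b - c) / (b\<^sup>2 - a * c)" "0 < (b - a) / (b\<^sup>2 - a * c)" "b\<^sup>2 - a * c \<noteq> 0" "0 < b" by auto
  qed
  then show "0 < k1" "0 < k2" "0 < b" by (simp_all add: k1_def k2_def)
  have sq: "k1\<^sup>2 = (b - c) / (b\<^sup>2 - a * c)" "k2\<^sup>2 = (b - a) / (b\<^sup>2 - a * c)"
    using pos by (simp_all add: k1_def k2_def)
  show "a * k1\<^sup>2 + b * k2\<^sup>2 = 1" "b * k1\<^sup>2 + c * k2\<^sup>2 = 1"
    unfolding sq times_divide_eq_right add_divide_distrib[symmetric] using nz
    by (simp_all add: algebra_simps power2_eq_square)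
qed

text \<open>The first conjunct certifies that the rotating profile is a standing wave of the system,
  which the stability statement by itself does not express.\<close>

theorem corollary2p6:
  fixes N :: nat and \<gamma> a b c \<omega> :: real
  assumes "N \<ge> 2" and "\<gamma> > 0"
    and "(0 < b \<and> b < min a c) \<or> (a > 0 \<and> c > 0 \<and> b > max a c)"
    and "\<omega> > \<gamma>\<^sup>2 / (real N)\<^sup>2"
    and "real N * sqrt \<omega> - \<gamma> \<le> 2 * \<gamma> / real N"
  defines "\<Phi>1 \<equiv> soliton_graph N \<omega> \<gamma> (sqrt ((b - c) / (b\<^sup>2 - a * c)))"
    and "\<Phi>2 \<equiv> soliton_graph N \<omega> \<gamma> (sqrt ((b - a) / (b\<^sup>2 - a * c)))"
  shows "global_solution N \<gamma> a b c (\<lambda>t. phase_rotate (\<omega> * t) \<Phi>1) (\<lambda>t. phase_rotate (\<omega> * t) \<Phi>2)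
       \<and> orbitally_stable N \<gamma> a b c \<Phi>1 \<Phi>2"
proof -
  define q where "q = \<gamma> / real N"
  define k1 where "k1 = sqrt ((b - c) / (b\<^sup>2 - a * c))"
  define k2 where "k2 = sqrt ((b - a) / (b\<^sup>2 - a * c))"
  note k = amplitude_equations[OF assms(3), folded k1_def k2_def]
  have q: "0 < q" "q\<^sup>2 < \<omega>" using assms(1,2,4) by (simp_all add: q_def power_divide)
  \<comment> \<open>The frequency condition \<omega> > \<gamma>^2/N^2 is the condition under which
    the profile with slope ratio q exists: the argument of artanh lies below 1.\<close>
  then have "q < sqrt \<omega>" by (simp add: real_less_rsqrt)
  then interpret star_soliton q \<omega> N \<gamma>
    using q(1) assms(1) by unfold_locales (simp_all add: q_def)
  have profile: "soliton_graph N \<omega> \<gamma> k = (\<lambda>e x. of_real k * \<Phi> e x)" for k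
    unfolding soliton_graph_def soliton_def \<Phi>_def \<phi>_def by (simp add: q_def fun_eq_iff)
  have "global_solution N \<gamma> a b c (\<lambda>t. phase_rotate (\<omega> * t) \<Phi>1) (\<lambda>t. phase_rotate (\<omega> * t) \<Phi>2)"
    using standing_wave_solution[OF k(3,4)]
    by (simp add: \<Phi>1_def \<Phi>2_def profile phase_rotate_def k1_def k2_def)
  moreover have "orbitally_stable N \<gamma> a b c \<Phi>1 \<Phi>2"
    using orbitally_stable_standing_wave[OF k] by (simp add: \<Phi>1_def \<Phi>2_def profile k1_def k2_def)
  ultimately show ?thesis ..
qed

end
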